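(* Let $\delta>0$ and suppose Assumptions 1–3 (stated in the context) hold. There are then estimates $w_n(b)$ of the values $b\in\mathcal L$ with $\left|\int_{-\pi}^{\pi}f_b(\mu)\,d\mu\right|>\delta$ such that $$n\,|w_n(b)-b|<n^{-1/5}$$ except for a set of probability $O(\log n/n^2)$, if $n$ is sufficiently large.
   Context: Setting. $\{X_k\}_{k\in\mathbb Z}$ is a real-valued process with $EX_k\equiv0$. It is harmonizable: $X_k=\int_{-\pi}^{\pi}e^{ik\lambda}\,dZ(\lambda)$ in mean square, where the spectral covariance $F(\lambda,\mu)=\mathrm{cov}(Z(\lambda),Z(\mu))$ satisfies $\int_{-\pi}^{\pi}\int_{-\pi}^{\pi}|dF(\lambda,\mu)|<\infty$. Its covariance function $r_{k,m}=EX_kX_m$ is almost periodic: $r_{s+t,\tau+t}=\sum_j\alpha_j(s,\tau)e^{i\lambda_j(s,\tau)t}$ with real $\lambda_j(s,\tau)$ and $\sum_j|\alpha_j(s,\tau)|<\infty$, the convergence being uniform in $s,\tau$. Then $F$ has mass only on at most countably many lines $\lambda=\mu+b$ (taken mod $2\pi$). The spectra on these lines are absolutely continuous with (complex) spectral densities $f_b(\mu)$, and $\mathcal L$ denotes the collection of $b$'s corresponding to lines with nontrivial spectral support. Thus $$r_{k,m}=\sum_{b\in\mathcal L}\int_{-\pi}^{\pi}e^{ik(\mu+b)}e^{-im\mu}f_b(\mu)\,d\mu=\sum_{b\in\mathcal L}e^{ikb}c_b(k-m),\qquad c_b(j)=\int_{-\pi}^{\pi}e^{ij\lambda}f_b(\lambda)\,d\lambda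 .$$ Assumption 1: $\{X_k\}$, $EX_k=0$, is a harmonizable Gaussian sequence with almost periodic covariance function; the set $\mathcal L$ is finite; and the $f_b(\mu)$, $b\in\mathcal L$, are continuously differentiable on the curve $\lambda=(b+\mu)\bmod 2\pi$ on the torus of points $(\lambda,\mu)\in[-\pi,\pi]^2$, with $(-\pi,\mu)$ identified with $(\pi,\mu)$ and $(\lambda,-\pi)$ with $(\lambda,\pi)$. Assumption 2: there is a function $c(j)\ge0$ on the integers with $|c_b(j)|\le c(j)$ for all $b\in\mathcal L$ and $\sum_jc(j)<\infty$. Assumption 3: $\int_{-\pi}^{\pi}f_b(\mu)\,d\mu\neq0$ for every $b\in\mathcal L$. Here $n$ is an even positive integer and an estimate is a quantity computed from the observations $X_{-n/2},\dots,X_{n/2}$. *)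

theory Defs
  imports "HOL-Probability.Probability" "HOL-Library.Real_Mod" "HOL-Library.Landau_Symbols"
begin

text \<open>Complex random variables: \<open>cov(U,V) = E (U - E U) * conj (V - E V)\<close>.\<close>

definition ccov :: "'a measure \<Rightarrow> ('a \<Rightarrow> complex) \<Rightarrow> ('a \<Rightarrow> complex) \<Rightarrow> complex" where
  "ccov M U V =
     (LINT \<omega>|M. (U \<omega> - (LINT \<omega>'|M. U \<omega>')) * cnj (V \<omega> - (LINT \<omega>'|M. V \<omega>')))"

definition spectral_cov :: "'a measure \<Rightarrow> (real \<Rightarrow> 'a \<Rightarrow> complex) \<Rightarrow> real \<Rightarrow> real \<Rightarrow> complex" where
  "spectral_cov M Z x y = ccov M (Z x) (Z y)"

definition rect_incr :: "(real \<Rightarrow> real \<Rightarrow> complex) \<Rightarrow> real \<Rightarrow> real \<Rightarrow> real \<Rightarrow> real \<Rightarrow> complex" where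
  "rect_incr F a a' c c' = F a' c' - F a c' - F a' c + F a c"

text \<open>\<open>\<integral>\<integral> |dF| < \<infinity>\<close> over \<open>[-\<pi>,\<pi>]\<^sup>2\<close>: finite variation in the sense of Vitali.\<close>

definition finite_double_variation :: "(real \<Rightarrow> real \<Rightarrow> complex) \<Rightarrow> bool" where
  "finite_double_variation F \<longleftrightarrow>
     (\<exists>V. \<forall>\<D> \<E>. \<D> division_of {-pi..pi} \<and> \<E> division_of {-pi..pi} \<longrightarrow>
        (\<Sum>I\<in>\<D>. \<Sum>J\<in>\<E>. cmod (rect_incr F (Inf I) (Sup I) (Inf J) (Sup J))) \<le> V)"

text \<open>The stochastic integral \<open>Y = \<integral> g dZ\<close> over \<open>[-\<pi>,\<pi>]\<close> as the mean-square limit of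
  Riemann--Stieltjes sums, as the mesh of the tagged partition tends to 0.\<close>

definition has_ms_integral ::
    "'a measure \<Rightarrow> (real \<Rightarrow> complex) \<Rightarrow> (real \<Rightarrow> 'a \<Rightarrow> complex) \<Rightarrow> ('a \<Rightarrow> complex) \<Rightarrow> bool" where
  "has_ms_integral M g Z Y \<longleftrightarrow>
     (\<forall>e>0. \<exists>d>0. \<forall>\<D>. \<D> tagged_division_of {-pi..pi} \<and> (\<lambda>x. ball x d) fine \<D> \<longrightarrow>
        (LINT \<omega>|M. (cmod (Y \<omega> - (\<Sum>(t, K)\<in>\<D>. g t * (Z (Sup K) \<omega> - Z (Inf K) \<omega>))))\<^sup>2) < e)"

definition harmonizable ::
    "'a measure \<Rightarrow> (int \<Rightarrow> 'a \<Rightarrow> real) \<Rightarrow> (real \<Rightarrow> 'a \<Rightarrow> complex) \<Rightarrow> bool" where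
  "harmonizable M X Z \<longleftrightarrow>
     (\<forall>k. X k \<in> borel_measurable M \<and> integrable M (\<lambda>\<omega>. (X k \<omega>)\<^sup>2)) \<and>
     (\<forall>x\<in>{-pi..pi}. Z x \<in> borel_measurable M \<and> integrable M (\<lambda>\<omega>. (cmod (Z x \<omega>))\<^sup>2)) \<and>
     finite_double_variation (spectral_cov M Z) \<and>
     (\<forall>k. has_ms_integral M (\<lambda>x. cis (of_int k * x)) Z (\<lambda>\<omega>. of_real (X k \<omega>)))"

text \<open>Jointly Gaussian in the wide sense: point masses count as normal laws of variance 0.\<close>

definition gaussian_family :: "'a measure \<Rightarrow> ('i \<Rightarrow> 'a \<Rightarrow> real) \<Rightarrow> bool" where
  "gaussian_family M X \<longleftrightarrow>
     (\<forall>i. X i \<in> borel_measurable M) \<and>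
     (\<forall>J a. finite J \<longrightarrow>
        (\<exists>\<mu>. (AE \<omega> in M. (\<Sum>j\<in>J. a j * X j \<omega>) = \<mu>) \<or>
             (\<exists>\<sigma>>0. distributed M lborel (\<lambda>\<omega>. \<Sum>j\<in>J. a j * X j \<omega>) (normal_density \<mu> \<sigma>))))"

definition covariance :: "'a measure \<Rightarrow> (int \<Rightarrow> 'a \<Rightarrow> real) \<Rightarrow> int \<Rightarrow> int \<Rightarrow> real" where
  "covariance M X k m = (LINT \<omega>|M. X k \<omega> * X m \<omega>)"

text \<open>A finite or countable family of frequencies is indexed by all of \<open>nat\<close>; finite sums are
  padded with zero coefficients.  Uniformity is that of the series of absolute values.\<close>

definition almost_periodic_cov :: "(int \<Rightarrow> int \<Rightarrow> real) \<Rightarrow> bool" where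
  "almost_periodic_cov r \<longleftrightarrow>
     (\<exists>(\<alpha> :: int \<Rightarrow> int \<Rightarrow> nat \<Rightarrow> complex) (\<nu> :: int \<Rightarrow> int \<Rightarrow> nat \<Rightarrow> real).
        (\<forall>s \<tau>. summable (\<lambda>j. cmod (\<alpha> s \<tau> j))) \<and>
        uniform_limit UNIV (\<lambda>N (s, \<tau>). \<Sum>j<N. cmod (\<alpha> s \<tau> j))
          (\<lambda>(s, \<tau>). \<Sum>j. cmod (\<alpha> s \<tau> j)) sequentially \<and>
        (\<forall>s \<tau> t. (\<lambda>j. \<alpha> s \<tau> j * cis (\<nu> s \<tau> j * of_int t))
                    sums of_real (r (s + t) (\<tau> + t))))"

text \<open>\<open>f b\<close> is the density, in the parameter \<open>\<mu>\<close>, on the line \<open>\<lambda> = \<mu> + b\<close> modulo \<open>2\<pi>\<close>.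
  The lines are indexed by the representatives \<open>b \<in> (-\<pi>,\<pi>]\<close>.\<close>

definition line_freqs :: "(real \<Rightarrow> real \<Rightarrow> complex) \<Rightarrow> real set" where
  "line_freqs f = {b \<in> {-pi<..pi}. \<not> (AE \<mu> in lborel. \<mu> \<in> {-pi..pi} \<longrightarrow> f b \<mu> = 0)}"

text \<open>The measure \<open>dF\<close> is the sum, over the lines, of the images of \<open>f b \<mu> d\<mu>\<close> under
  \<open>\<mu> \<mapsto> (\<mu> + b mod 2\<pi>, \<mu>)\<close>; it is evaluated on half-open rectangles \<open>(a,a'] \<times> (c,c']\<close>.\<close>

definition line_spectrum :: "(real \<Rightarrow> real \<Rightarrow> complex) \<Rightarrow> (real \<Rightarrow> real \<Rightarrow> complex) \<Rightarrow> bool" where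
  "line_spectrum F f \<longleftrightarrow>
     countable (line_freqs f) \<and>
     (\<forall>b\<in>line_freqs f. set_integrable lborel {-pi..pi} (f b)) \<and>
     (\<forall>a a' c c'. -pi \<le> a \<and> a \<le> a' \<and> a' \<le> pi \<and> -pi \<le> c \<and> c \<le> c' \<and> c' \<le> pi \<longrightarrow>
        ((\<lambda>b. LINT \<mu>:{\<mu> \<in> {c<..c'}. \<exists>x\<in>{a<..a'}. [x = \<mu> + b] (rmod (2 * pi))}|lborel. f b \<mu>)
           has_sum rect_incr F a a' c c') (line_freqs f))"

text \<open>A function on the closed curve \<open>\<lambda> = \<mu> + b\<close> of the torus is a \<open>2\<pi>\<close>-periodic function
  of \<open>\<mu>\<close>.\<close>

definition C1_on_circle :: "(real \<Rightarrow> complex) \<Rightarrow> bool" where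
  "C1_on_circle g \<longleftrightarrow> (\<forall>\<mu>. g (\<mu> + 2 * pi) = g \<mu>) \<and> g C1_differentiable_on UNIV"

definition line_coeff :: "(real \<Rightarrow> real \<Rightarrow> complex) \<Rightarrow> real \<Rightarrow> int \<Rightarrow> complex" where
  "line_coeff f b j = (LINT x:{-pi..pi}|lborel. cis (of_int j * x) * f b x)"

definition line_mass :: "(real \<Rightarrow> real \<Rightarrow> complex) \<Rightarrow> real \<Rightarrow> complex" where
  "line_mass f b = (LINT \<mu>:{-pi..pi}|lborel. f b \<mu>)"

definition regular_gaussian_ap ::
    "'a measure \<Rightarrow> (int \<Rightarrow> 'a \<Rightarrow> real) \<Rightarrow> (real \<Rightarrow> 'a \<Rightarrow> complex) \<Rightarrow> (real \<Rightarrow> real \<Rightarrow> complex) \<Rightarrow> bool" where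
  "regular_gaussian_ap M X Z f \<longleftrightarrow>
     prob_space M \<and>
     gaussian_family M X \<and>
     (\<forall>k. (LINT \<omega>|M. X k \<omega>) = 0) \<and>
     harmonizable M X Z \<and>
     almost_periodic_cov (covariance M X) \<and>
     line_spectrum (spectral_cov M Z) f \<and>
     finite (line_freqs f) \<and>
     (\<forall>b\<in>line_freqs f. C1_on_circle (f b))"

definition dominated_line_coeffs :: "(real \<Rightarrow> real \<Rightarrow> complex) \<Rightarrow> bool" where
  "dominated_line_coeffs f \<longleftrightarrow>
     (\<exists>c :: int \<Rightarrow> real. (\<forall>j. 0 \<le> c j) \<and>
        (\<forall>b\<in>line_freqs f. \<forall>j. cmod (line_coeff f b j) \<le> c j) \<and> c summable_on UNIV)"

definition nonzero_line_masses :: "(real \<Rightarrow> real \<Rightarrow> complex) \<Rightarrow> bool" where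
  "nonzero_line_masses f \<longleftrightarrow> (\<forall>b\<in>line_freqs f. line_mass f b \<noteq> 0)"

definition heavy_freqs :: "(real \<Rightarrow> real \<Rightarrow> complex) \<Rightarrow> real \<Rightarrow> real set" where
  "heavy_freqs f \<delta> = {b \<in> line_freqs f. cmod (line_mass f b) > \<delta>}"

definition obs_window :: "nat \<Rightarrow> int set" where
  "obs_window n = {- int (n div 2)..int (n div 2)}"

definition obs_space :: "nat \<Rightarrow> (int \<Rightarrow> real) measure" where
  "obs_space n = Pi\<^sub>M (obs_window n) (\<lambda>_. borel)"

definition observed :: "(int \<Rightarrow> 'a \<Rightarrow> real) \<Rightarrow> nat \<Rightarrow> 'a \<Rightarrow> int \<Rightarrow> real" where
  "observed X n \<omega> = (\<lambda>k\<in>obs_window n. X k \<omega>)"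

text \<open>A rule that computes from the data alone a number \<open>m n\<close> of detected frequencies and their
  estimates \<open>w n 0, \<dots>, w n (m n - 1)\<close>.  The rule cannot refer to the process, so that
  the constants \<open>w = b\<close> are no estimates of the unknown frequencies \<open>b\<close>.\<close>

definition frequency_estimator ::
    "(nat \<Rightarrow> (int \<Rightarrow> real) \<Rightarrow> nat) \<Rightarrow> (nat \<Rightarrow> nat \<Rightarrow> (int \<Rightarrow> real) \<Rightarrow> real) \<Rightarrow> bool" where
  "frequency_estimator m w \<longleftrightarrow>
     (\<forall>n. m n \<in> measurable (obs_space n) (count_space UNIV) \<and>
          (\<forall>i. w n i \<in> borel_measurable (obs_space n)))"

end

theory Submission
  imports Defs "HOL-Real_Asymp.Real_Asymp"
begin

text \<open>
  The variance of \<open>X\<^sub>k\<close> is \<open>E X\<^sub>k\<^sup>2 = \<Sum>\<^sub>b e\<^sup>i\<^sup>k\<^sup>b \<theta>\<^sub>b\<close>, where \<open>\<theta>\<^sub>b\<close> is the total mass of the spectral density on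
  the line \<open>b\<close>. The squared observations are therefore a sum of finitely many pure oscillations, with the
  unknown frequencies \<open>b\<close> and amplitudes \<open>\<theta>\<^sub>b\<close>, and a centred noise. The normalized Fourier transform of the
  squares has near each \<open>b\<close> a peak of height \<open>\<bar>\<theta>\<^sub>b\<bar>\<close> with the shape of the Dirichlet kernel, of width \<open>1/n\<close>. The
  estimates are the local maxima of its absolute value, over a grid of spacing \<open>n\<^sup>-\<^sup>2\<close>, that exceed
  \<open>\<delta> + n\<^sup>-\<^sup>1\<^sup>/\<^sup>3\<close>, taken in increasing order.

  \<^emph>\<open>Noise.\<close> Outside an event of probability \<open>O(n\<^sup>-\<^sup>2)\<close> the centred transform is at most \<open>n\<^sup>-\<^sup>9\<^sup>/\<^sup>2\<^sup>0\<close> at all grid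
  points (\<open>uniform_deviation_probability\<close>). This follows from high moments of centred quadratic forms in
  Gaussian variables, \<open>centered_quadratic_form_moment\<close>, which integration by parts reduces to a bound on
  the norm of the covariance matrix. That norm is bounded because the line coefficients are summable
  (\<open>covariance_row_sum_bounded\<close>).

  \<^emph>\<open>Accuracy.\<close> The value of the transform at a peak is at least its value next to \<open>b\<close>, up to a multiple of
  the noise, while the kernel at distance \<open>x\<close> from its centre has lost a part of order \<open>(n x)\<^sup>2\<close> of its height
  (\<open>dirichlet_kernel_peak\<close>). Hence \<open>n \<bar>x\<bar>\<close> is of the order of the square root of the noise, \<open>n\<^sup>-\<^sup>9\<^sup>/\<^sup>4\<^sup>0\<close>, which is
  smaller than \<open>n\<^sup>-\<^sup>1\<^sup>/\<^sup>5\<close> (\<open>frequency_recovery\<close>).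

  \<^emph>\<open>Covariances.\<close> The formula for \<open>E X\<^sub>k X\<^sub>m\<close>, \<open>covariance_line_expansion\<close>, is obtained from Riemann sums
  of the stochastic integral: the covariances of these sums are sums over the rectangles of a division of the torus,
  on each of which the increment of the spectral covariance is given by the densities on the lines.
\<close>

section \<open>Random variables with finite moments and Gaussian integration by parts\<close>

definition all_moments :: "'a measure \<Rightarrow> ('a \<Rightarrow> real) \<Rightarrow> bool" where
  "all_moments M Y \<longleftrightarrow> Y \<in> borel_measurable M \<and> (\<forall>p. integrable M (\<lambda>\<omega>. \<bar>Y \<omega>\<bar> ^ p))"

lemma all_moments_measurable: "all_moments M Y \<Longrightarrow> Y \<in> borel_measurable M"
  by (simp add: all_moments_def)

lemma all_moments_integrable_power: "all_moments M Y \<Longrightarrow> integrable M (\<lambda>\<omega>. Y \<omega> ^ p)"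
  unfolding all_moments_def
  by (rule Bochner_Integration.integrable_bound[of M "\<lambda>\<omega>. \<bar>Y \<omega>\<bar> ^ p"])
    (auto simp flip: power_abs)

lemma all_moments_integrable: "all_moments M Y \<Longrightarrow> integrable M Y"
  using all_moments_integrable_power[of M Y 1] by simp

lemma all_moments_add:
  assumes "all_moments M Y" "all_moments M W"
  shows "all_moments M (\<lambda>\<omega>. Y \<omega> + W \<omega>)"
  unfolding all_moments_def
proof (intro conjI allI)
  have [measurable]: "Y \<in> borel_measurable M" "W \<in> borel_measurable M"
    using assms by (auto simp: all_moments_def)
  show "(\<lambda>\<omega>. Y \<omega> + W \<omega>) \<in> borel_measurable M" by measurable
  fix p
  have bound: "\<bar>x + y\<bar> ^ p \<le> 2 ^ p * (\<bar>x\<bar> ^ p + \<bar>y\<bar> ^ p)" for x y :: real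
  proof -
    have "\<bar>x + y\<bar> ^ p \<le> (2 * max \<bar>x\<bar> \<bar>y\<bar>) ^ p"
      by (intro power_mono) auto
    also have "\<dots> = 2 ^ p * (max \<bar>x\<bar> \<bar>y\<bar>) ^ p" by (simp add: power_mult_distrib)
    also have "(max \<bar>x\<bar> \<bar>y\<bar>) ^ p \<le> \<bar>x\<bar> ^ p + \<bar>y\<bar> ^ p"
      by (cases "\<bar>x\<bar> \<le> \<bar>y\<bar>") (auto simp: max_def)
    finally show ?thesis by simp
  qed
  show "integrable M (\<lambda>\<omega>. \<bar>Y \<omega> + W \<omega>\<bar> ^ p)"
    by (rule Bochner_Integration.integrable_bound[where f="\<lambda>\<omega>. 2 ^ p * (\<bar>Y \<omega>\<bar> ^ p + \<bar>W \<omega>\<bar> ^ p)"])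
       (use assms bound in \<open>auto simp: all_moments_def\<close>)
qed

lemma all_moments_mult:
  assumes "all_moments M Y" "all_moments M W"
  shows "all_moments M (\<lambda>\<omega>. Y \<omega> * W \<omega>)"
  unfolding all_moments_def
proof (intro conjI allI)
  have [measurable]: "Y \<in> borel_measurable M" "W \<in> borel_measurable M"
    using assms by (auto simp: all_moments_def)
  show "(\<lambda>\<omega>. Y \<omega> * W \<omega>) \<in> borel_measurable M" by measurable
  fix p
  have bound: "\<bar>x * y\<bar> ^ p \<le> \<bar>x\<bar> ^ (p + p) + \<bar>y\<bar> ^ (p + p)" for x y :: real
  proof -
    have "2 * (\<bar>x\<bar> ^ p * \<bar>y\<bar> ^ p) \<le> \<bar>x\<bar> ^ p * \<bar>x\<bar> ^ p + \<bar>y\<bar> ^ p * \<bar>y\<bar> ^ p"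
      using sum_squares_bound[of "\<bar>x\<bar> ^ p" "\<bar>y\<bar> ^ p"] by (simp add: power2_eq_square)
    moreover have "0 \<le> \<bar>x\<bar> ^ p * \<bar>y\<bar> ^ p" by simp
    ultimately show ?thesis unfolding abs_mult power_mult_distrib power_add by linarith
  qed
  have i: "integrable M (\<lambda>\<omega>. \<bar>Y \<omega>\<bar> ^ (p + p) + \<bar>W \<omega>\<bar> ^ (p + p))"
    using assms unfolding all_moments_def by (intro Bochner_Integration.integrable_add) blast+
  show "integrable M (\<lambda>\<omega>. \<bar>Y \<omega> * W \<omega>\<bar> ^ p)"
    by (rule Bochner_Integration.integrable_bound[OF i])
       (use bound in \<open>auto intro!: AE_I2 order_trans[OF _ abs_ge_self]\<close>)
qed

lemma (in prob_space) all_moments_const: "all_moments M (\<lambda>_. c)"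
  by (simp add: all_moments_def)

lemma (in prob_space) all_moments_scale: "all_moments M Y \<Longrightarrow> all_moments M (\<lambda>\<omega>. c * Y \<omega>)"
  by (intro all_moments_mult all_moments_const)

lemma (in prob_space) all_moments_diff:
  "all_moments M Y \<Longrightarrow> all_moments M W \<Longrightarrow> all_moments M (\<lambda>\<omega>. Y \<omega> - W \<omega>)"
  using all_moments_add[OF _ all_moments_scale, of Y W "-1"] by simp

lemma (in prob_space) all_moments_power: "all_moments M Y \<Longrightarrow> all_moments M (\<lambda>\<omega>. Y \<omega> ^ d)"
  by (induction d) (auto intro: all_moments_const all_moments_mult)

lemma (in prob_space) all_moments_sum:
  "(\<And>i. i \<in> I \<Longrightarrow> all_moments M (Y i)) \<Longrightarrow> all_moments M (\<lambda>\<omega>. \<Sum>i\<in>I. Y i \<omega>)"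
  by (induction I rule: infinite_finite_induct) (auto intro: all_moments_const all_moments_add)

lemmas (in prob_space) all_moments_intros =
  all_moments_const all_moments_mult all_moments_add all_moments_diff all_moments_power
  all_moments_sum

text \<open>Identities between moments of \<open>V + u W\<close> that hold for all real \<open>u\<close> can be compared through their
derivatives at \<open>u = 0\<close>; this is how one-dimensional moment identities are turned into mixed ones.\<close>

lemma (in prob_space) has_derivative_moment:
  assumes "all_moments M P" "all_moments M V" "all_moments M W"
  shows "((\<lambda>u. LINT \<omega>|M. P \<omega> * (V \<omega> + u * W \<omega>) ^ d) has_real_derivative
            real d * (LINT \<omega>|M. P \<omega> * W \<omega> * V \<omega> ^ (d - 1))) (at 0)"
proof -
  define c where "c k = real (d choose k) * (LINT \<omega>|M. P \<omega> * W \<omega> ^ k * V \<omega> ^ (d - k))" for k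
  have int: "integrable M (\<lambda>\<omega>. P \<omega> * W \<omega> ^ k * V \<omega> ^ j)" for k j
    by (intro all_moments_integrable all_moments_intros assms)
  have eq: "(LINT \<omega>|M. P \<omega> * (V \<omega> + u * W \<omega>) ^ d) = (\<Sum>k\<le>d. c k * u ^ k)" for u
  proof -
    have "P \<omega> * (V \<omega> + u * W \<omega>) ^ d =
        (\<Sum>k\<le>d. (real (d choose k) * u ^ k) * (P \<omega> * W \<omega> ^ k * V \<omega> ^ (d - k)))" for \<omega>
      using binomial_ring[of "u * W \<omega>" "V \<omega>" d]
      by (simp add: add.commute sum_distrib_left power_mult_distrib mult_ac)
    then have "(LINT \<omega>|M. P \<omega> * (V \<omega> + u * W \<omega>) ^ d) =
        (\<Sum>k\<le>d. (real (d choose k) * u ^ k) * (LINT \<omega>|M. P \<omega> * W \<omega> ^ k * V \<omega> ^ (d - k)))"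
      using int by (simp add: Bochner_Integration.integral_sum)
    then show ?thesis by (simp add: c_def mult_ac)
  qed
  have "((\<lambda>u. \<Sum>k\<le>d. c k * u ^ k) has_real_derivative (\<Sum>k\<le>d. c k * (real k * 0 ^ (k - 1)))) (at 0)"
    by (auto intro!: derivative_eq_intros sum.cong)
  also have "(\<Sum>k\<le>d. c k * (real k * 0 ^ (k - 1))) = (\<Sum>k\<in>{1} \<inter> {..d}. c k)"
  proof (rule sum.mono_neutral_cong_right)
    show "\<forall>i\<in>{..d} - {1} \<inter> {..d}. c i * (real i * 0 ^ (i - 1)) = 0"
    proof
      fix i assume "i \<in> {..d} - {1} \<inter> {..d}"
      then have "i = 0 \<or> i - 1 \<noteq> 0" by auto
      then show "c i * (real i * 0 ^ (i - 1)) = 0" by auto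
    qed
  qed auto
  also have "\<dots> = real d * (LINT \<omega>|M. P \<omega> * W \<omega> * V \<omega> ^ (d - 1))"
    by (cases d) (auto simp: c_def)
  finally show ?thesis unfolding eq .
qed

text \<open>A linear space of centred Gaussian variables, described by the recursion
\<open>E Y\<^sup>d\<^sup>+\<^sup>1 = d E Y\<^sup>2 E Y\<^sup>d\<^sup>-\<^sup>1\<close>. It determines all moments from the variance. At
\<open>d = 0\<close> it says \<open>E Y = 0\<close>, so that degenerate
variables are included as the constant 0.\<close>

locale gaussian_space = prob_space M for M :: "'a measure" +
  fixes H :: "('a \<Rightarrow> real) set"
  assumes all_moments: "Y \<in> H \<Longrightarrow> all_moments M Y"
    and moment_recursion:
      "Y \<in> H \<Longrightarrow> (LINT \<omega>|M. Y \<omega> ^ Suc d) = real d * (LINT \<omega>|M. Y \<omega> ^ 2) * (LINT \<omega>|M. Y \<omega> ^ (d - 1))"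
    and add_closed: "Y \<in> H \<Longrightarrow> W \<in> H \<Longrightarrow> (\<lambda>\<omega>. Y \<omega> + W \<omega>) \<in> H"
    and scale_closed: "Y \<in> H \<Longrightarrow> (\<lambda>\<omega>. u * Y \<omega>) \<in> H"
begin

text \<open>The recursion, applied to \<open>V + u Y\<close> and differentiated at \<open>u = 0\<close>, expresses \<open>E (Y V\<^sup>d)\<close> through
\<open>E (Y V\<^sup>d\<^sup>-\<^sup>2)\<close>; induction on \<open>d\<close> then gives integration by parts for powers of a single linear form.\<close>

lemma stein_power:
  assumes Y: "Y \<in> H" and V: "V \<in> H"
  shows "(LINT \<omega>|M. Y \<omega> * V \<omega> ^ d) =
           real d * (LINT \<omega>|M. Y \<omega> * V \<omega>) * (LINT \<omega>|M. V \<omega> ^ (d - 1))"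
proof (induction d rule: less_induct)
  case (less d)
  note D = has_derivative_moment[OF all_moments_const[of 1] all_moments[OF V] all_moments[OF Y], simplified]
  have H: "(\<lambda>\<omega>. V \<omega> + u * Y \<omega>) \<in> H" for u
    by (intro add_closed scale_closed V Y)
  have R: "((\<lambda>u. LINT \<omega>|M. (V \<omega> + u * Y \<omega>) ^ Suc d) has_real_derivative
          real d * ((LINT \<omega>|M. V \<omega> ^ 2) * (real (d - 1) * (LINT \<omega>|M. Y \<omega> * V \<omega> ^ (d - 1 - 1))) +
                    2 * (LINT \<omega>|M. Y \<omega> * V \<omega>) * (LINT \<omega>|M. V \<omega> ^ (d - 1)))) (at 0)"
    unfolding moment_recursion[OF H]
    unfolding mult.assoc
    by (rule DERIV_cong[OF DERIV_cmult[OF DERIV_mult[OF D[of 2] D[of "d - 1"]]]]) (simp add: algebra_simps)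
  have "real (Suc d) * (LINT \<omega>|M. Y \<omega> * V \<omega> ^ d) =
      real d * ((LINT \<omega>|M. V \<omega> ^ 2) * (real (d - 1) * (LINT \<omega>|M. Y \<omega> * V \<omega> ^ (d - 1 - 1))) +
                    2 * (LINT \<omega>|M. Y \<omega> * V \<omega>) * (LINT \<omega>|M. V \<omega> ^ (d - 1)))"
    using DERIV_unique[OF D[of "Suc d"] R] by (simp only: diff_Suc_Suc diff_zero)
  moreover have "(LINT \<omega>|M. V \<omega> ^ 2) * (real (d - 1) * (LINT \<omega>|M. Y \<omega> * V \<omega> ^ (d - 1 - 1))) =
      real (d - 1) * (LINT \<omega>|M. Y \<omega> * V \<omega>) * (LINT \<omega>|M. V \<omega> ^ (d - 1))"
  proof (cases "d \<le> 1")
    case False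
    then obtain e where e: "d = Suc (Suc e)" by (metis One_nat_def Suc_le_mono not0_implies_Suc le0)
    show ?thesis using less.IH[of e] moment_recursion[OF V, of e] by (simp add: e)
  qed auto
  ultimately have "real (Suc d) * (LINT \<omega>|M. Y \<omega> * V \<omega> ^ d) =
      real (Suc d) * (real d * (LINT \<omega>|M. Y \<omega> * V \<omega>) * (LINT \<omega>|M. V \<omega> ^ (d - 1)))"
    by (cases d) (auto simp: algebra_simps)
  then show ?case by (simp only: mult_cancel_left) simp
qed

text \<open>\<open>P'\<close> acts as the derivative of the polynomial \<open>P\<close> in the direction of the covariance with \<open>Y\<close>. The
factor \<open>V\<^sup>d\<close> only strengthens the statement: it is the reserve from which further linear factors of \<open>P\<close>
are split off. Integration by parts proper is the case \<open>d = 0\<close>.\<close>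

definition stein_pair :: "('a \<Rightarrow> real) \<Rightarrow> ('a \<Rightarrow> real) \<Rightarrow> ('a \<Rightarrow> real) \<Rightarrow> bool" where
  "stein_pair Y P P' \<longleftrightarrow> all_moments M P \<and> all_moments M P' \<and>
     (\<forall>V\<in>H. \<forall>d. (LINT \<omega>|M. Y \<omega> * P \<omega> * V \<omega> ^ d) =
        (LINT \<omega>|M. P' \<omega> * V \<omega> ^ d) +
        real d * (LINT \<omega>|M. Y \<omega> * V \<omega>) * (LINT \<omega>|M. P \<omega> * V \<omega> ^ (d - 1)))"

lemma stein_pair_const: "Y \<in> H \<Longrightarrow> stein_pair Y (\<lambda>_. 1) (\<lambda>_. 0)"
  by (auto simp: stein_pair_def all_moments_const stein_power)

lemma stein_pair_identity: "stein_pair Y P P' \<Longrightarrow> Y \<in> H \<Longrightarrow> (LINT \<omega>|M. Y \<omega> * P \<omega>) = (LINT \<omega>|M. P' \<omega>)"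
  unfolding stein_pair_def by (metis (no_types, lifting) Bochner_Integration.integral_cong 
   add.right_neutral mult_zero_left mult.right_neutral of_nat_0 power_0)

lemma stein_pair_scale:
  assumes "stein_pair Y P P'"
  shows "stein_pair Y (\<lambda>\<omega>. c * P \<omega>) (\<lambda>\<omega>. c * P' \<omega>)"
proof -
  have *: "Y \<omega> * (c * P \<omega>) * t = c * (Y \<omega> * P \<omega> * t)" "c * P \<omega> * t = c * (P \<omega> * t)" 
    "c * P' \<omega> * t = c * (P' \<omega> * t)" for \<omega> t
    by auto
  show ?thesis
    using assms unfolding stein_pair_def *
    by (auto intro!: all_moments_scale simp: algebra_simps)
qed

lemma stein_pair_add:
  assumes Y: "Y \<in> H" and "stein_pair Y P P'" "stein_pair Y R R'"
  shows "stein_pair Y (\<lambda>\<omega>. P \<omega> + R \<omega>) (\<lambda>\<omega>. P' \<omega> + R' \<omega>)"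
proof -
  have m: "all_moments M P" "all_moments M P'" "all_moments M R" "all_moments M R'"
    using assms by (auto simp: stein_pair_def)
  note m = m all_moments[OF Y]
  show ?thesis
    unfolding stein_pair_def
  proof (intro conjI ballI allI)
    fix V d assume V: "V \<in> H"
    note m = m all_moments[OF V]
    have i: "integrable M (\<lambda>\<omega>. Y \<omega> * P \<omega> * V \<omega> ^ e)" "integrable M (\<lambda>\<omega>. Y \<omega> * R \<omega> * V \<omega> ^ e)"
      "integrable M (\<lambda>\<omega>. P' \<omega> * V \<omega> ^ e)" "integrable M (\<lambda>\<omega>. R' \<omega> * V \<omega> ^ e)"
      "integrable M (\<lambda>\<omega>. P \<omega> * V \<omega> ^ e)" "integrable M (\<lambda>\<omega>. R \<omega> * V \<omega> ^ e)" for e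
      by (intro all_moments_integrable all_moments_intros m)+
    show "(LINT \<omega>|M. Y \<omega> * (P \<omega> + R \<omega>) * V \<omega> ^ d) =
        (LINT \<omega>|M. (P' \<omega> + R' \<omega>) * V \<omega> ^ d) +
        real d * (LINT \<omega>|M. Y \<omega> * V \<omega>) * (LINT \<omega>|M. (P \<omega> + R \<omega>) * V \<omega> ^ (d - 1))"
      using assms(2,3) V i unfolding stein_pair_def by (simp add: algebra_simps)
  qed (intro all_moments_add m)+
qed

lemma stein_pair_sum:
  assumes Y: "Y \<in> H" and "\<And>i. i \<in> I \<Longrightarrow> stein_pair Y (P i) (P' i)"
  shows "stein_pair Y (\<lambda>\<omega>. \<Sum>i\<in>I. P i \<omega>) (\<lambda>\<omega>. \<Sum>i\<in>I. P' i \<omega>)"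
proof -
  have 0: "stein_pair Y (\<lambda>\<omega>. 0) (\<lambda>\<omega>. 0)"
    using stein_pair_scale[OF stein_pair_const[OF Y], of 0] by simp
  show ?thesis
    using assms(2) by (induction I rule: infinite_finite_induct) (auto intro!: stein_pair_add Y 0)
qed

text \<open>The product rule. In the identity for \<open>(V + u W)\<^sup>d\<^sup>+\<^sup>1\<close> the derivative at \<open>u = 0\<close> moves one factor \<open>W\<close> out of
the power and into \<open>P\<close>.\<close>

lemma stein_pair_mult:
  assumes Y: "Y \<in> H" and P: "stein_pair Y P P'" and W: "W \<in> H"
  shows "stein_pair Y (\<lambda>\<omega>. P \<omega> * W \<omega>) (\<lambda>\<omega>. P' \<omega> * W \<omega> + (LINT \<omega>|M. Y \<omega> * W \<omega>) * P \<omega>)"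
proof -
  have m: "all_moments M P" "all_moments M P'"
    using P by (auto simp: stein_pair_def)
  note m = m all_moments[OF Y] all_moments[OF W]
  show ?thesis
    unfolding stein_pair_def
  proof (intro conjI ballI allI)
    fix V d assume V: "V \<in> H"
    note m = m all_moments[OF V]
    let ?c = "LINT \<omega>|M. Y \<omega> * W \<omega>" and ?v = "LINT \<omega>|M. Y \<omega> * V \<omega>"
    have mYP: "all_moments M (\<lambda>\<omega>. Y \<omega> * P \<omega>)" by (intro all_moments_intros m)
    have H: "(\<lambda>\<omega>. V \<omega> + u * W \<omega>) \<in> H" for u
      by (intro add_closed scale_closed V W)
    have lin: "(LINT \<omega>|M. Y \<omega> * (V \<omega> + u * W \<omega>)) = ?v + u * ?c" for u
    proof -
      have "integrable M (\<lambda>\<omega>. Y \<omega> * V \<omega>)" "integrable M (\<lambda>\<omega>. Y \<omega> * W \<omega>)"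
        by (intro all_moments_integrable all_moments_intros m)+
      then have "(LINT \<omega>|M. Y \<omega> * V \<omega> + u * (Y \<omega> * W \<omega>)) = ?v + u * ?c" by simp
      then show ?thesis by (simp add: algebra_simps)
    qed
    have id: "(LINT \<omega>|M. Y \<omega> * P \<omega> * (V \<omega> + u * W \<omega>) ^ Suc d) =
        (LINT \<omega>|M. P' \<omega> * (V \<omega> + u * W \<omega>) ^ Suc d) +
        real (Suc d) * (?v + u * ?c) * (LINT \<omega>|M. P \<omega> * (V \<omega> + u * W \<omega>) ^ d)" for u
      using P[unfolded stein_pair_def, THEN conjunct2, THEN conjunct2, rule_format, OF H[of u], of "Suc d"]
      by (simp only: lin diff_Suc_1)
    have R: "((\<lambda>u. LINT \<omega>|M. Y \<omega> * P \<omega> * (V \<omega> + u * W \<omega>) ^ Suc d) has_real_derivative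
        real (Suc d) * (LINT \<omega>|M. P' \<omega> * W \<omega> * V \<omega> ^ d) +
        (real (Suc d) * ?c * (LINT \<omega>|M. P \<omega> * V \<omega> ^ d) +
         real (Suc d) * ?v * (real d * (LINT \<omega>|M. P \<omega> * W \<omega> * V \<omega> ^ (d - 1))))) (at 0)"
      unfolding id
      by (rule DERIV_cong[OF DERIV_add[OF has_derivative_moment[OF m(2,5,4)]
            DERIV_mult[OF DERIV_cmult[OF DERIV_add[OF DERIV_const DERIV_cmult_right[OF DERIV_ident]]]
              has_derivative_moment[OF m(1,5,4)]]]])
         (simp add: algebra_simps)
    have "real (Suc d) * (LINT \<omega>|M. Y \<omega> * P \<omega> * W \<omega> * V \<omega> ^ d) =
        real (Suc d) * ((LINT \<omega>|M. P' \<omega> * W \<omega> * V \<omega> ^ d) + ?c * (LINT \<omega>|M. P \<omega> * V \<omega> ^ d) +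
         ?v * (real d * (LINT \<omega>|M. P \<omega> * W \<omega> * V \<omega> ^ (d - 1))))"
      using DERIV_unique[OF has_derivative_moment[OF mYP m(5,4), of "Suc d"] R]
      by (simp only: diff_Suc_1 distrib_left mult_ac add_ac)
    then have "(LINT \<omega>|M. Y \<omega> * P \<omega> * W \<omega> * V \<omega> ^ d) =
        (LINT \<omega>|M. P' \<omega> * W \<omega> * V \<omega> ^ d) + ?c * (LINT \<omega>|M. P \<omega> * V \<omega> ^ d) +
         ?v * (real d * (LINT \<omega>|M. P \<omega> * W \<omega> * V \<omega> ^ (d - 1)))"
      by (simp only: mult_cancel_left) simp
    moreover have "(LINT \<omega>|M. (P' \<omega> * W \<omega> + ?c * P \<omega>) * V \<omega> ^ d) =
       (LINT \<omega>|M. P' \<omega> * W \<omega> * V \<omega> ^ d) + ?c * (LINT \<omega>|M. P \<omega> * V \<omega> ^ d)"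
    proof -
      have "integrable M (\<lambda>\<omega>. P' \<omega> * W \<omega> * V \<omega> ^ d)" "integrable M (\<lambda>\<omega>. P \<omega> * V \<omega> ^ d)"
        by (intro all_moments_integrable all_moments_intros m)+
      then have "(LINT \<omega>|M. P' \<omega> * W \<omega> * V \<omega> ^ d + ?c * (P \<omega> * V \<omega> ^ d)) =
       (LINT \<omega>|M. P' \<omega> * W \<omega> * V \<omega> ^ d) + ?c * (LINT \<omega>|M. P \<omega> * V \<omega> ^ d)" by simp
      then show ?thesis by (simp add: algebra_simps)
    qed
    ultimately show "(LINT \<omega>|M. Y \<omega> * (P \<omega> * W \<omega>) * V \<omega> ^ d) =
        (LINT \<omega>|M. (P' \<omega> * W \<omega> + ?c * P \<omega>) * V \<omega> ^ d) +
        real d * ?v * (LINT \<omega>|M. P \<omega> * W \<omega> * V \<omega> ^ (d - 1))"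
      by (simp add: mult_ac)
  qed (intro all_moments_intros m)+
qed

end

section \<open>Moments of centred quadratic forms\<close>

lemma sum_power_le_card:
  fixes x :: "'b \<Rightarrow> real"
  assumes "finite I" "\<And>k. k \<in> I \<Longrightarrow> 0 \<le> x k" "p \<ge> 1"
  shows "(\<Sum>k\<in>I. x k) ^ p \<le> real (card I) ^ p * (\<Sum>k\<in>I. x k ^ p)"
proof (cases "I = {}")
  case False
  have "Max (x ` I) \<in> x ` I" using assms(1) False by (intro Max_in) auto
  then obtain m where m: "m \<in> I" "x m = Max (x ` I)" by auto
  then have m: "m \<in> I" "\<And>k. k \<in> I \<Longrightarrow> x k \<le> x m" using assms(1) by auto
  have "(\<Sum>k\<in>I. x k) ^ p \<le> (real (card I) * x m) ^ p"
    using m assms sum_bounded_above[of I x "x m"] by (intro power_mono sum_nonneg) auto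
  also have "\<dots> = real (card I) ^ p * x m ^ p" by (simp add: power_mult_distrib)
  also have "x m ^ p \<le> (\<Sum>k\<in>I. x k ^ p)"
    using assms m(1) by (intro member_le_sum) auto
  finally show ?thesis by (simp add: mult_left_mono)
qed (use assms(3) in \<open>simp add: power_0_left\<close>)

text \<open>Schur's test: a symmetric matrix whose rows have absolute sums at most \<open>\<rho>\<close> has norm at most \<open>\<rho>\<close>.\<close>

lemma quadratic_form_le_row_sum:
  fixes r :: "'b \<Rightarrow> 'b \<Rightarrow> real"
  assumes sym: "\<And>k m. r k m = r m k" and row: "\<And>k. k \<in> I \<Longrightarrow> (\<Sum>m\<in>I. \<bar>r k m\<bar>) \<le> \<rho>"
    and a: "\<And>k. k \<in> I \<Longrightarrow> \<bar>a k\<bar> \<le> 1"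
  shows "(\<Sum>k\<in>I. \<Sum>m\<in>I. a k * a m * r k m * x k * x m) \<le> \<rho> * (\<Sum>k\<in>I. (x k)\<^sup>2)"
proof -
  have "(\<Sum>k\<in>I. \<Sum>m\<in>I. a k * a m * r k m * x k * x m) \<le>
        (\<Sum>k\<in>I. \<Sum>m\<in>I. \<bar>r k m\<bar> * ((x k)\<^sup>2 / 2) + \<bar>r k m\<bar> * ((x m)\<^sup>2 / 2))"
  proof (intro sum_mono)
    fix k m assume km: "k \<in> I" "m \<in> I"
    have "a k * a m * r k m * x k * x m \<le> \<bar>a k * a m\<bar> * (\<bar>r k m\<bar> * (\<bar>x k\<bar> * \<bar>x m\<bar>))"
      using abs_ge_self[of "a k * a m * r k m * x k * x m"] by (simp add: abs_mult mult_ac)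
    also have "\<dots> \<le> 1 * (\<bar>r k m\<bar> * (\<bar>x k\<bar> * \<bar>x m\<bar>))"
      using mult_mono[OF a[OF km(1)] a[OF km(2)]] by (intro mult_right_mono) (auto simp: abs_mult)
    also have "\<dots> \<le> \<bar>r k m\<bar> * ((x k)\<^sup>2 / 2 + (x m)\<^sup>2 / 2)"
      using sum_squares_bound[of "\<bar>x k\<bar>" "\<bar>x m\<bar>"] by (auto intro!: mult_left_mono)
    finally show "a k * a m * r k m * x k * x m \<le> \<bar>r k m\<bar> * ((x k)\<^sup>2 / 2) + \<bar>r k m\<bar> * ((x m)\<^sup>2 / 2)"
      by (simp add: distrib_left)
  qed
  also have "\<dots> = (\<Sum>k\<in>I. \<Sum>m\<in>I. \<bar>r k m\<bar> * ((x k)\<^sup>2 / 2)) + (\<Sum>m\<in>I. \<Sum>k\<in>I. \<bar>r k m\<bar> * ((x m)\<^sup>2 / 2))"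
    by (simp add: sum.distrib) (rule sum.swap)
  also have "\<dots> = (\<Sum>k\<in>I. (\<Sum>m\<in>I. \<bar>r k m\<bar>) * (x k)\<^sup>2)"
    using sym by (simp add: sum_distrib_right sum.distrib[symmetric])
  also have "\<dots> \<le> (\<Sum>k\<in>I. \<rho> * (x k)\<^sup>2)"
    by (intro sum_mono mult_right_mono row) auto
  finally show ?thesis by (simp add: sum_distrib_left)
qed

text \<open>A form of Young's inequality without fractional exponents: whichever of \<open>c u\<close> and \<open>v\<close> is larger
bounds the product.\<close>

lemma young_power:
  fixes u v c :: real
  assumes "0 \<le> u" "0 \<le> v" "0 \<le> c" "p \<ge> 1"
  shows "c * u * v ^ (p - 1) \<le> v ^ p + c ^ p * u ^ p"
proof (cases "c * u \<le> v")
  case True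
  then have "c * u * v ^ (p - 1) \<le> v * v ^ (p - 1)" using assms by (intro mult_right_mono) auto
  also have "\<dots> = v ^ p" using assms by (metis power_eq_if not_one_le_zero)
  finally show ?thesis using assms by (simp add: add_increasing2)
next
  case False
  then have "c * u * v ^ (p - 1) \<le> (c * u) * (c * u) ^ (p - 1)"
    using assms by (intro mult_left_mono power_mono) auto
  also have "\<dots> = (c * u) ^ p" using assms by (metis power_eq_if not_one_le_zero)
  finally show ?thesis using assms by (simp add: add_increasing power_mult_distrib)
qed

context gaussian_space begin

lemma even_moment_le:
  assumes "Y \<in> H" "(LINT \<omega>|M. Y \<omega> ^ 2) \<le> \<rho>"
  shows "(LINT \<omega>|M. (Y \<omega>)\<^sup>2 ^ p) \<le> fact (2 * p) * \<rho> ^ p"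
proof (induction p)
  case (Suc p)
  have "0 \<le> (LINT \<omega>|M. Y \<omega> ^ 2)" by simp
  with assms(2) have \<rho>: "0 \<le> \<rho>" by linarith
  have "(LINT \<omega>|M. (Y \<omega>)\<^sup>2 ^ Suc p) = real (2 * p + 1) * (LINT \<omega>|M. Y \<omega> ^ 2) * (LINT \<omega>|M. (Y \<omega>)\<^sup>2 ^ p)"
  proof -
    have "y\<^sup>2 ^ Suc p = y ^ Suc (2 * p + 1)" "y\<^sup>2 ^ p = y ^ (2 * p + 1 - 1)" for y :: real
      by (simp_all add: power_mult power2_eq_square)
    then show ?thesis using moment_recursion[OF assms(1), of "2 * p + 1"] by (simp only:)
  qed
  also have "\<dots> \<le> real (2 * p + 1) * \<rho> * (fact (2 * p) * \<rho> ^ p)"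
    using assms \<rho> by (intro mult_mono Suc) (auto intro!: integral_nonneg)
  also have "\<dots> = fact (2 * p + 1) * \<rho> ^ Suc p" by (simp add: algebra_simps)
  also have "\<dots> \<le> fact (2 * Suc p) * \<rho> ^ Suc p"
    using \<rho> by (intro mult_right_mono fact_mono) auto
  finally show ?case .
qed (simp add: prob_space)

text \<open>Let \<open>Q\<close> be the centred quadratic form and \<open>T = \<Sum> X\<^sub>k\<^sup>2\<close>. One integration by parts in
\<open>E (Q Q\<^sup>2\<^sup>p\<^sup>-\<^sup>1)\<close> cancels the centring and leaves \<open>E Q\<^sup>2\<^sup>p \<le> C E (T Q\<^sup>2\<^sup>p\<^sup>-\<^sup>2)\<close>, where \<open>C\<close> contains the norm
bound \<open>\<rho>\<close> of the covariance matrix. Young's inequality absorbs the powers of \<open>Q\<close> on the left. As \<open>T\<close>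
has the size of the number \<open>N\<close> of terms, \<open>Q\<close> has the size of \<open>\<surd>N\<close> in every moment, the same as for
independent summands.\<close>

lemma centered_quadratic_form_moment:
  fixes X :: "int \<Rightarrow> 'a \<Rightarrow> real"
  assumes I: "finite I" and X: "\<And>k. X k \<in> H"
    and r: "\<And>k m. r k m = (LINT \<omega>|M. X k \<omega> * X m \<omega>)"
    and row: "\<And>k. k \<in> I \<Longrightarrow> (\<Sum>m\<in>I. \<bar>r k m\<bar>) \<le> \<rho>"
    and a: "\<And>k. k \<in> I \<Longrightarrow> \<bar>a k\<bar> \<le> 1" and p: "p \<ge> 1" and \<rho>: "\<rho> \<ge> 0"
  shows "all_moments M (\<lambda>\<omega>. \<Sum>k\<in>I. a k * ((X k \<omega>)\<^sup>2 - r k k))"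
    and "(LINT \<omega>|M. (\<Sum>k\<in>I. a k * ((X k \<omega>)\<^sup>2 - r k k)) ^ (2 * p)) \<le>
      (8 * real p * \<rho>) ^ p * (LINT \<omega>|M. (\<Sum>k\<in>I. (X k \<omega>)\<^sup>2) ^ p)"
proof -
  define Q where "Q \<omega> = (\<Sum>k\<in>I. a k * ((X k \<omega>)\<^sup>2 - r k k))" for \<omega>
  define S where "S k \<omega> = (\<Sum>m\<in>I. a m * r k m * X m \<omega>)" for k \<omega>
  define T where "T \<omega> = (\<Sum>k\<in>I. (X k \<omega>)\<^sup>2)" for \<omega>
  note mX = all_moments[OF X]
  have mQ: "all_moments M Q" unfolding Q_def by (intro all_moments_intros mX)
  have mS: "all_moments M (S k)" for k unfolding S_def by (intro all_moments_intros mX)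
  have mT: "all_moments M T" unfolding T_def by (intro all_moments_intros mX)
  show "all_moments M (\<lambda>\<omega>. \<Sum>k\<in>I. a k * ((X k \<omega>)\<^sup>2 - r k k))"
    using mQ unfolding Q_def .
  \<comment> \<open>The covariance derivative of \<open>Q\<close> in the direction of \<open>X k\<close> is \<open>2 S k\<close>.\<close>
  have step: "stein_pair (X k) (\<lambda>\<omega>. P \<omega> * Q \<omega>) (\<lambda>\<omega>. P' \<omega> * Q \<omega> + 2 * S k \<omega> * P \<omega>)"
    if P: "stein_pair (X k) P P'" for k P P'
  proof -
    have "stein_pair (X k)
      (\<lambda>\<omega>. \<Sum>m\<in>I. a m * (P \<omega> * X m \<omega> * X m \<omega> + (- r m m) * P \<omega>))
      (\<lambda>\<omega>. \<Sum>m\<in>I. a m * (((P' \<omega> * X m \<omega> + r k m * P \<omega>) * X m \<omega> + r k m * (P \<omega> * X m \<omega>)) + (- r m m) * P' \<omega>))"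
      unfolding r by (intro stein_pair_sum stein_pair_scale stein_pair_add stein_pair_mult X P)
    also have "(\<lambda>\<omega>. \<Sum>m\<in>I. a m * (P \<omega> * X m \<omega> * X m \<omega> + (- r m m) * P \<omega>)) = (\<lambda>\<omega>. P \<omega> * Q \<omega>)"
      unfolding Q_def sum_distrib_left
      by (intro ext sum.cong) (auto simp: algebra_simps power2_eq_square)
    also have "(\<lambda>\<omega>. \<Sum>m\<in>I. a m * (((P' \<omega> * X m \<omega> + r k m * P \<omega>) * X m \<omega> + r k m * (P \<omega> * X m \<omega>)) + (- r m m) * P' \<omega>))
      = (\<lambda>\<omega>. P' \<omega> * Q \<omega> + 2 * S k \<omega> * P \<omega>)"
      unfolding Q_def S_def sum_distrib_left sum_distrib_right sum.distrib[symmetric]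
      by (intro ext sum.cong) (auto simp: algebra_simps power2_eq_square)
    finally show ?thesis .
  qed
  have pow: "stein_pair (X k) (\<lambda>\<omega>. Q \<omega> ^ j) (\<lambda>\<omega>. 2 * real j * S k \<omega> * Q \<omega> ^ (j - 1))" for k j
  proof (induction j)
    case 0
    then show ?case using stein_pair_const[OF X] by simp
  next
    case (Suc j)
    have "(\<lambda>\<omega>. 2 * real j * S k \<omega> * Q \<omega> ^ (j - 1) * Q \<omega> + 2 * S k \<omega> * Q \<omega> ^ j) =
       (\<lambda>\<omega>. 2 * real (Suc j) * S k \<omega> * Q \<omega> ^ (Suc j - 1))"
      by (cases j) (auto simp: algebra_simps)
    with step[OF Suc] show ?case by (simp add: mult.commute)
  qed
  define j where "j = 2 * p - 1"
  have int: "integrable M (\<lambda>\<omega>. (X k \<omega>)\<^sup>2 * Q \<omega> ^ j)" "integrable M (\<lambda>\<omega>. Q \<omega> ^ j)"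
     "integrable M (\<lambda>\<omega>. S k \<omega> * Q \<omega> ^ (j - 1) * X k \<omega>)" for k
    by (intro all_moments_integrable all_moments_intros mX mQ mS)+
  have ibp: "(LINT \<omega>|M. (X k \<omega>)\<^sup>2 * Q \<omega> ^ j) - r k k * (LINT \<omega>|M. Q \<omega> ^ j) =
      2 * real j * (LINT \<omega>|M. S k \<omega> * Q \<omega> ^ (j - 1) * X k \<omega>)" for k
  proof -
    have "(LINT \<omega>|M. X k \<omega> * (Q \<omega> ^ j * X k \<omega>)) =
        (LINT \<omega>|M. 2 * real j * S k \<omega> * Q \<omega> ^ (j - 1) * X k \<omega> + r k k * Q \<omega> ^ j)"
      unfolding r by (rule stein_pair_identity[OF stein_pair_mult[OF X pow X] X])
    also have "\<dots> = (LINT \<omega>|M. 2 * real j * (S k \<omega> * Q \<omega> ^ (j - 1) * X k \<omega>) + r k k * Q \<omega> ^ j)"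
      by (simp add: mult_ac)
    also have "\<dots> = 2 * real j * (LINT \<omega>|M. S k \<omega> * Q \<omega> ^ (j - 1) * X k \<omega>) + r k k * (LINT \<omega>|M. Q \<omega> ^ j)"
      using int by simp
    finally show ?thesis by (simp add: power2_eq_square mult_ac)
  qed
  have j: "2 * p = Suc j" "j - 1 = 2 * (p - 1)" using p by (auto simp: j_def)
  have QQ: "Q \<omega> ^ (2 * p) = (\<Sum>k\<in>I. a k * ((X k \<omega>)\<^sup>2 * Q \<omega> ^ j - r k k * Q \<omega> ^ j))" for \<omega>
    unfolding j power_Suc by (subst (1) Q_def) (simp only: sum_distrib_right mult.assoc left_diff_distrib)
  define c where "c = 8 * real p * \<rho>"
  have c: "c \<ge> 0" using \<rho> by (simp add: c_def)
  have "(LINT \<omega>|M. Q \<omega> ^ (2 * p)) =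
      (\<Sum>k\<in>I. a k * ((LINT \<omega>|M. (X k \<omega>)\<^sup>2 * Q \<omega> ^ j) - r k k * (LINT \<omega>|M. Q \<omega> ^ j)))"
    unfolding QQ using int by (simp add: Bochner_Integration.integral_sum)
  also have "\<dots> = 2 * real j * (LINT \<omega>|M. (\<Sum>k\<in>I. a k * (S k \<omega> * Q \<omega> ^ (j - 1) * X k \<omega>)))"
  proof -
    have "(LINT \<omega>|M. (\<Sum>k\<in>I. a k * (S k \<omega> * Q \<omega> ^ (j - 1) * X k \<omega>))) =
        (\<Sum>k\<in>I. a k * (LINT \<omega>|M. S k \<omega> * Q \<omega> ^ (j - 1) * X k \<omega>))"
      using int by simp
    then show ?thesis unfolding ibp by (simp add: sum_distrib_left mult.left_commute)
  qed
  also have "\<dots> \<le> 2 * real j * (LINT \<omega>|M. \<rho> * (T \<omega> * ((Q \<omega>)\<^sup>2 ^ (p - 1))))"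
  proof (intro mult_left_mono integral_mono)
    fix \<omega>
    have "(\<Sum>k\<in>I. a k * (S k \<omega> * Q \<omega> ^ (j - 1) * X k \<omega>)) =
      (\<Sum>k\<in>I. \<Sum>m\<in>I. a k * a m * r k m * X k \<omega> * X m \<omega>) * (Q \<omega>)\<^sup>2 ^ (p - 1)"
      unfolding j power_mult S_def sum_distrib_left sum_distrib_right by (simp add: mult_ac)
    also have "\<dots> \<le> (\<rho> * T \<omega>) * (Q \<omega>)\<^sup>2 ^ (p - 1)"
      unfolding T_def
      by (intro mult_right_mono quadratic_form_le_row_sum) (auto simp: a row, auto simp: r mult_ac)
    finally show "(\<Sum>k\<in>I. a k * (S k \<omega> * Q \<omega> ^ (j - 1) * X k \<omega>)) \<le> \<rho> * (T \<omega> * ((Q \<omega>)\<^sup>2 ^ (p - 1)))"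
      by (simp add: mult_ac)
  qed (auto intro!: all_moments_integrable all_moments_intros mX mQ mS mT)
  also have "\<dots> \<le> 4 * real p * \<rho> * (LINT \<omega>|M. T \<omega> * ((Q \<omega>)\<^sup>2 ^ (p - 1)))"
  proof -
    have "0 \<le> (LINT \<omega>|M. T \<omega> * ((Q \<omega>)\<^sup>2 ^ (p - 1)))"
      by (intro Bochner_Integration.integral_nonneg) (auto simp: T_def intro!: sum_nonneg mult_nonneg_nonneg)
    then have "(2 * real j) * (\<rho> * (LINT \<omega>|M. T \<omega> * ((Q \<omega>)\<^sup>2 ^ (p - 1)))) \<le> (4 * real p) * (\<rho> * (LINT \<omega>|M. T \<omega> * ((Q \<omega>)\<^sup>2 ^ (p - 1))))"
      using \<rho> by (intro mult_right_mono) (auto simp: j_def)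
    then show ?thesis by (simp add: mult_ac)
  qed
  finally have Q1: "(LINT \<omega>|M. Q \<omega> ^ (2 * p)) \<le> 4 * real p * \<rho> * (LINT \<omega>|M. T \<omega> * ((Q \<omega>)\<^sup>2 ^ (p - 1)))" .
  have "2 * (LINT \<omega>|M. Q \<omega> ^ (2 * p)) \<le> (LINT \<omega>|M. c * T \<omega> * ((Q \<omega>)\<^sup>2 ^ (p - 1)))"
  proof -
    have "(LINT \<omega>|M. c * T \<omega> * ((Q \<omega>)\<^sup>2 ^ (p - 1))) = c * (LINT \<omega>|M. T \<omega> * ((Q \<omega>)\<^sup>2 ^ (p - 1)))"
      by (simp add: mult.assoc)
    moreover have "c * L = 2 * (4 * real p * \<rho> * L)" for L by (simp add: c_def)
    ultimately show ?thesis using Q1 by (simp only:)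
  qed
  also have "\<dots> \<le> (LINT \<omega>|M. Q \<omega> ^ (2 * p) + c ^ p * T \<omega> ^ p)"
  proof (intro integral_mono)
    fix \<omega>
    show "c * T \<omega> * ((Q \<omega>)\<^sup>2 ^ (p - 1)) \<le> Q \<omega> ^ (2 * p) + c ^ p * T \<omega> ^ p"
      unfolding power_mult by (rule young_power) (use p in \<open>auto simp: c T_def intro!: sum_nonneg\<close>)
  qed (auto intro!: all_moments_integrable all_moments_intros mX mQ mS mT)
  also have "\<dots> = (LINT \<omega>|M. Q \<omega> ^ (2 * p)) + c ^ p * (LINT \<omega>|M. T \<omega> ^ p)"
    by (subst Bochner_Integration.integral_add) (auto intro!: all_moments_integrable all_moments_intros mX mQ mS mT)
  finally show "(LINT \<omega>|M. (\<Sum>k\<in>I. a k * ((X k \<omega>)\<^sup>2 - r k k)) ^ (2 * p)) \<le>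
      (8 * real p * \<rho>) ^ p * (LINT \<omega>|M. (\<Sum>k\<in>I. (X k \<omega>)\<^sup>2) ^ p)"
    unfolding Q_def T_def c_def by simp
qed

text \<open>Markov's inequality for the \<open>2p\<close>-th moment. The crude bound \<open>E T\<^sup>p \<le> N\<^sup>p \<Sum> E X\<^sub>k\<^sup>2\<^sup>p\<close> costs one factor
\<open>N\<close>, which a larger \<open>p\<close> makes up for.\<close>

lemma centered_quadratic_form_tail:
  fixes X :: "int \<Rightarrow> 'a \<Rightarrow> real"
  assumes I: "finite I" and X: "\<And>k. X k \<in> H"
    and r: "\<And>k m. r k m = (LINT \<omega>|M. X k \<omega> * X m \<omega>)"
    and row: "\<And>k. k \<in> I \<Longrightarrow> (\<Sum>m\<in>I. \<bar>r k m\<bar>) \<le> \<rho>"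
    and a: "\<And>k. k \<in> I \<Longrightarrow> \<bar>a k\<bar> \<le> 1" and p: "p \<ge> 1" and \<rho>: "\<rho> \<ge> 0" and s: "s > 0"
  shows "prob {\<omega>\<in>space M. \<bar>\<Sum>k\<in>I. a k * ((X k \<omega>)\<^sup>2 - r k k)\<bar> \<ge> s} \<le>
      (8 * real p * \<rho>\<^sup>2) ^ p * fact (2 * p) * real (card I) ^ Suc p / s ^ (2 * p)"
proof -
  let ?Q = "\<lambda>\<omega>. \<Sum>k\<in>I. a k * ((X k \<omega>)\<^sup>2 - r k k)"
  note mX = all_moments[OF X]
  have mQ: "all_moments M ?Q"
    by (intro all_moments_intros mX)
  have [measurable]: "?Q \<in> borel_measurable M" using mQ by (rule all_moments_measurable)
  have var: "(LINT \<omega>|M. X k \<omega> ^ 2) \<le> \<rho>" if "k \<in> I" for k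
  proof -
    have "(LINT \<omega>|M. X k \<omega> ^ 2) = r k k" by (simp add: r power2_eq_square)
    also have "\<dots> \<le> \<bar>r k k\<bar>" by simp
    also have "\<dots> \<le> (\<Sum>m\<in>I. \<bar>r k m\<bar>)"
      using I that by (intro member_le_sum) auto
    finally show ?thesis using row[OF that] by simp
  qed
  have "(LINT \<omega>|M. (\<Sum>k\<in>I. (X k \<omega>)\<^sup>2) ^ p) \<le> (LINT \<omega>|M. real (card I) ^ p * (\<Sum>k\<in>I. (X k \<omega>)\<^sup>2 ^ p))"
    by (intro integral_mono sum_power_le_card I p) (auto intro!: all_moments_integrable all_moments_intros mX)
  also have "\<dots> = real (card I) ^ p * (\<Sum>k\<in>I. LINT \<omega>|M. (X k \<omega>)\<^sup>2 ^ p)"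
    by (subst integral_mult_right_zero, subst Bochner_Integration.integral_sum)
       (auto intro!: all_moments_integrable all_moments_intros mX)
  also have "\<dots> \<le> real (card I) ^ p * (\<Sum>k\<in>I. fact (2 * p) * \<rho> ^ p)"
    by (intro mult_left_mono sum_mono even_moment_le X var) auto
  also have "\<dots> = fact (2 * p) * \<rho> ^ p * real (card I) ^ Suc p"
    unfolding sum_constant power_Suc by (simp only: mult_ac)
  finally have T: "(LINT \<omega>|M. (\<Sum>k\<in>I. (X k \<omega>)\<^sup>2) ^ p) \<le> fact (2 * p) * \<rho> ^ p * real (card I) ^ Suc p" .
  have "{\<omega>\<in>space M. \<bar>?Q \<omega>\<bar> \<ge> s} \<subseteq> {\<omega>\<in>space M. ?Q \<omega> ^ (2 * p) \<ge> s ^ (2 * p)}"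
  proof safe
    fix \<omega> assume "s \<le> \<bar>?Q \<omega>\<bar>"
    then have "s ^ (2 * p) \<le> \<bar>?Q \<omega>\<bar> ^ (2 * p)" using s by (intro power_mono) auto
    then show "s ^ (2 * p) \<le> ?Q \<omega> ^ (2 * p)" by (simp add: power_even_abs)
  qed
  then have "prob {\<omega>\<in>space M. \<bar>?Q \<omega>\<bar> \<ge> s} \<le> prob {\<omega>\<in>space M. ?Q \<omega> ^ (2 * p) \<ge> s ^ (2 * p)}"
    by (intro finite_measure_mono) auto
  also have "\<dots> \<le> (LINT \<omega>|M. ?Q \<omega> ^ (2 * p)) / s ^ (2 * p)"
    using s by (intro integral_Markov_inequality_measure[where A="{}"] AE_I2)
      (auto intro!: all_moments_integrable all_moments_intros mX)
  also have "\<dots> \<le> ((8 * real p * \<rho>) ^ p * (fact (2 * p) * \<rho> ^ p * real (card I) ^ Suc p)) / s ^ (2 * p)"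
    using s \<rho> order_trans[OF centered_quadratic_form_moment(2)[OF I X r row a p \<rho>] mult_left_mono[OF T]]
    by (intro divide_right_mono) auto
  finally show ?thesis by (simp add: power_mult_distrib power2_eq_square mult_ac)
qed

end

section \<open>Jointly Gaussian families\<close>

definition linear_combinations :: "('i \<Rightarrow> 'a \<Rightarrow> real) \<Rightarrow> ('a \<Rightarrow> real) set" where
  "linear_combinations X = {\<lambda>\<omega>. \<Sum>j\<in>J. a j * X j \<omega> | J a. finite J}"

lemma linear_combinations_self: "X k \<in> linear_combinations X"
  unfolding linear_combinations_def
  by (intro CollectI exI[of _ "{k}"] exI[of _ "\<lambda>_. 1"]) auto

lemma linear_combinations_scale:
  assumes "Y \<in> linear_combinations X"
  shows "(\<lambda>\<omega>. u * Y \<omega>) \<in> linear_combinations X"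
proof -
  obtain J a where "finite J" "Y = (\<lambda>\<omega>. \<Sum>j\<in>J. a j * X j \<omega>)"
    using assms by (auto simp: linear_combinations_def)
  then show ?thesis
    unfolding linear_combinations_def
    by (intro CollectI exI[of _ J] exI[of _ "\<lambda>j. u * a j"]) (auto simp: sum_distrib_left mult.assoc)
qed

lemma linear_combinations_add:
  assumes "Y \<in> linear_combinations X" "W \<in> linear_combinations X"
  shows "(\<lambda>\<omega>. Y \<omega> + W \<omega>) \<in> linear_combinations X"
proof -
  obtain J a where J: "finite J" "Y = (\<lambda>\<omega>. \<Sum>j\<in>J. a j * X j \<omega>)"
    using assms by (auto simp: linear_combinations_def)
  obtain K b where K: "finite K" "W = (\<lambda>\<omega>. \<Sum>j\<in>K. b j * X j \<omega>)"
    using assms by (auto simp: linear_combinations_def)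
  let ?c = "\<lambda>j. (if j \<in> J then a j else 0) + (if j \<in> K then b j else 0)"
  have "(\<Sum>j\<in>J. a j * X j \<omega>) + (\<Sum>j\<in>K. b j * X j \<omega>) = (\<Sum>j\<in>J \<union> K. ?c j * X j \<omega>)" for \<omega>
  proof -
    have "(\<Sum>j\<in>J. a j * X j \<omega>) = (\<Sum>j\<in>J \<union> K. (if j \<in> J then a j else 0) * X j \<omega>)"
      "(\<Sum>j\<in>K. b j * X j \<omega>) = (\<Sum>j\<in>J \<union> K. (if j \<in> K then b j else 0) * X j \<omega>)"
      using J K by (auto intro!: sum.mono_neutral_cong_left)
    then show ?thesis by (simp add: distrib_right sum.distrib)
  qed
  then show ?thesis
    using J K unfolding linear_combinations_def
    by (intro CollectI exI[of _ "J \<union> K"] exI[of _ ?c]) auto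
qed

lemma centered_normal_moment_recursion:
  assumes \<sigma>: "\<sigma> > 0"
  shows "(LINT x|lborel. normal_density 0 \<sigma> x * x ^ Suc d) =
    real d * (LINT x|lborel. normal_density 0 \<sigma> x * x ^ 2) * (LINT x|lborel. normal_density 0 \<sigma> x * x ^ (d - 1))"
proof -
  have even: "(LINT x|lborel. normal_density 0 \<sigma> x * x ^ (2 * j)) = fact (2 * j) / ((2 / \<sigma>\<^sup>2) ^ j * fact j)" for j
    using integral_normal_moment_even[OF \<sigma>, of 0 j] by simp
  have odd: "(LINT x|lborel. normal_density 0 \<sigma> x * x ^ (2 * j + 1)) = 0" for j
    using integral_normal_moment_odd[OF \<sigma>, of 0 j] by simp
  consider j where "d = 2 * j + 1" | "d = 0" | j where "d = 2 * Suc j"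
    by (metis oddE evenE mult_0_right not0_implies_Suc)
  then show ?thesis
  proof cases
    case 1
    have eq: "fact (2 * Suc j) / ((2 / \<sigma>\<^sup>2) ^ Suc j * fact (Suc j)) =
        real (2 * j + 1) * (fact (2 * 1) / ((2 / \<sigma>\<^sup>2) ^ 1 * fact 1)) * (fact (2 * j) / ((2 / \<sigma>\<^sup>2) ^ j * fact j))"
      using \<sigma> by (simp add: divide_simps)
    have "Suc d = 2 * Suc j" "d - 1 = 2 * j" "(2::nat) = 2 * 1" using 1 by auto
    then show ?thesis using eq 1 unfolding even[symmetric] by simp
  next
    case 2
    then show ?thesis using odd[of 0] by simp
  next
    case 3
    then have "Suc d = 2 * Suc j + 1" "d - 1 = 2 * j + 1" by auto
    then show ?thesis by (simp only: odd mult_zero_right)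
  qed
qed

text \<open>The law of a linear combination is only known to be some normal law or a point mass; its mean is 0
because the means of the generators vanish, and this fixes the parameter of the law.\<close>

lemma gaussian_space_linear_combinations:
  assumes M: "prob_space M" and G: "gaussian_family M X" and zero: "\<And>k. (LINT \<omega>|M. X k \<omega>) = 0"
  shows "gaussian_space M (linear_combinations X)"
proof -
  interpret prob_space M by (rule M)
  have gauss: "(AE \<omega> in M. Y \<omega> = 0) \<or> (\<exists>\<sigma>>0. distributed M lborel Y (normal_density 0 \<sigma>))"
    and meas: "Y \<in> borel_measurable M" if YL: "Y \<in> linear_combinations X" for Y
  proof -
    have law: "\<exists>\<mu>. (AE \<omega> in M. Y \<omega> = \<mu>) \<or> (\<exists>\<sigma>>0. distributed M lborel Y (normal_density \<mu> \<sigma>))"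
      if "Y \<in> linear_combinations X" for Y
      using that G unfolding linear_combinations_def gaussian_family_def by blast
    have measX: "X k \<in> borel_measurable M" for k
      using G by (auto simp: gaussian_family_def)
    have nonneg: "0 \<le> normal_density \<mu> \<sigma> x" for \<mu> \<sigma> x by simp
    have "integrable M (X k)" for k
    proof -
      obtain \<mu> where "(AE \<omega> in M. X k \<omega> = \<mu>) \<or> (\<exists>\<sigma>>0. distributed M lborel (X k) (normal_density \<mu> \<sigma>))"
        using law[OF linear_combinations_self] by blast
      then show ?thesis
      proof (elim disjE exE conjE)
        assume "AE \<omega> in M. X k \<omega> = \<mu>"
        then show ?thesis
          using measX by (subst integrable_cong_AE[of _ _ "\<lambda>_. \<mu>"]) auto
      next
        fix \<sigma> :: real assume "0 < \<sigma>" "distributed M lborel (X k) (normal_density \<mu> \<sigma>)"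
        then show ?thesis
          using distributed_integrable_var[OF _ nonneg integrable_normal_moment_nz_1] by blast
      qed
    qed
    then have mean: "(LINT \<omega>|M. Y \<omega>) = 0"
      using YL zero unfolding linear_combinations_def by (auto simp: Bochner_Integration.integral_sum)
    show m: "Y \<in> borel_measurable M"
      using YL measX unfolding linear_combinations_def by auto
    obtain \<mu> where "(AE \<omega> in M. Y \<omega> = \<mu>) \<or> (\<exists>\<sigma>>0. distributed M lborel Y (normal_density \<mu> \<sigma>))"
      using law[OF YL] by blast
    then show "(AE \<omega> in M. Y \<omega> = 0) \<or> (\<exists>\<sigma>>0. distributed M lborel Y (normal_density 0 \<sigma>))"
    proof (elim disjE exE conjE)
      assume ae: "AE \<omega> in M. Y \<omega> = \<mu>"
      then have "(LINT \<omega>|M. Y \<omega>) = (LINT \<omega>|M. \<mu>)"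
        using m by (intro integral_cong_AE) auto
      with mean have "\<mu> = 0" by (simp add: prob_space)
      with ae show ?thesis by simp
    next
      fix \<sigma> :: real assume *: "0 < \<sigma>" "distributed M lborel Y (normal_density \<mu> \<sigma>)"
      have "(LINT \<omega>|M. Y \<omega>) = (LINT x|lborel. normal_density \<mu> \<sigma> x * x)"
        using distributed_integral[OF *(2), of "\<lambda>x. x"] by simp
      also have "\<dots> = \<mu>" by (rule integral_normal_moment_nz_1[OF *(1)])
      finally show ?thesis using mean * by auto
    qed
  qed
  show ?thesis
  proof (unfold_locales)
    fix Y assume Y: "Y \<in> linear_combinations X"
    show "all_moments M Y"
      unfolding all_moments_def
    proof (intro conjI allI)
      fix p
      show "integrable M (\<lambda>\<omega>. \<bar>Y \<omega>\<bar> ^ p)"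
        using gauss[OF Y]
      proof (elim disjE exE conjE)
        assume "AE \<omega> in M. Y \<omega> = 0"
        then show ?thesis
          using meas[OF Y] by (subst integrable_cong_AE[of _ _ "\<lambda>_. \<bar>0\<bar> ^ p"]) auto
      next
        fix \<sigma> :: real assume "0 < \<sigma>" "distributed M lborel Y (normal_density 0 \<sigma>)"
        then show ?thesis
          using distributed_integrable[of M lborel Y "normal_density 0 \<sigma>" "\<lambda>x. \<bar>x\<bar> ^ p"]
            integrable_normal_moment_abs[of \<sigma> 0 p] by simp
      qed
    qed (rule meas[OF Y])
    fix d
    show "(LINT \<omega>|M. Y \<omega> ^ Suc d) = real d * (LINT \<omega>|M. (Y \<omega>)\<^sup>2) * (LINT \<omega>|M. Y \<omega> ^ (d - 1))"
      using gauss[OF Y]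
    proof (elim disjE exE conjE)
      assume ae: "AE \<omega> in M. Y \<omega> = 0"
      have "(LINT \<omega>|M. Y \<omega> ^ Suc d) = (LINT \<omega>|M. 0)" "(LINT \<omega>|M. (Y \<omega>)\<^sup>2) = (LINT \<omega>|M. 0)"
        using ae meas[OF Y] by (intro integral_cong_AE; auto)+
      then show ?thesis by simp
    next
      fix \<sigma> :: real assume *: "0 < \<sigma>" "distributed M lborel Y (normal_density 0 \<sigma>)"
      have "(LINT \<omega>|M. Y \<omega> ^ k) = (LINT x|lborel. normal_density 0 \<sigma> x * x ^ k)" for k
        using distributed_integral[OF *(2), of "\<lambda>x. x ^ k"] by simp
      then show ?thesis
        using centered_normal_moment_recursion[OF *(1), of d] by (simp only:)
    qed
  qed (auto intro: linear_combinations_add linear_combinations_scale)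
qed

section \<open>Mean square limits and covariances\<close>

definition square_integrable :: "'a measure \<Rightarrow> ('a \<Rightarrow> complex) \<Rightarrow> bool" where
  "square_integrable M U \<longleftrightarrow> U \<in> borel_measurable M \<and> integrable M (\<lambda>\<omega>. (cmod (U \<omega>))\<^sup>2)"

lemma square_integrable_mult_cnj:
  assumes "square_integrable M U" "square_integrable M V"
  shows "integrable M (\<lambda>\<omega>. U \<omega> * cnj (V \<omega>))"
proof (rule Bochner_Integration.integrable_bound[where f="\<lambda>\<omega>. (cmod (U \<omega>))\<^sup>2 + (cmod (V \<omega>))\<^sup>2"])
  have [measurable]: "U \<in> borel_measurable M" "V \<in> borel_measurable M"
    using assms by (auto simp: square_integrable_def)
  show "(\<lambda>\<omega>. U \<omega> * cnj (V \<omega>)) \<in> borel_measurable M"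
    by (intro borel_measurable_times borel_measurable_continuous_on[OF _ \<open>V \<in> _\<close>]) (auto intro: continuous_intros)
  show "integrable M (\<lambda>\<omega>. (cmod (U \<omega>))\<^sup>2 + (cmod (V \<omega>))\<^sup>2)"
    using assms by (auto simp: square_integrable_def)
  show "AE \<omega> in M. norm (U \<omega> * cnj (V \<omega>)) \<le> norm ((cmod (U \<omega>))\<^sup>2 + (cmod (V \<omega>))\<^sup>2)"
  proof (rule AE_I2)
    fix \<omega>
    have "2 * (cmod (U \<omega>) * cmod (V \<omega>)) \<le> (cmod (U \<omega>))\<^sup>2 + (cmod (V \<omega>))\<^sup>2"
      using sum_squares_bound[of "cmod (U \<omega>)" "cmod (V \<omega>)"] by simp
    moreover have "0 \<le> cmod (U \<omega>) * cmod (V \<omega>)" by simp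
    ultimately show "norm (U \<omega> * cnj (V \<omega>)) \<le> norm ((cmod (U \<omega>))\<^sup>2 + (cmod (V \<omega>))\<^sup>2)"
      unfolding norm_mult complex_mod_cnj real_norm_def by linarith
  qed
qed

lemma square_integrable_add:
  assumes "square_integrable M U" "square_integrable M V"
  shows "square_integrable M (\<lambda>\<omega>. U \<omega> + V \<omega>)"
  unfolding square_integrable_def
proof
  have [measurable]: "U \<in> borel_measurable M" "V \<in> borel_measurable M"
    using assms by (auto simp: square_integrable_def)
  show "(\<lambda>\<omega>. U \<omega> + V \<omega>) \<in> borel_measurable M" by measurable
  show "integrable M (\<lambda>\<omega>. (cmod (U \<omega> + V \<omega>))\<^sup>2)"
  proof (rule Bochner_Integration.integrable_bound[where f="\<lambda>\<omega>. 2 * ((cmod (U \<omega>))\<^sup>2 + (cmod (V \<omega>))\<^sup>2)"])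
    show "integrable M (\<lambda>\<omega>. 2 * ((cmod (U \<omega>))\<^sup>2 + (cmod (V \<omega>))\<^sup>2))"
      using assms by (auto simp: square_integrable_def)
    show "AE \<omega> in M. norm ((cmod (U \<omega> + V \<omega>))\<^sup>2) \<le> norm (2 * ((cmod (U \<omega>))\<^sup>2 + (cmod (V \<omega>))\<^sup>2))"
    proof (rule AE_I2)
      fix \<omega>
      have "(cmod (U \<omega> + V \<omega>))\<^sup>2 \<le> (cmod (U \<omega>) + cmod (V \<omega>))\<^sup>2"
        by (intro power_mono norm_triangle_ineq) auto
      also have "\<dots> \<le> 2 * ((cmod (U \<omega>))\<^sup>2 + (cmod (V \<omega>))\<^sup>2)"
        using sum_squares_bound[of "cmod (U \<omega>)" "cmod (V \<omega>)"] by (simp add: power2_sum)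
      finally show "norm ((cmod (U \<omega> + V \<omega>))\<^sup>2) \<le> norm (2 * ((cmod (U \<omega>))\<^sup>2 + (cmod (V \<omega>))\<^sup>2))" by simp
    qed
  qed measurable
qed

lemma square_integrable_scale: "square_integrable M U \<Longrightarrow> square_integrable M (\<lambda>\<omega>. c * U \<omega>)"
  by (auto simp: square_integrable_def norm_mult power_mult_distrib)

lemma square_integrable_diff:
  "square_integrable M U \<Longrightarrow> square_integrable M V \<Longrightarrow> square_integrable M (\<lambda>\<omega>. U \<omega> - V \<omega>)"
  using square_integrable_add[OF _ square_integrable_scale, of M U V "-1"] by simp

lemma square_integrable_zero: "square_integrable M (\<lambda>\<omega>. 0)"
  by (simp add: square_integrable_def)

lemma square_integrable_sum:
  "(\<And>i. i \<in> I \<Longrightarrow> square_integrable M (U i)) \<Longrightarrow> square_integrable M (\<lambda>\<omega>. \<Sum>i\<in>I. U i \<omega>)"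
  by (induction I rule: infinite_finite_induct) (auto intro: square_integrable_zero square_integrable_add)

lemma (in prob_space) square_integrable_const: "square_integrable M (\<lambda>\<omega>. c)"
  by (simp add: square_integrable_def)

lemma (in prob_space) square_integrable_integrable:
  "square_integrable M U \<Longrightarrow> integrable M U"
  using square_integrable_mult_cnj[OF _ square_integrable_const[of 1], of U] by simp

text \<open>The quadratic polynomial \<open>s \<mapsto> E (\<bar>U\<bar> - s \<bar>V\<bar>)\<^sup>2\<close> is nonnegative.\<close>

lemma cauchy_schwarz_integral:
  assumes U: "square_integrable M U" and V: "square_integrable M V"
  shows "cmod (LINT \<omega>|M. U \<omega> * cnj (V \<omega>)) \<le>
    sqrt ((LINT \<omega>|M. (cmod (U \<omega>))\<^sup>2) * (LINT \<omega>|M. (cmod (V \<omega>))\<^sup>2))"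
proof -
  define P where "P = (LINT \<omega>|M. cmod (U \<omega>) * cmod (V \<omega>))"
  let ?F = "LINT \<omega>|M. (cmod (U \<omega>))\<^sup>2" and ?G = "LINT \<omega>|M. (cmod (V \<omega>))\<^sup>2"
  have i: "integrable M (\<lambda>\<omega>. (cmod (U \<omega>))\<^sup>2)" "integrable M (\<lambda>\<omega>. (cmod (V \<omega>))\<^sup>2)"
    using U V by (auto simp: square_integrable_def)
  have iP: "integrable M (\<lambda>\<omega>. cmod (U \<omega>) * cmod (V \<omega>))"
    using integrable_norm[OF square_integrable_mult_cnj[OF U V]] by (simp add: norm_mult)
  have P: "cmod (LINT \<omega>|M. U \<omega> * cnj (V \<omega>)) \<le> P"
    using integral_norm_bound[of M "\<lambda>\<omega>. U \<omega> * cnj (V \<omega>)"] by (simp add: P_def norm_mult)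
  have P0: "P \<ge> 0" unfolding P_def by (intro Bochner_Integration.integral_nonneg) auto
  have G0: "?G \<ge> 0" by simp
  have quad: "0 \<le> ?F - 2 * s * P + s\<^sup>2 * ?G" for s
  proof -
    have "0 \<le> (LINT \<omega>|M. (cmod (U \<omega>) - s * cmod (V \<omega>))\<^sup>2)" by simp
    also have "\<dots> = (LINT \<omega>|M. (cmod (U \<omega>))\<^sup>2 - (2 * s) * (cmod (U \<omega>) * cmod (V \<omega>)) + s\<^sup>2 * (cmod (V \<omega>))\<^sup>2)"
      by (simp add: power2_eq_square algebra_simps)
    also have "\<dots> = ?F - 2 * s * P + s\<^sup>2 * ?G"
      using i iP by (simp add: P_def)
    finally show ?thesis .
  qed
  have "P\<^sup>2 \<le> ?F * ?G"
  proof (cases "?G = 0")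
    case True
    have "P = 0"
    proof (rule ccontr)
      assume "P \<noteq> 0"
      then show False using quad[of "(?F + 1) / (2 * P)"] True P0 by simp
    qed
    then show ?thesis using True by simp
  next
    case False
    then have "?G > 0" using G0 by linarith
    then show ?thesis using quad[of "P / ?G"]
      by (simp add: field_simps power2_eq_square)
  qed
  then have "P \<le> sqrt (?F * ?G)" using real_le_rsqrt by blast
  with P show ?thesis by linarith
qed

lemma integral_mult_cnj_tendsto:
  assumes U: "\<And>n. square_integrable M (U n)" and V: "\<And>n. square_integrable M (V n)"
    and X: "square_integrable M X" and Y: "square_integrable M Y"
    and UX: "(\<lambda>n. LINT \<omega>|M. (cmod (X \<omega> - U n \<omega>))\<^sup>2) \<longlonglongrightarrow> 0"
    and VY: "(\<lambda>n. LINT \<omega>|M. (cmod (Y \<omega> - V n \<omega>))\<^sup>2) \<longlonglongrightarrow> 0"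
  shows "(\<lambda>n. LINT \<omega>|M. U n \<omega> * cnj (V n \<omega>)) \<longlonglongrightarrow> (LINT \<omega>|M. X \<omega> * cnj (Y \<omega>))"
proof -
  let ?A = "\<lambda>n \<omega>. X \<omega> - U n \<omega>" and ?B = "\<lambda>n \<omega>. Y \<omega> - V n \<omega>"
  let ?N = "\<lambda>W. LINT \<omega>|M. (cmod (W \<omega>))\<^sup>2"
  have A: "square_integrable M (?A n)" and B: "square_integrable M (?B n)" for n
    by (intro square_integrable_diff U V X Y)+
  note ints = square_integrable_mult_cnj[OF A B] square_integrable_mult_cnj[OF A Y]
    square_integrable_mult_cnj[OF X B] square_integrable_mult_cnj[OF X Y]
  have expand: "(LINT \<omega>|M. f \<omega> - g \<omega> - h \<omega> + k \<omega>) =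
      (LINT \<omega>|M. f \<omega>) - (LINT \<omega>|M. g \<omega>) - (LINT \<omega>|M. h \<omega>) + (LINT \<omega>|M. k \<omega>)"
    if "integrable M f" "integrable M g" "integrable M h" "integrable M k" for f g h k :: "'a \<Rightarrow> complex"
    using that by simp
  have eq: "(LINT \<omega>|M. U n \<omega> * cnj (V n \<omega>)) - (LINT \<omega>|M. X \<omega> * cnj (Y \<omega>)) =
     (LINT \<omega>|M. ?A n \<omega> * cnj (?B n \<omega>)) - (LINT \<omega>|M. ?A n \<omega> * cnj (Y \<omega>)) - (LINT \<omega>|M. X \<omega> * cnj (?B n \<omega>))" for n
  proof -
    have "(LINT \<omega>|M. U n \<omega> * cnj (V n \<omega>)) =
      (LINT \<omega>|M. ?A n \<omega> * cnj (?B n \<omega>) - ?A n \<omega> * cnj (Y \<omega>) - X \<omega> * cnj (?B n \<omega>) + X \<omega> * cnj (Y \<omega>))"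
      by (intro Bochner_Integration.integral_cong) (auto simp: algebra_simps)
    also have "\<dots> = (LINT \<omega>|M. ?A n \<omega> * cnj (?B n \<omega>)) - (LINT \<omega>|M. ?A n \<omega> * cnj (Y \<omega>))
      - (LINT \<omega>|M. X \<omega> * cnj (?B n \<omega>)) + (LINT \<omega>|M. X \<omega> * cnj (Y \<omega>))"
      by (rule expand[OF ints])
    finally show ?thesis by simp
  qed
  have "(\<lambda>n. sqrt (?N (?A n) * ?N (?B n)) + sqrt (?N (?A n) * ?N Y) + sqrt (?N X * ?N (?B n))) \<longlonglongrightarrow>
      sqrt (0 * 0) + sqrt (0 * ?N Y) + sqrt (?N X * 0)"
    by (intro tendsto_intros UX VY)
  then have lim: "(\<lambda>n. sqrt (?N (?A n) * ?N (?B n)) + sqrt (?N (?A n) * ?N Y) + sqrt (?N X * ?N (?B n))) \<longlonglongrightarrow> 0"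
    by simp
  have "(\<lambda>n. (LINT \<omega>|M. U n \<omega> * cnj (V n \<omega>)) - (LINT \<omega>|M. X \<omega> * cnj (Y \<omega>))) \<longlonglongrightarrow> 0"
  proof (rule Lim_null_comparison[OF _ lim], rule always_eventually, rule allI)
    fix n
    show "norm ((LINT \<omega>|M. U n \<omega> * cnj (V n \<omega>)) - (LINT \<omega>|M. X \<omega> * cnj (Y \<omega>))) \<le>
       sqrt (?N (?A n) * ?N (?B n)) + sqrt (?N (?A n) * ?N Y) + sqrt (?N X * ?N (?B n))"
      unfolding eq
      by (intro order_trans[OF norm_triangle_ineq4] add_mono cauchy_schwarz_integral A B X Y)
  qed
  then show ?thesis by (simp add: LIM_zero_iff)
qed

context prob_space begin

lemma ccov_eq:
  assumes "square_integrable M U" "square_integrable M V"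
  shows "ccov M U V = (LINT \<omega>|M. U \<omega> * cnj (V \<omega>)) - (LINT \<omega>|M. U \<omega>) * cnj (LINT \<omega>|M. V \<omega>)"
proof -
  let ?u = "LINT \<omega>|M. U \<omega>" and ?v = "LINT \<omega>|M. V \<omega>"
  have i: "integrable M (\<lambda>\<omega>. U \<omega> * cnj (V \<omega>))" "integrable M U" "integrable M V"
    "integrable M (\<lambda>\<omega>. cnj (V \<omega>))"
    using assms by (auto intro: square_integrable_mult_cnj square_integrable_integrable)
  have "ccov M U V = (LINT \<omega>|M. U \<omega> * cnj (V \<omega>) - U \<omega> * cnj ?v - ?u * cnj (V \<omega>) + ?u * cnj ?v)"
    unfolding ccov_def by (simp add: algebra_simps)
  also have "\<dots> = (LINT \<omega>|M. U \<omega> * cnj (V \<omega>)) - ?u * cnj ?v - ?u * cnj ?v + ?u * cnj ?v"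
    using i by (simp add: prob_space)
  finally show ?thesis by simp
qed

lemma ccov_sum:
  assumes "\<And>i. i \<in> I \<Longrightarrow> square_integrable M (U i)" "\<And>j. j \<in> J \<Longrightarrow> square_integrable M (V j)"
  shows "ccov M (\<lambda>\<omega>. \<Sum>i\<in>I. c i * U i \<omega>) (\<lambda>\<omega>. \<Sum>j\<in>J. d j * V j \<omega>) =
    (\<Sum>i\<in>I. \<Sum>j\<in>J. c i * cnj (d j) * ccov M (U i) (V j))"
proof -
  have i: "i \<in> I \<Longrightarrow> j \<in> J \<Longrightarrow> integrable M (\<lambda>\<omega>. U i \<omega> * cnj (V j \<omega>))"
     "i \<in> I \<Longrightarrow> integrable M (U i)" "j \<in> J \<Longrightarrow> integrable M (V j)" for i j
    using assms by (auto intro: square_integrable_mult_cnj square_integrable_integrable)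
  have "(\<lambda>\<omega>. (\<Sum>i\<in>I. c i * U i \<omega>) * cnj (\<Sum>j\<in>J. d j * V j \<omega>)) =
      (\<lambda>\<omega>. \<Sum>i\<in>I. \<Sum>j\<in>J. c i * cnj (d j) * (U i \<omega> * cnj (V j \<omega>)))"
    by (simp add: sum_product mult_ac)
  then have "ccov M (\<lambda>\<omega>. \<Sum>i\<in>I. c i * U i \<omega>) (\<lambda>\<omega>. \<Sum>j\<in>J. d j * V j \<omega>) =
    (LINT \<omega>|M. (\<Sum>i\<in>I. \<Sum>j\<in>J. c i * cnj (d j) * (U i \<omega> * cnj (V j \<omega>)))) -
    (LINT \<omega>|M. (\<Sum>i\<in>I. c i * U i \<omega>)) * cnj (LINT \<omega>|M. (\<Sum>j\<in>J. d j * V j \<omega>))"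
    by (subst ccov_eq) (auto intro!: square_integrable_sum square_integrable_scale assms)
  also have "(LINT \<omega>|M. (\<Sum>i\<in>I. \<Sum>j\<in>J. c i * cnj (d j) * (U i \<omega> * cnj (V j \<omega>)))) =
    (\<Sum>i\<in>I. \<Sum>j\<in>J. c i * cnj (d j) * (LINT \<omega>|M. U i \<omega> * cnj (V j \<omega>)))"
    using i by (simp add: Bochner_Integration.integral_sum)
  also have "(LINT \<omega>|M. (\<Sum>i\<in>I. c i * U i \<omega>)) = (\<Sum>i\<in>I. c i * (LINT \<omega>|M. U i \<omega>))"
    using i by (simp add: Bochner_Integration.integral_sum)
  also have "(LINT \<omega>|M. (\<Sum>j\<in>J. d j * V j \<omega>)) = (\<Sum>j\<in>J. d j * (LINT \<omega>|M. V j \<omega>))"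
    using i by (simp add: Bochner_Integration.integral_sum)
  also have "(\<Sum>i\<in>I. c i * (LINT \<omega>|M. U i \<omega>)) * cnj (\<Sum>j\<in>J. d j * (LINT \<omega>|M. V j \<omega>)) =
     (\<Sum>i\<in>I. \<Sum>j\<in>J. c i * cnj (d j) * ((LINT \<omega>|M. U i \<omega>) * cnj (LINT \<omega>|M. V j \<omega>)))"
    by (simp add: sum_product mult_ac)
  also have "(\<Sum>i\<in>I. \<Sum>j\<in>J. c i * cnj (d j) * (LINT \<omega>|M. U i \<omega> * cnj (V j \<omega>))) - \<dots> =
    (\<Sum>i\<in>I. \<Sum>j\<in>J. c i * cnj (d j) * ((LINT \<omega>|M. U i \<omega> * cnj (V j \<omega>)) - (LINT \<omega>|M. U i \<omega>) * cnj (LINT \<omega>|M. V j \<omega>)))"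
    by (simp add: right_diff_distrib sum_subtractf)
  also have "\<dots> = (\<Sum>i\<in>I. \<Sum>j\<in>J. c i * cnj (d j) * ccov M (U i) (V j))"
    using assms by (intro sum.cong refl) (simp add: ccov_eq)
  finally show ?thesis .
qed

lemma ccov_diff:
  assumes "square_integrable M U" "square_integrable M U'" "square_integrable M V" "square_integrable M V'"
  shows "ccov M (\<lambda>\<omega>. U' \<omega> - U \<omega>) (\<lambda>\<omega>. V' \<omega> - V \<omega>) =
    ccov M U' V' - ccov M U V' - ccov M U' V + ccov M U V"
proof -
  define A where "A i = (if i then U' else U)" for i
  define B where "B i = (if i then V' else V)" for i
  define c :: "bool \<Rightarrow> complex" where "c i = (if i then 1 else -1)" for i
  have AB: "square_integrable M (A i)" "square_integrable M (B i)" for i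
    using assms by (auto simp: A_def B_def)
  have "ccov M (\<lambda>\<omega>. \<Sum>i\<in>UNIV. c i * A i \<omega>) (\<lambda>\<omega>. \<Sum>j\<in>UNIV. c j * B j \<omega>) =
    (\<Sum>i\<in>UNIV. \<Sum>j\<in>UNIV. c i * cnj (c j) * ccov M (A i) (B j))"
    by (rule ccov_sum) (rule AB)+
  then show ?thesis by (simp add: UNIV_bool A_def B_def c_def algebra_simps)
qed

text \<open>Covariances are continuous for mean square convergence. This covers the means too: a mean is the
inner product with the constant 1.\<close>

lemma ccov_tendsto:
  assumes U: "\<And>n. square_integrable M (U n)" and V: "\<And>n. square_integrable M (V n)"
    and X: "square_integrable M X" and Y: "square_integrable M Y"
    and UX: "(\<lambda>n. LINT \<omega>|M. (cmod (X \<omega> - U n \<omega>))\<^sup>2) \<longlonglongrightarrow> 0"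
    and VY: "(\<lambda>n. LINT \<omega>|M. (cmod (Y \<omega> - V n \<omega>))\<^sup>2) \<longlonglongrightarrow> 0"
  shows "(\<lambda>n. ccov M (U n) (V n)) \<longlonglongrightarrow> ccov M X Y"
proof -
  have mean: "(\<lambda>n. LINT \<omega>|M. W n \<omega>) \<longlonglongrightarrow> (LINT \<omega>|M. S \<omega>)"
    if "\<And>n. square_integrable M (W n)" "square_integrable M S" "(\<lambda>n. LINT \<omega>|M. (cmod (S \<omega> - W n \<omega>))\<^sup>2) \<longlonglongrightarrow> 0" for W S
    using integral_mult_cnj_tendsto[OF that(1) square_integrable_const that(2) square_integrable_const[of 1] that(3), of "\<lambda>_. 1"]
    by simp
  show ?thesis
    unfolding ccov_eq[OF U V] ccov_eq[OF X Y]
    by (intro tendsto_intros integral_mult_cnj_tendsto mean assms)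
qed

end

section \<open>Riemann sums on the circle\<close>

text \<open>The division points of \<open>[-\<pi>, \<pi>]\<close> into \<open>N\<close> equal parts.\<close>

definition circle_point :: "nat \<Rightarrow> nat \<Rightarrow> real" where
  "circle_point N i = - pi + 2 * pi * real i / real N"

definition circle_sum :: "(real \<Rightarrow> complex) \<Rightarrow> (real \<Rightarrow> 'a \<Rightarrow> complex) \<Rightarrow> nat \<Rightarrow> 'a \<Rightarrow> complex" where
  "circle_sum g Z N \<omega> =
     (\<Sum>i<N. g (circle_point N i) * (Z (circle_point N (Suc i)) \<omega> - Z (circle_point N i) \<omega>))"

lemma circle_point_0: "circle_point N 0 = - pi"
  by (simp add: circle_point_def)

lemma circle_point_N: "N > 0 \<Longrightarrow> circle_point N N = pi"
  by (simp add: circle_point_def)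

lemma circle_point_less: "N > 0 \<Longrightarrow> i < j \<Longrightarrow> circle_point N i < circle_point N j"
  by (simp add: circle_point_def divide_strict_right_mono)

lemma circle_point_le: "N > 0 \<Longrightarrow> i \<le> j \<Longrightarrow> circle_point N i \<le> circle_point N j"
  by (simp add: circle_point_def divide_right_mono)

lemma circle_point_mem: "N > 0 \<Longrightarrow> i \<le> N \<Longrightarrow> circle_point N i \<in> {-pi..pi}"
  using circle_point_le[of N 0 i] circle_point_le[of N i N]
  by (auto simp: circle_point_0 circle_point_N)

lemma circle_point_width: "circle_point N (Suc i) - circle_point N i = 2 * pi / real N"
  by (simp add: circle_point_def add_divide_distrib algebra_simps)

lemma circle_point_cell:
  assumes "N > 0" "x \<in> {-pi<..pi}"
  obtains i where "i < N" "x \<in> {circle_point N i<..circle_point N (Suc i)}"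
proof -
  have "\<exists>i<n. x \<in> {circle_point N i<..circle_point N (Suc i)}" if "x \<in> {circle_point N 0<..circle_point N n}" for n
    using that
  proof (induction n)
    case (Suc n)
    show ?case
    proof (cases "x \<le> circle_point N n")
      case True
      then show ?thesis using Suc by (auto intro: less_SucI)
    next
      case False
      then show ?thesis using Suc.prems by (intro exI[of _ n]) auto
    qed
  qed simp
  from this[of N] that show ?thesis using assms by (auto simp: circle_point_0 circle_point_N)
qed

lemma circle_point_cell_unique:
  assumes "N > 0" "x \<in> {circle_point N i<..circle_point N (Suc i)}"
    "x \<in> {circle_point N j<..circle_point N (Suc j)}"
  shows "i = j"
proof (rule ccontr)
  assume "i \<noteq> j"
  then consider "Suc i \<le> j" | "Suc j \<le> i" by linarith
  then show False
    using assms(2,3) circle_point_le[OF assms(1), of "Suc i" j] circle_point_le[OF assms(1), of "Suc j" i]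
    by cases auto
qed

lemma circle_partition_tagged_division:
  assumes N: "N > 0"
  shows "(\<lambda>i. (circle_point N i, {circle_point N i..circle_point N (Suc i)})) ` {..<N} tagged_division_of {-pi..pi}"
proof (rule tagged_division_ofI)
  let ?s = "(\<lambda>i. (circle_point N i, {circle_point N i..circle_point N (Suc i)})) ` {..<N}"
  show "finite ?s" by simp
  fix x K assume "(x, K) \<in> ?s"
  then obtain i where i: "i < N" "x = circle_point N i" "K = {circle_point N i..circle_point N (Suc i)}" by auto
  show "x \<in> K" using i circle_point_le[OF N, of i "Suc i"] by simp
  show "K \<subseteq> {-pi..pi}"
    using i circle_point_mem[OF N, of i] circle_point_mem[OF N, of "Suc i"] by auto
  show "\<exists>a b. K = cbox a b" using i by auto
next
  let ?s = "(\<lambda>i. (circle_point N i, {circle_point N i..circle_point N (Suc i)})) ` {..<N}"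
  fix x K x' K' assume "(x, K) \<in> ?s" "(x', K') \<in> ?s" "(x, K) \<noteq> (x', K')"
  then obtain i j where ij: "K = {circle_point N i..circle_point N (Suc i)}"
    "K' = {circle_point N j..circle_point N (Suc j)}" "i \<noteq> j" by auto
  then consider "Suc i \<le> j" | "Suc j \<le> i" by linarith
  then show "interior K \<inter> interior K' = {}"
    using ij circle_point_le[OF N, of "Suc i" j] circle_point_le[OF N, of "Suc j" i]
    by cases auto
next
  let ?s = "(\<lambda>i. (circle_point N i, {circle_point N i..circle_point N (Suc i)})) ` {..<N}"
  show "\<Union>{K. \<exists>x. (x, K) \<in> ?s} = {-pi..pi}"
  proof (intro equalityI subsetI)
    fix x assume "x \<in> \<Union>{K. \<exists>x. (x, K) \<in> ?s}"
    then obtain i where "i < N" "x \<in> {circle_point N i..circle_point N (Suc i)}" by blast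
    then show "x \<in> {-pi..pi}"
      using circle_point_mem[OF N, of i] circle_point_mem[OF N, of "Suc i"] by auto
  next
    fix x :: real assume x: "x \<in> {-pi..pi}"
    show "x \<in> \<Union>{K. \<exists>x. (x, K) \<in> ?s}"
    proof (cases "x = -pi")
      case True
      then have "x \<in> {circle_point N 0..circle_point N (Suc 0)}"
        using circle_point_le[OF N, of 0 1] by (simp add: circle_point_0)
      then show ?thesis using N by blast
    next
      case False
      then obtain i where "i < N" "x \<in> {circle_point N i<..circle_point N (Suc i)}"
        using circle_point_cell[OF N, of x] x by auto
      then have "i \<in> {..<N}" "x \<in> {circle_point N i..circle_point N (Suc i)}" by auto
      then show ?thesis by blast
    qed
  qed
qed

lemma has_ms_integral_circle_sum_tendsto:
  assumes "has_ms_integral M g Z Y"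
  shows "(\<lambda>N. LINT \<omega>|M. (cmod (Y \<omega> - circle_sum g Z (Suc N) \<omega>))\<^sup>2) \<longlonglongrightarrow> 0"
proof (rule LIMSEQ_I)
  fix e :: real assume "e > 0"
  then obtain d where d0: "d > 0" "\<forall>\<D>. \<D> tagged_division_of {-pi..pi} \<and> (\<lambda>x. ball x d) fine \<D> \<longrightarrow>
        (LINT \<omega>|M. (cmod (Y \<omega> - (\<Sum>(t, K)\<in>\<D>. g t * (Z (Sup K) \<omega> - Z (Inf K) \<omega>))))\<^sup>2) < e"
    using assms[unfolded has_ms_integral_def, rule_format, of e] by auto
  have d: "d > 0" "\<And>\<D>. \<D> tagged_division_of {-pi..pi} \<Longrightarrow> (\<lambda>x. ball x d) fine \<D> \<Longrightarrow>
        (LINT \<omega>|M. (cmod (Y \<omega> - (\<Sum>(t, K)\<in>\<D>. g t * (Z (Sup K) \<omega> - Z (Inf K) \<omega>))))\<^sup>2) < e"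
    using d0 by simp_all
  obtain N0 :: nat where N0: "2 * pi / d < real N0" using reals_Archimedean2 by blast
  show "\<exists>no. \<forall>n\<ge>no. norm ((LINT \<omega>|M. (cmod (Y \<omega> - circle_sum g Z (Suc n) \<omega>))\<^sup>2) - 0) < e"
  proof (intro exI allI impI)
    fix n assume n: "n \<ge> N0"
    define N where "N = Suc n"
    have N: "N > 0" by (simp add: N_def)
    let ?f = "\<lambda>i. (circle_point N i, {circle_point N i..circle_point N (Suc i)})"
    have "2 * pi / d < real N" using N0 n by (simp add: N_def)
    then have w: "2 * pi / real N < d" using d(1) N by (simp add: field_simps)
    have "(\<lambda>x. ball x d) fine ?f ` {..<N}"
    proof (rule fineI)
      fix x K assume "(x, K) \<in> ?f ` {..<N}"
      then obtain i where i: "x = circle_point N i" "K = {circle_point N i..circle_point N (Suc i)}" by auto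
      show "K \<subseteq> ball x d"
      proof
        fix y assume "y \<in> K"
        then show "y \<in> ball x d"
          using w circle_point_width[of N i] i by (simp add: dist_real_def)
      qed
    qed
    from d(2)[OF circle_partition_tagged_division[OF N] this]
    have *: "(LINT \<omega>|M. (cmod (Y \<omega> - (\<Sum>(t, K)\<in>?f ` {..<N}. g t * (Z (Sup K) \<omega> - Z (Inf K) \<omega>))))\<^sup>2) < e" .
    have inj: "inj_on ?f {..<N}"
      using circle_point_less[OF N] by (intro inj_onI) (metis Pair_inject less_irrefl linorder_neqE_nat)
    have "(\<Sum>(t, K)\<in>?f ` {..<N}. g t * (Z (Sup K) \<omega> - Z (Inf K) \<omega>)) = circle_sum g Z N \<omega>" for \<omega>
      using circle_point_le[OF N] by (simp add: sum.reindex[OF inj] circle_sum_def)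
    with * show "norm ((LINT \<omega>|M. (cmod (Y \<omega> - circle_sum g Z (Suc n) \<omega>))\<^sup>2) - 0) < e"
      by (simp add: N_def)
  qed
qed

text \<open>\<open>X k\<close> is the mean square limit of the sums \<open>\<Sum>\<^sub>i e\<^sup>i\<^sup>k\<^sup>x \<Delta>Z\<close> over uniform divisions, and covariances pass to the
limit. The covariances of the increments are the increments of the spectral covariance over rectangles.
The variables \<open>Z x\<close> may have nonzero means: these drop out of the covariances.\<close>

lemma (in prob_space) covariance_circle_sum_tendsto:
  assumes "harmonizable M X Z" and zero: "\<And>k. (LINT \<omega>|M. X k \<omega>) = 0"
  shows "(\<lambda>N. \<Sum>i<Suc N. \<Sum>j<Suc N.
      cis (of_int k * circle_point (Suc N) i) * cnj (cis (of_int m * circle_point (Suc N) j)) *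
      rect_incr (spectral_cov M Z) (circle_point (Suc N) i) (circle_point (Suc N) (Suc i))
        (circle_point (Suc N) j) (circle_point (Suc N) (Suc j)))
    \<longlonglongrightarrow> of_real (covariance M X k m)"
proof -
  let ?e = "\<lambda>k x. cis (of_int k * x)"
  have Z: "square_integrable M (Z x)" if "x \<in> {-pi..pi}" for x
    using assms(1) that by (auto simp: harmonizable_def square_integrable_def)
  have X: "square_integrable M (\<lambda>\<omega>. of_real (X k \<omega>))" for k
    using assms(1) unfolding harmonizable_def square_integrable_def
    by (auto intro: measurable_compose[OF _ borel_measurable_of_real])
  have dZ: "square_integrable M (\<lambda>\<omega>. Z (circle_point N (Suc i)) \<omega> - Z (circle_point N i) \<omega>)" if "i < N" for N i
    using that by (intro square_integrable_diff Z circle_point_mem) auto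
  have S: "square_integrable M (circle_sum g Z N)" for g N
    unfolding circle_sum_def[abs_def] by (intro square_integrable_sum square_integrable_scale dZ) auto
  have lim: "(\<lambda>N. LINT \<omega>|M. (cmod (of_real (X k \<omega>) - circle_sum (?e k) Z (Suc N) \<omega>))\<^sup>2) \<longlonglongrightarrow> 0" for k
    using assms(1) unfolding harmonizable_def by (intro has_ms_integral_circle_sum_tendsto) auto
  have "(\<lambda>N. ccov M (circle_sum (?e k) Z (Suc N)) (circle_sum (?e m) Z (Suc N))) \<longlonglongrightarrow>
      ccov M (\<lambda>\<omega>. of_real (X k \<omega>)) (\<lambda>\<omega>. of_real (X m \<omega>))"
    by (intro ccov_tendsto S X lim)
  also have "ccov M (\<lambda>\<omega>. of_real (X k \<omega>)) (\<lambda>\<omega>. of_real (X m \<omega>)) = of_real (covariance M X k m)"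
  proof -
    have "(LINT \<omega>|M. complex_of_real (X k \<omega>)) = 0" for k
      using zero integral_complex_of_real[of M "X k"] by simp
    moreover have "(LINT \<omega>|M. complex_of_real (X k \<omega>) * cnj (of_real (X m \<omega>))) = of_real (covariance M X k m)"
      unfolding covariance_def integral_complex_of_real[symmetric] by simp
    ultimately show ?thesis by (simp add: ccov_eq[OF X X])
  qed
  also have "(\<lambda>N. ccov M (circle_sum (?e k) Z (Suc N)) (circle_sum (?e m) Z (Suc N))) =
    (\<lambda>N. \<Sum>i<Suc N. \<Sum>j<Suc N.
      ?e k (circle_point (Suc N) i) * cnj (?e m (circle_point (Suc N) j)) *
      rect_incr (spectral_cov M Z) (circle_point (Suc N) i) (circle_point (Suc N) (Suc i))
        (circle_point (Suc N) j) (circle_point (Suc N) (Suc j)))"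
  proof
    fix N
    let ?p = "circle_point (Suc N)"
    have "ccov M (circle_sum (?e k) Z (Suc N)) (circle_sum (?e m) Z (Suc N)) =
      (\<Sum>i<Suc N. \<Sum>j<Suc N. ?e k (?p i) * cnj (?e m (?p j)) *
        ccov M (\<lambda>\<omega>. Z (?p (Suc i)) \<omega> - Z (?p i) \<omega>) (\<lambda>\<omega>. Z (?p (Suc j)) \<omega> - Z (?p j) \<omega>))"
      unfolding circle_sum_def[abs_def] by (rule ccov_sum) (auto intro!: dZ simp del: of_nat_Suc)
    also have "\<dots> = (\<Sum>i<Suc N. \<Sum>j<Suc N. ?e k (?p i) * cnj (?e m (?p j)) *
        rect_incr (spectral_cov M Z) (?p i) (?p (Suc i)) (?p j) (?p (Suc j)))"
      by (intro sum.cong refl arg_cong2[where f="(*)"])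
         (subst ccov_diff, (intro Z circle_point_mem; simp)+, simp add: rect_incr_def spectral_cov_def)
    finally show "ccov M (circle_sum (?e k) Z (Suc N)) (circle_sum (?e m) Z (Suc N)) =
      (\<Sum>i<Suc N. \<Sum>j<Suc N. ?e k (?p i) * cnj (?e m (?p j)) *
        rect_incr (spectral_cov M Z) (?p i) (?p (Suc i)) (?p j) (?p (Suc j)))" .
  qed
  finally show ?thesis .
qed

section \<open>The covariance as a sum over the spectral lines\<close>

lemma cmod_cis_diff_le: "cmod (cis x - cis y) \<le> \<bar>x - y\<bar>"
proof -
  have "cis x - cis y = cis y * (cis (x - y) - 1)"
    by (simp add: right_diff_distrib cis_mult)
  then have "cmod (cis x - cis y) = cmod (cis (x - y) - 1)" by (simp add: norm_mult)
  also have "\<dots> \<le> \<bar>x - y\<bar>"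
    using iexp_approx1[of "x - y" 0] by (simp add: cis_conv_exp)
  finally show ?thesis .
qed

text \<open>The parameters \<open>\<mu>\<close> of the points in which the line \<open>\<lambda> = \<mu> + b\<close> modulo \<open>2\<pi>\<close> meets the rectangle \<open>A \<times> C\<close>.\<close>

definition line_cell :: "real \<Rightarrow> real set \<Rightarrow> real set \<Rightarrow> real set" where
  "line_cell b A C = {\<mu> \<in> C. \<exists>x\<in>A. [x = \<mu> + b] (rmod (2 * pi))}"

lemma line_cell_measurable [measurable]: "line_cell b {a<..a'} {c<..c'} \<in> sets borel"
proof -
  have "line_cell b {a<..a'} {c<..c'} =
      {c<..c'} \<inter> (\<Union>n::int. {a + of_int n * (2 * pi) - b<..a' + of_int n * (2 * pi) - b})"
  proof (intro equalityI subsetI)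
    fix \<mu> assume "\<mu> \<in> line_cell b {a<..a'} {c<..c'}"
    then obtain x n where "\<mu> \<in> {c<..c'}" "x \<in> {a<..a'}" "\<mu> + b = x + of_int n * (2 * pi)"
      by (auto simp: line_cell_def rcong_altdef)
    then have "\<mu> \<in> {c<..c'}" "\<mu> \<in> {a + of_int n * (2 * pi) - b<..a' + of_int n * (2 * pi) - b}" by auto
    then show "\<mu> \<in> {c<..c'} \<inter> (\<Union>n::int. {a + of_int n * (2 * pi) - b<..a' + of_int n * (2 * pi) - b})"
      by blast
  next
    fix \<mu> assume "\<mu> \<in> {c<..c'} \<inter> (\<Union>n::int. {a + of_int n * (2 * pi) - b<..a' + of_int n * (2 * pi) - b})"
    then obtain n :: int where n: "\<mu> \<in> {c<..c'}"
      "\<mu> \<in> {a + of_int n * (2 * pi) - b<..a' + of_int n * (2 * pi) - b}" by blast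
    then have "\<mu> + b - of_int n * (2 * pi) \<in> {a<..a'}" by auto
    moreover have "[\<mu> + b - of_int n * (2 * pi) = \<mu> + b] (rmod (2 * pi))"
      unfolding rcong_altdef by (intro exI[of _ n]) simp
    ultimately show "\<mu> \<in> line_cell b {a<..a'} {c<..c'}"
      using n(1) unfolding line_cell_def by blast
  qed
  then show ?thesis by simp
qed

lemma circle_representative:
  obtains x where "x \<in> {-pi<..pi}" "[x = y] (rmod (2 * pi))"
proof
  define n where "n = \<lceil>(y - pi) / (2 * pi)\<rceil>"
  have "(y - pi) / (2 * pi) \<le> of_int n" "of_int n < (y - pi) / (2 * pi) + 1"
    unfolding n_def by linarith+
  then show "y - of_int n * (2 * pi) \<in> {-pi<..pi}"
    by (simp add: field_simps)
  show "[y - of_int n * (2 * pi) = y] (rmod (2 * pi))"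
    unfolding rcong_altdef by (intro exI[of _ n]) simp
qed

lemma circle_representative_unique:
  assumes "x \<in> {-pi<..pi}" "x' \<in> {-pi<..pi}" "[x = x'] (rmod (2 * pi))"
  shows "x = x'"
proof -
  obtain n :: int where n: "x' = x + of_int n * (2 * pi)"
    using assms(3) by (auto simp: rcong_altdef)
  have "of_int n * (2 * pi) < 1 * (2 * pi)" "(-1) * (2 * pi) < of_int n * (2 * pi)"
    using assms(1,2) unfolding n greaterThanAtMost_iff mult_minus_left mult_1 by linarith+
  then have "of_int n < (1::real)" "(-1::real) < of_int n"
    using mult_less_cancel_right_pos[of "2 * pi"] by (metis pi_gt_zero zero_less_mult_iff zero_less_numeral)+
  then have "n = 0" by linarith
  with n show ?thesis by simp
qed

lemma cis_rcong:
  assumes "[x = y] (rmod (2 * pi))"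
  shows "cis (of_int k * x) = cis (of_int k * y)"
proof -
  obtain n :: int where n: "y = x + of_int n * (2 * pi)"
    using assms by (auto simp: rcong_altdef)
  have "cis (of_int k * y) = cis (of_int k * x) * cis (2 * pi * of_int (k * n))"
    unfolding n cis_mult by (simp add: algebra_simps)
  then show ?thesis by (simp add: cis_multiple_2pi)
qed

text \<open>Each point of the line lies in exactly one cell of the division of the torus, hence the double sum has
one nonzero term, and this term compares the exponentials at points of the same cell.\<close>

lemma line_step_function_error:
  fixes k m :: int
  assumes N: "N > 0" and \<mu>: "\<mu> \<in> {-pi<..pi}"
  defines "p \<equiv> circle_point N"
  shows "cmod ((\<Sum>i<N. \<Sum>j<N. cis (of_int k * p i) * cnj (cis (of_int m * p j)) *
            indicator (line_cell b {p i<..p (Suc i)} {p j<..p (Suc j)}) \<mu>)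
          - cis (of_int k * (\<mu> + b)) * cnj (cis (of_int m * \<mu>)))
         \<le> (\<bar>of_int k\<bar> + \<bar>of_int m\<bar>) * (2 * pi / real N)"
proof -
  obtain x where x: "x \<in> {-pi<..pi}" "[x = \<mu> + b] (rmod (2 * pi))" by (rule circle_representative)
  obtain i0 where i0: "i0 < N" "x \<in> {p i0<..p (Suc i0)}"
    using circle_point_cell[OF N x(1)] unfolding p_def by metis
  obtain j0 where j0: "j0 < N" "\<mu> \<in> {p j0<..p (Suc j0)}"
    using circle_point_cell[OF N \<mu>] unfolding p_def by metis
  have ind: "(indicator (line_cell b {p i<..p (Suc i)} {p j<..p (Suc j)}) \<mu> :: complex) =
      (if i = i0 \<and> j = j0 then 1 else 0)" if "i < N" for i j
  proof -
    have "\<mu> \<in> line_cell b {p i<..p (Suc i)} {p j<..p (Suc j)} \<longleftrightarrow> i = i0 \<and> j = j0"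
    proof
      assume "\<mu> \<in> line_cell b {p i<..p (Suc i)} {p j<..p (Suc j)}"
      then obtain x' where x': "\<mu> \<in> {p j<..p (Suc j)}" "x' \<in> {p i<..p (Suc i)}" "[x' = \<mu> + b] (rmod (2 * pi))"
        by (auto simp: line_cell_def)
      have "x' \<in> {-pi<..pi}"
        using x'(2) that circle_point_mem[OF N, of i] circle_point_mem[OF N, of "Suc i"] unfolding p_def by auto
      moreover have "[x' = x] (rmod (2 * pi))" using x'(3) x(2) by (metis rcong_sym rcong_trans)
      ultimately have "x' = x" using x(1) circle_representative_unique by blast
      then show "i = i0 \<and> j = j0"
        using x' i0 j0 circle_point_cell_unique[OF N] unfolding p_def by blast
    next
      assume "i = i0 \<and> j = j0"
      then show "\<mu> \<in> line_cell b {p i<..p (Suc i)} {p j<..p (Suc j)}"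
        using i0 j0 x(2) unfolding line_cell_def by blast
    qed
    then show ?thesis by (simp add: indicator_def)
  qed
  have "(\<Sum>i<N. \<Sum>j<N. cis (of_int k * p i) * cnj (cis (of_int m * p j)) *
            indicator (line_cell b {p i<..p (Suc i)} {p j<..p (Suc j)}) \<mu>) =
      (\<Sum>i<N. \<Sum>j<N. if i = i0 then if j = j0 then cis (of_int k * p i) * cnj (cis (of_int m * p j)) else 0 else 0)"
    by (intro sum.cong refl) (simp add: ind)
  also have "\<dots> = (\<Sum>i<N. if i = i0 then (\<Sum>j<N. if j = j0 then cis (of_int k * p i) * cnj (cis (of_int m * p j)) else 0) else 0)"
    by (intro sum.cong refl) auto
  also have "\<dots> = cis (of_int k * p i0) * cnj (cis (of_int m * p j0))"
    using i0(1) j0(1) by (simp add: sum.delta)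
  finally have sum: "(\<Sum>i<N. \<Sum>j<N. cis (of_int k * p i) * cnj (cis (of_int m * p j)) *
            indicator (line_cell b {p i<..p (Suc i)} {p j<..p (Suc j)}) \<mu>) =
      cis (of_int k * p i0) * cnj (cis (of_int m * p j0))" .
  let ?w = "2 * pi / real N"
  have "\<bar>p i0 - x\<bar> \<le> ?w" "\<bar>p j0 - \<mu>\<bar> \<le> ?w"
    using i0(2) j0(2) circle_point_width[of N i0] circle_point_width[of N j0] unfolding p_def by auto
  then have a: "cmod (cis (of_int k * p i0) - cis (of_int k * x)) \<le> \<bar>of_int k\<bar> * ?w"
    "cmod (cnj (cis (of_int m * p j0)) - cnj (cis (of_int m * \<mu>))) \<le> \<bar>of_int m\<bar> * ?w"
    using cmod_cis_diff_le[of "of_int k * p i0" "of_int k * x"] cmod_cis_diff_le[of "of_int m * p j0" "of_int m * \<mu>"]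
    unfolding complex_cnj_diff[symmetric] complex_mod_cnj right_diff_distrib[symmetric] abs_mult
    by (meson abs_ge_zero mult_left_mono order_trans)+
  have split: "u * v - u' * v' = (u - u') * v + u' * (v - v')" for u v u' v' :: complex
    by (simp add: algebra_simps)
  have "cis (of_int k * p i0) * cnj (cis (of_int m * p j0)) - cis (of_int k * x) * cnj (cis (of_int m * \<mu>)) =
    (cis (of_int k * p i0) - cis (of_int k * x)) * cnj (cis (of_int m * p j0)) +
    cis (of_int k * x) * (cnj (cis (of_int m * p j0)) - cnj (cis (of_int m * \<mu>)))"
    by (rule split)
  also have "cmod \<dots> \<le> \<bar>of_int k\<bar> * ?w + \<bar>of_int m\<bar> * ?w"
    using a by (intro order_trans[OF norm_triangle_ineq] add_mono) (auto simp: norm_mult)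
  finally have "cmod (cis (of_int k * p i0) * cnj (cis (of_int m * p j0)) - cis (of_int k * x) * cnj (cis (of_int m * \<mu>)))
      \<le> (\<bar>of_int k\<bar> + \<bar>of_int m\<bar>) * ?w" by (simp only: distrib_right)
  then show ?thesis unfolding sum using cis_rcong[OF x(2), of k] by simp
qed

text \<open>The sum is the integral against \<open>g\<close> of a step function that approximates
\<open>\<mu> \<mapsto> e\<^sup>i\<^sup>k\<^sup>(\<^sup>\<mu>\<^sup>+\<^sup>b\<^sup>) e\<^sup>-\<^sup>i\<^sup>m\<^sup>\<mu>\<close> uniformly, by \<open>line_step_function_error\<close>.\<close>

lemma line_riemann_sum_tendsto:
  fixes g :: "real \<Rightarrow> complex" and k m :: int
  assumes g: "set_integrable lborel {-pi..pi} g"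
  shows "(\<lambda>N. \<Sum>i<Suc N. \<Sum>j<Suc N.
      cis (of_int k * circle_point (Suc N) i) * cnj (cis (of_int m * circle_point (Suc N) j)) *
      (LINT \<mu>:line_cell b {circle_point (Suc N) i<..circle_point (Suc N) (Suc i)}
        {circle_point (Suc N) j<..circle_point (Suc N) (Suc j)}|lborel. g \<mu>))
    \<longlonglongrightarrow> cis (of_int k * b) * (LINT x:{-pi..pi}|lborel. cis (of_int (k - m) * x) * g x)"
proof -
  \<comment> \<open>The cells are half open and leave out the point \<open>-\<pi>\<close>, which is a null set.\<close>
  define h where "h \<mu> = indicator {-pi<..pi} \<mu> *\<^sub>R g \<mu>" for \<mu>
  have "set_integrable lborel {-pi<..pi} g"
    by (rule set_integrable_subset[OF g]) auto
  then have h: "integrable lborel h"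
    unfolding set_integrable_def h_def .
  define \<phi> where "\<phi> N \<mu> = (\<Sum>i<Suc N. \<Sum>j<Suc N.
      cis (of_int k * circle_point (Suc N) i) * cnj (cis (of_int m * circle_point (Suc N) j)) *
      indicator (line_cell b {circle_point (Suc N) i<..circle_point (Suc N) (Suc i)}
        {circle_point (Suc N) j<..circle_point (Suc N) (Suc j)}) \<mu>)" for N \<mu>
  define \<psi> where "\<psi> \<mu> = cis (of_int k * (\<mu> + b)) * cnj (cis (of_int m * \<mu>))" for \<mu>
  have cell: "integrable lborel (\<lambda>\<mu>. indicator (line_cell b {c<..c'} {a<..a'}) \<mu> * h \<mu>)" for a a' c c'
    by (rule Bochner_Integration.integrable_bound[OF h])
       (use h in \<open>auto simp: indicator_def norm_mult intro!: borel_measurable_times\<close>)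
  have \<phi>h: "\<phi> N \<mu> * h \<mu> = (\<Sum>i<Suc N. \<Sum>j<Suc N.
      cis (of_int k * circle_point (Suc N) i) * cnj (cis (of_int m * circle_point (Suc N) j)) *
      (indicator (line_cell b {circle_point (Suc N) i<..circle_point (Suc N) (Suc i)}
        {circle_point (Suc N) j<..circle_point (Suc N) (Suc j)}) \<mu> * h \<mu>))" for N \<mu>
    unfolding \<phi>_def sum_distrib_right mult.assoc ..
  have i\<phi>: "integrable lborel (\<lambda>\<mu>. \<phi> N \<mu> * h \<mu>)" for N
    unfolding \<phi>h by (intro Bochner_Integration.integrable_sum integrable_mult_right cell)
  have \<psi>m: "\<psi> \<in> borel_measurable lborel"
    unfolding \<psi>_def by (simp, intro borel_measurable_continuous_onI continuous_intros)
  have i\<psi>: "integrable lborel (\<lambda>\<mu>. \<psi> \<mu> * h \<mu>)"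
  proof (rule Bochner_Integration.integrable_bound[OF h])
    show "(\<lambda>\<mu>. \<psi> \<mu> * h \<mu>) \<in> borel_measurable lborel"
      using h by (intro borel_measurable_times \<psi>m) auto
    show "AE \<mu> in lborel. norm (\<psi> \<mu> * h \<mu>) \<le> norm (h \<mu>)"
      by (simp add: \<psi>_def norm_mult)
  qed
  have S: "(\<Sum>i<Suc N. \<Sum>j<Suc N.
      cis (of_int k * circle_point (Suc N) i) * cnj (cis (of_int m * circle_point (Suc N) j)) *
      (LINT \<mu>:line_cell b {circle_point (Suc N) i<..circle_point (Suc N) (Suc i)}
        {circle_point (Suc N) j<..circle_point (Suc N) (Suc j)}|lborel. g \<mu>)) = (LINT \<mu>|lborel. \<phi> N \<mu> * h \<mu>)" for N
  proof -
    have "(LINT \<mu>:line_cell b {circle_point (Suc N) i<..circle_point (Suc N) (Suc i)}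
        {circle_point (Suc N) j<..circle_point (Suc N) (Suc j)}|lborel. g \<mu>) =
       (LINT \<mu>|lborel. indicator (line_cell b {circle_point (Suc N) i<..circle_point (Suc N) (Suc i)}
        {circle_point (Suc N) j<..circle_point (Suc N) (Suc j)}) \<mu> * h \<mu>)" if "j < Suc N" for i j
    proof -
      have "line_cell b A {circle_point (Suc N) j<..circle_point (Suc N) (Suc j)} \<subseteq> {-pi<..pi}" for A
        using that circle_point_mem[of "Suc N" j] circle_point_mem[of "Suc N" "Suc j"]
        by (auto simp: line_cell_def)
      then have "\<mu> \<in> {-pi<..pi}" if "\<mu> \<in> line_cell b A {circle_point (Suc N) j<..circle_point (Suc N) (Suc j)}" for A \<mu>
        using that by blast
      then show ?thesis
        unfolding set_lebesgue_integral_def h_def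
        by (intro Bochner_Integration.integral_cong refl) (simp add: indicator_def del: greaterThanAtMost_iff)
    qed
    then have "(\<Sum>i<Suc N. \<Sum>j<Suc N.
      cis (of_int k * circle_point (Suc N) i) * cnj (cis (of_int m * circle_point (Suc N) j)) *
      (LINT \<mu>:line_cell b {circle_point (Suc N) i<..circle_point (Suc N) (Suc i)}
        {circle_point (Suc N) j<..circle_point (Suc N) (Suc j)}|lborel. g \<mu>)) =
      (\<Sum>i<Suc N. \<Sum>j<Suc N.
      cis (of_int k * circle_point (Suc N) i) * cnj (cis (of_int m * circle_point (Suc N) j)) *
      (LINT \<mu>|lborel. indicator (line_cell b {circle_point (Suc N) i<..circle_point (Suc N) (Suc i)}
        {circle_point (Suc N) j<..circle_point (Suc N) (Suc j)}) \<mu> * h \<mu>))"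
      by (intro sum.cong refl) simp
    also have "\<dots> = (LINT \<mu>|lborel. \<phi> N \<mu> * h \<mu>)"
      unfolding \<phi>h using cell
      by (subst Bochner_Integration.integral_sum, (intro Bochner_Integration.integrable_sum integrable_mult_right cell)[1],
          subst Bochner_Integration.integral_sum, (intro Bochner_Integration.integrable_sum integrable_mult_right cell)[1])
         (simp only: integral_mult_right_zero)
    finally show ?thesis .
  qed
  have "(\<lambda>N. (\<bar>of_int k\<bar> + \<bar>of_int m\<bar>) * (2 * pi / real (Suc N)) * (LINT \<mu>|lborel. cmod (h \<mu>))) \<longlonglongrightarrow>
      (\<bar>of_int k\<bar> + \<bar>of_int m\<bar>) * 0 * (LINT \<mu>|lborel. cmod (h \<mu>))"
    by (intro tendsto_mult tendsto_const LIMSEQ_Suc[OF lim_const_over_n])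
  then have lim: "(\<lambda>N. (\<bar>of_int k\<bar> + \<bar>of_int m\<bar>) * (2 * pi / real (Suc N)) * (LINT \<mu>|lborel. cmod (h \<mu>))) \<longlonglongrightarrow> 0"
    by simp
  have "(\<lambda>N. (LINT \<mu>|lborel. \<phi> N \<mu> * h \<mu>) - (LINT \<mu>|lborel. \<psi> \<mu> * h \<mu>)) \<longlonglongrightarrow> 0"
  proof (rule Lim_null_comparison[OF _ lim], rule always_eventually, rule allI)
    fix N
    let ?c = "(\<bar>of_int k\<bar> + \<bar>of_int m\<bar>) * (2 * pi / real (Suc N))"
    have "norm ((LINT \<mu>|lborel. \<phi> N \<mu> * h \<mu>) - (LINT \<mu>|lborel. \<psi> \<mu> * h \<mu>)) =
        norm (LINT \<mu>|lborel. \<phi> N \<mu> * h \<mu> - \<psi> \<mu> * h \<mu>)"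
      using i\<phi> i\<psi> by simp
    also have "\<dots> \<le> (LINT \<mu>|lborel. norm (\<phi> N \<mu> * h \<mu> - \<psi> \<mu> * h \<mu>))" by (rule integral_norm_bound)
    also have "\<dots> \<le> (LINT \<mu>|lborel. ?c * cmod (h \<mu>))"
    proof (intro integral_mono)
      fix \<mu>
      show "norm (\<phi> N \<mu> * h \<mu> - \<psi> \<mu> * h \<mu>) \<le> ?c * cmod (h \<mu>)"
      proof (cases "\<mu> \<in> {-pi<..pi}")
        case True
        have "cmod (\<phi> N \<mu> - \<psi> \<mu>) \<le> ?c"
          unfolding \<phi>_def \<psi>_def using True by (intro line_step_function_error) auto
        then show ?thesis
          unfolding left_diff_distrib[symmetric] norm_mult by (rule mult_right_mono) simp
      qed (simp add: h_def)
    qed (use i\<phi> i\<psi> h in \<open>auto intro!: integrable_norm\<close>)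
    finally show "norm ((LINT \<mu>|lborel. \<phi> N \<mu> * h \<mu>) - (LINT \<mu>|lborel. \<psi> \<mu> * h \<mu>)) \<le> ?c * (LINT \<mu>|lborel. cmod (h \<mu>))"
      by simp
  qed
  then have "(\<lambda>N. LINT \<mu>|lborel. \<phi> N \<mu> * h \<mu>) \<longlonglongrightarrow> (LINT \<mu>|lborel. \<psi> \<mu> * h \<mu>)"
    by (simp add: LIM_zero_iff)
  also have "(LINT \<mu>|lborel. \<psi> \<mu> * h \<mu>) =
      cis (of_int k * b) * (LINT x:{-pi..pi}|lborel. cis (of_int (k - m) * x) * g x)"
  proof -
    have "\<psi> \<mu> = cis (of_int k * b) * cis (of_int (k - m) * \<mu>)" for \<mu>
      unfolding \<psi>_def cis_cnj cis_mult by (simp add: algebra_simps)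
    then have eq: "(LINT \<mu>|lborel. \<psi> \<mu> * h \<mu>) = cis (of_int k * b) * (LINT \<mu>|lborel. cis (of_int (k - m) * \<mu>) * h \<mu>)"
      by (simp only: mult.assoc integral_mult_right_zero)
    have e2: "cis (of_int (k - m) * \<mu>) * h \<mu> = indicator {-pi<..pi} \<mu> *\<^sub>R (cis (of_int (k - m) * \<mu>) * g \<mu>)" for \<mu>
      by (simp add: h_def)
    have gm: "(\<lambda>\<mu>. indicator {-pi..pi} \<mu> *\<^sub>R g \<mu>) \<in> borel_measurable lborel"
      using g unfolding set_integrable_def by auto
    have cm: "(\<lambda>\<mu>. cis (of_int (k - m) * \<mu>)) \<in> borel_measurable lborel"
      by (simp, intro borel_measurable_continuous_onI continuous_intros)
    have "(LINT \<mu>|lborel. cis (of_int (k - m) * \<mu>) * h \<mu>) =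
       (LINT \<mu>|lborel. cis (of_int (k - m) * \<mu>) * (indicator {-pi..pi} \<mu> *\<^sub>R g \<mu>))"
    proof (rule integral_cong_AE)
      show "AE \<mu> in lborel. cis (of_int (k - m) * \<mu>) * h \<mu> = cis (of_int (k - m) * \<mu>) * (indicator {-pi..pi} \<mu> *\<^sub>R g \<mu>)"
        using AE_lborel_singleton[of "-pi"] by eventually_elim (auto simp: h_def indicator_def)
    qed (intro borel_measurable_times cm gm borel_measurable_integrable[OF h])+
    with eq show ?thesis
      by (simp add: set_lebesgue_integral_def)
  qed
  finally show ?thesis unfolding S .
qed

lemma (in prob_space) covariance_line_expansion:
  assumes harm: "harmonizable M X Z" and zero: "\<And>k. (LINT \<omega>|M. X k \<omega>) = 0"
    and line: "line_spectrum (spectral_cov M Z) f" and fin: "finite (line_freqs f)"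
  shows "of_real (covariance M X k m) = (\<Sum>b\<in>line_freqs f. cis (of_int k * b) * line_coeff f b (k - m))"
proof -
  let ?F = "spectral_cov M Z"
  let ?c = "\<lambda>N i j. cis (of_int k * circle_point (Suc N) i) * cnj (cis (of_int m * circle_point (Suc N) j))"
  let ?I = "\<lambda>N i j b. LINT \<mu>:line_cell b {circle_point (Suc N) i<..circle_point (Suc N) (Suc i)}
        {circle_point (Suc N) j<..circle_point (Suc N) (Suc j)}|lborel. f b \<mu>"
  have rect: "rect_incr ?F (circle_point (Suc N) i) (circle_point (Suc N) (Suc i))
        (circle_point (Suc N) j) (circle_point (Suc N) (Suc j)) = (\<Sum>b\<in>line_freqs f. ?I N i j b)"
    if "i < Suc N" "j < Suc N" for N i j
  proof -
    let ?p = "circle_point (Suc N)"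
    have mem: "?p l \<in> {-pi..pi}" if "l \<le> Suc N" for l using that by (intro circle_point_mem) auto
    have le: "?p i \<le> ?p (Suc i)" "?p j \<le> ?p (Suc j)" by (intro circle_point_le; simp)+
    have "-pi \<le> ?p i \<and> ?p i \<le> ?p (Suc i) \<and> ?p (Suc i) \<le> pi \<and> -pi \<le> ?p j \<and> ?p j \<le> ?p (Suc j) \<and> ?p (Suc j) \<le> pi"
      using mem[of i] mem[of "Suc i"] mem[of j] mem[of "Suc j"] le that by auto
    then have "((\<lambda>b. ?I N i j b) has_sum rect_incr ?F (?p i) (?p (Suc i)) (?p j) (?p (Suc j))) (line_freqs f)"
      using line unfolding line_spectrum_def line_cell_def by blast
    then show ?thesis using fin by (simp add: has_sum_finite_iff)
  qed
  have "(\<lambda>N. \<Sum>b\<in>line_freqs f. \<Sum>i<Suc N. \<Sum>j<Suc N. ?c N i j * ?I N i j b) \<longlonglongrightarrow>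
      (\<Sum>b\<in>line_freqs f. cis (of_int k * b) * line_coeff f b (k - m))"
    unfolding line_coeff_def
    by (intro tendsto_sum line_riemann_sum_tendsto) (use line in \<open>auto simp: line_spectrum_def\<close>)
  also have "(\<lambda>N. \<Sum>b\<in>line_freqs f. \<Sum>i<Suc N. \<Sum>j<Suc N. ?c N i j * ?I N i j b) =
     (\<lambda>N. \<Sum>i<Suc N. \<Sum>j<Suc N. ?c N i j *
      rect_incr ?F (circle_point (Suc N) i) (circle_point (Suc N) (Suc i))
        (circle_point (Suc N) j) (circle_point (Suc N) (Suc j)))"
  proof
    fix N
    have "(\<Sum>b\<in>line_freqs f. \<Sum>i<Suc N. \<Sum>j<Suc N. ?c N i j * ?I N i j b) =
        (\<Sum>i<Suc N. \<Sum>j<Suc N. \<Sum>b\<in>line_freqs f. ?c N i j * ?I N i j b)"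
      by (subst sum.swap) (intro sum.cong refl sum.swap)
    also have "\<dots> = (\<Sum>i<Suc N. \<Sum>j<Suc N. ?c N i j *
      rect_incr ?F (circle_point (Suc N) i) (circle_point (Suc N) (Suc i))
        (circle_point (Suc N) j) (circle_point (Suc N) (Suc j)))"
      by (intro sum.cong refl) (simp add: rect sum_distrib_left)
    finally show "(\<Sum>b\<in>line_freqs f. \<Sum>i<Suc N. \<Sum>j<Suc N. ?c N i j * ?I N i j b) = \<dots>" .
  qed
  finally show ?thesis
    using covariance_circle_sum_tendsto[OF harm zero, of k m] by (rule LIMSEQ_unique[rotated])
qed

section \<open>The Dirichlet kernel\<close>

text \<open>On \<open>[0, \<pi>/2]\<close> the sine is concave: its slope over \<open>[0, y]\<close> is at least its slope over \<open>[y, \<pi>/2]\<close>.\<close>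

lemma sin_ge_chord:
  assumes "0 \<le> y" "y \<le> pi / 2"
  shows "2 / pi * y \<le> sin y"
proof (cases "y = 0 \<or> y = pi / 2")
  case False
  then have y: "0 < y" "y < pi / 2" using assms by auto
  have "\<exists>u. 0 < u \<and> u < y \<and> sin y - sin 0 = (y - 0) * cos u"
    using y by (intro MVT2) (auto intro!: derivative_eq_intros)
  then obtain u where u: "0 < u" "u < y" "sin y = y * cos u" by auto
  have "\<exists>v. y < v \<and> v < pi / 2 \<and> sin (pi / 2) - sin y = (pi / 2 - y) * cos v"
    using y by (intro MVT2) (auto intro!: derivative_eq_intros)
  then obtain v where v: "y < v" "v < pi / 2" "1 - sin y = (pi / 2 - y) * cos v" by auto
  have "cos v \<le> cos u" using u v y by (intro cos_monotone_0_pi_le) auto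
  then have "y * ((pi / 2 - y) * cos v) \<le> (pi / 2 - y) * (y * cos u)"
    using y by (simp add: mult.left_commute)
  then have "y * (1 - sin y) \<le> (pi / 2 - y) * sin y" using u v by simp
  then show ?thesis by (simp add: field_simps)
next
  case True
  moreover have "2 / pi * (pi / 2) = sin (pi / 2)" by simp
  ultimately show ?thesis by (metis mult_zero_right order_refl sin_zero)
qed

lemma abs_sin_half_ge:
  assumes "\<bar>x\<bar> \<le> pi"
  shows "\<bar>x\<bar> / pi \<le> \<bar>sin (x / 2)\<bar>"
proof -
  have "\<bar>x\<bar> / pi \<le> sin (\<bar>x\<bar> / 2)"
    using sin_ge_chord[of "\<bar>x\<bar> / 2"] assms by simp
  also have "\<dots> \<le> \<bar>sin (x / 2)\<bar>" by (cases "x \<ge> 0") auto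
  finally show ?thesis .
qed

lemma cos_le_parabola:
  assumes "\<bar>y\<bar> \<le> pi"
  shows "cos y \<le> 1 - 2 * y\<^sup>2 / pi\<^sup>2"
proof -
  have "(\<bar>y\<bar> / pi)\<^sup>2 \<le> \<bar>sin (y / 2)\<bar>\<^sup>2"
    using abs_sin_half_ge[OF assms] by (intro power_mono) auto
  then have "y\<^sup>2 / pi\<^sup>2 \<le> (sin (y / 2))\<^sup>2" by (simp add: power_divide)
  moreover have "cos y = 1 - 2 * (sin (y / 2))\<^sup>2"
    using cos_double_sin[of "y / 2"] by simp
  ultimately show ?thesis by simp
qed

definition dirichlet_kernel :: "nat \<Rightarrow> real \<Rightarrow> real" where
  "dirichlet_kernel h x = (\<Sum>k\<in>{- int h..int h}. cos (of_int k * x))"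

lemma symmetric_window_Suc:
  fixes g :: "int \<Rightarrow> 'b :: comm_monoid_add"
  shows "(\<Sum>k\<in>{- int (Suc h)..int (Suc h)}. g k) = (\<Sum>k\<in>{- int h..int h}. g k) + (g (int (Suc h)) + g (- int (Suc h)))"
proof -
  have "{- int (Suc h)..int (Suc h)} = insert (int (Suc h)) (insert (- int (Suc h)) {- int h..int h})" by auto
  then show ?thesis by (simp add: add_ac)
qed

lemma dirichlet_kernel_0: "dirichlet_kernel 0 x = 1"
  by (simp add: dirichlet_kernel_def)

lemma dirichlet_kernel_Suc:
  "dirichlet_kernel (Suc h) x = dirichlet_kernel h x + 2 * cos (real (Suc h) * x)"
  unfolding dirichlet_kernel_def symmetric_window_Suc by (simp del: of_nat_Suc)

lemma sum_cis_eq_dirichlet_kernel: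
  "(\<Sum>k\<in>{- int h..int h}. cis (of_int k * x)) = of_real (dirichlet_kernel h x)"
proof (induction h)
  case (Suc h)
  have "cis (real (Suc h) * x) + cis (- (real (Suc h) * x)) = of_real (2 * cos (real (Suc h) * x))"
    by (simp add: complex_eq_iff)
  with Suc show ?case
    unfolding symmetric_window_Suc dirichlet_kernel_Suc by (simp add: algebra_simps)
qed (simp add: dirichlet_kernel_0)

lemma sin_half_mult_dirichlet_kernel:
  "sin (x / 2) * dirichlet_kernel h x = sin ((real h + 1 / 2) * x)"
proof (induction h)
  case (Suc h)
  let ?y = "real (Suc h) * x"
  have "sin (?y + x / 2) - sin (?y - x / 2) = 2 * (sin (x / 2) * cos ?y)"
    unfolding sin_add sin_diff by simp
  moreover have "?y + x / 2 = (real (Suc h) + 1 / 2) * x" "?y - x / 2 = (real h + 1 / 2) * x"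
    by (simp_all add: algebra_simps)
  ultimately show ?case
    using Suc unfolding dirichlet_kernel_Suc by (simp add: distrib_left)
qed (simp add: dirichlet_kernel_0)

lemma dirichlet_kernel_abs_le: "\<bar>dirichlet_kernel h x\<bar> \<le> 2 * real h + 1"
proof (induction h)
  case (Suc h)
  have step: "\<bar>a\<bar> \<le> 2 * t + 1 \<Longrightarrow> c \<le> 1 \<Longrightarrow> -1 \<le> c \<Longrightarrow> \<bar>a + 2 * c\<bar> \<le> 2 * (1 + t) + 1" for a c t :: real
    unfolding abs_le_iff by auto
  from Suc show ?case
    unfolding dirichlet_kernel_Suc of_nat_Suc
    by (rule step) simp_all
qed (simp add: dirichlet_kernel_0)

lemma dirichlet_kernel_ge: "(2 * real h + 1) * (1 - real h * \<bar>x\<bar>) \<le> dirichlet_kernel h x"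
proof -
  have "of_nat (card {- int h..int h}) * (1 - real h * \<bar>x\<bar>) \<le> dirichlet_kernel h x"
    unfolding dirichlet_kernel_def
  proof (rule sum_bounded_below)
    fix k assume "k \<in> {- int h..int h}"
    then have "\<bar>of_int k * x\<bar> \<le> real h * \<bar>x\<bar>" unfolding abs_mult by (intro mult_right_mono) auto
    moreover have "1 - \<bar>y\<bar> \<le> cos y" for y :: real
      using cmod_cis_diff_le[of y 0] abs_Re_le_cmod[of "cis y - cis 0"] by simp
    ultimately show "1 - real h * \<bar>x\<bar> \<le> cos (of_int k * x)" by (meson diff_left_mono order_trans)
  qed
  then show ?thesis by simp
qed

lemma dirichlet_kernel_le_parabola:
  assumes "real h * \<bar>x\<bar> \<le> pi"
  shows "dirichlet_kernel h x \<le> (2 * real h + 1) * (1 - 2 * real h * (real h + 1) * x\<^sup>2 / (3 * pi\<^sup>2))"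
  using assms
proof (induction h)
  case (Suc h)
  have "real h * \<bar>x\<bar> \<le> real (Suc h) * \<bar>x\<bar>" by (intro mult_right_mono) auto
  with Suc have IH: "dirichlet_kernel h x \<le> (2 * real h + 1) * (1 - 2 * real h * (real h + 1) * x\<^sup>2 / (3 * pi\<^sup>2))"
    by linarith
  have "cos (real (Suc h) * x) \<le> 1 - 2 * (real (Suc h) * x)\<^sup>2 / pi\<^sup>2"
    using Suc.prems by (intro cos_le_parabola) (simp add: abs_mult)
  then have "dirichlet_kernel (Suc h) x \<le> (2 * real h + 1) * (1 - 2 * real h * (real h + 1) * x\<^sup>2 / (3 * pi\<^sup>2)) +
     2 * (1 - 2 * (real (Suc h) * x)\<^sup>2 / pi\<^sup>2)"
    unfolding dirichlet_kernel_Suc by (intro add_mono mult_left_mono IH) auto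
  also have "\<dots> = (2 * real (Suc h) + 1) * (1 - 2 * real (Suc h) * (real (Suc h) + 1) * x\<^sup>2 / (3 * pi\<^sup>2))"
    by (simp add: field_simps power2_eq_square)
  finally show ?case .
qed (simp add: dirichlet_kernel_0)

lemma dirichlet_kernel_decay:
  "\<bar>dirichlet_kernel h x\<bar> * \<bar>sin (x / 2)\<bar> \<le> 1"
  using sin_half_mult_dirichlet_kernel[of x h] abs_sin_le_one[of "(real h + 1 / 2) * x"]
  by (metis abs_mult mult.commute)

text \<open>The kernel either has dropped to half of its maximum, or lies below a parabola of width \<open>1/h\<close>. Away
from 0 its decay gives the former. In the main lobe the parabola bounds each cosine, and the kernel is
nonnegative there by its closed form, so that the bound holds for its absolute value too.\<close>

lemma dirichlet_kernel_peak:
  assumes x: "\<bar>x\<bar> \<le> pi"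
  shows "\<bar>dirichlet_kernel h x\<bar> \<le> (2 * real h + 1) / 2 \<or>
    \<bar>dirichlet_kernel h x\<bar> \<le> (2 * real h + 1) * (1 - (2 * real h)\<^sup>2 * x\<^sup>2 / (6 * pi\<^sup>2))"
proof (cases "(2 * real h + 1) * \<bar>x\<bar> \<ge> 2 * pi")
  case True
  have "x \<noteq> 0" using True pi_gt_zero by (intro notI) simp
  have "\<bar>dirichlet_kernel h x\<bar> * (\<bar>x\<bar> / pi) \<le> \<bar>dirichlet_kernel h x\<bar> * \<bar>sin (x / 2)\<bar>"
    by (intro mult_left_mono abs_sin_half_ge x) auto
  also have "\<dots> \<le> 1" by (rule dirichlet_kernel_decay)
  finally have "\<bar>dirichlet_kernel h x\<bar> * \<bar>x\<bar> \<le> pi" by (simp add: field_simps)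
  also have "\<dots> \<le> (2 * real h + 1) / 2 * \<bar>x\<bar>" using True by simp
  finally have "\<bar>dirichlet_kernel h x\<bar> \<le> (2 * real h + 1) / 2"
    using \<open>x \<noteq> 0\<close> by (simp only: mult_le_cancel_right)
  then show ?thesis ..
next
  case False
  \<comment> \<open>Both sines in \<open>sin_half_mult_dirichlet_kernel\<close> have arguments between 0 and \<open>\<pi>\<close>.\<close>
  have nonneg: "dirichlet_kernel h x \<ge> 0"
  proof (cases "x = 0")
    case True
    then show ?thesis by (simp add: dirichlet_kernel_def)
  next
    case x0: False
    have "sin (\<bar>x\<bar> / 2) > 0" using x x0 by (intro sin_gt_zero) auto
    moreover have "sin ((real h + 1 / 2) * \<bar>x\<bar>) \<ge> 0"
    proof (rule sin_ge_zero)
      have "(real h + 1 / 2) * \<bar>x\<bar> = (2 * real h + 1) * \<bar>x\<bar> / 2" by (simp add: field_simps)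
      with False show "(real h + 1 / 2) * \<bar>x\<bar> \<le> pi" by linarith
    qed simp
    ultimately have "dirichlet_kernel h \<bar>x\<bar> \<ge> 0"
      using sin_half_mult_dirichlet_kernel[of "\<bar>x\<bar>" h] by (metis zero_le_mult_iff not_less)
    moreover have "dirichlet_kernel h \<bar>x\<bar> = dirichlet_kernel h x"
      unfolding dirichlet_kernel_def by (cases "x \<ge> 0") auto
    ultimately show ?thesis by simp
  qed
  have "2 * (real h * \<bar>x\<bar>) \<le> (2 * real h + 1) * \<bar>x\<bar>" by (simp add: distrib_right)
  with False have "real h * \<bar>x\<bar> \<le> pi" by linarith
  then have "dirichlet_kernel h x \<le> (2 * real h + 1) * (1 - 2 * real h * (real h + 1) * x\<^sup>2 / (3 * pi\<^sup>2))"
    by (rule dirichlet_kernel_le_parabola)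
  also have "\<dots> \<le> (2 * real h + 1) * (1 - (2 * real h)\<^sup>2 * x\<^sup>2 / (6 * pi\<^sup>2))"
  proof (intro mult_left_mono diff_left_mono)
    have "(2 * real h)\<^sup>2 * x\<^sup>2 / (6 * pi\<^sup>2) = 2 * real h * real h * x\<^sup>2 / (3 * pi\<^sup>2)"
      by (simp add: field_simps power2_eq_square)
    also have "\<dots> \<le> 2 * real h * (real h + 1) * x\<^sup>2 / (3 * pi\<^sup>2)"
      by (intro divide_right_mono mult_right_mono mult_left_mono) auto
    finally show "(2 * real h)\<^sup>2 * x\<^sup>2 / (6 * pi\<^sup>2) \<le> 2 * real h * (real h + 1) * x\<^sup>2 / (3 * pi\<^sup>2)" .
  qed simp
  finally show ?thesis using nonneg by simp
qed

section \<open>Peaks of a function on a finite set\<close>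

definition position :: "real set \<Rightarrow> real \<Rightarrow> nat" where
  "position S x = card {y \<in> S. y < x}"

text \<open>The value is 0 if \<open>S\<close> has at most \<open>i\<close> elements.\<close>

definition at_position :: "real set \<Rightarrow> nat \<Rightarrow> real" where
  "at_position S i = (\<Sum>x\<in>S. if position S x = i then x else 0)"

lemma position_strict_mono:
  assumes "finite S" "x \<in> S" "x < y"
  shows "position S x < position S y"
  unfolding position_def using assms by (intro psubset_card_mono) auto

lemma position_inj_on: "finite S \<Longrightarrow> inj_on (position S) S"
  by (intro inj_onI) (metis linorder_neqE nat_neq_iff position_strict_mono)

lemma position_bij_betw:
  assumes "finite S"
  shows "bij_betw (position S) S {..<card S}"
proof -
  have "position S ` S \<subseteq> {..<card S}"
    using assms by (auto simp: position_def intro!: psubset_card_mono)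
  moreover have "card (position S ` S) = card {..<card S}"
    using position_inj_on[OF assms] by (simp add: card_image)
  ultimately have "position S ` S = {..<card S}" by (intro card_subset_eq) auto
  then show ?thesis using position_inj_on[OF assms] by (simp add: bij_betw_def)
qed

lemma at_position_position:
  assumes "finite S" "x \<in> S"
  shows "at_position S (position S x) = x"
proof -
  have "at_position S (position S x) = (\<Sum>y\<in>S. if y = x then y else 0)"
    unfolding at_position_def
    using inj_onD[OF position_inj_on[OF assms(1)]] assms(2) by (intro sum.cong) auto
  then show ?thesis using assms by simp
qed

lemma position_image:
  assumes H: "finite H" and mono: "strict_mono_on H g" and b: "b \<in> H"
  shows "position (g ` H) (g b) = position H b"
proof -
  have "{y \<in> g ` H. y < g b} = g ` {x \<in> H. x < b}"
    using b strict_mono_on_less[OF mono] by auto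
  moreover have "inj_on g {x \<in> H. x < b}"
    using strict_mono_on_imp_inj_on[OF mono] by (rule inj_on_subset) auto
  ultimately show ?thesis by (simp add: position_def card_image)
qed

text \<open>Maxima above the threshold over a window of radius \<open>2a\<close>; ties are decided in favour of the leftmost
point, so that two peaks are never closer than \<open>2a\<close>.\<close>

definition peaks :: "real set \<Rightarrow> real \<Rightarrow> real \<Rightarrow> (real \<Rightarrow> real) \<Rightarrow> real set" where
  "peaks G a \<tau> T = {w \<in> G. \<tau> < T w \<and>
     (\<forall>v\<in>G. \<bar>v - w\<bar> < 2 * a \<longrightarrow> T v \<le> T w \<and> (v < w \<longrightarrow> T v < T w))}"

lemma peaks_close_imp_eq:
  assumes "v \<in> peaks G a \<tau> T" "w \<in> peaks G a \<tau> T" "\<bar>v - w\<bar> < 2 * a"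
  shows "v = w"
proof (rule ccontr)
  assume "v \<noteq> w"
  have "\<bar>w - v\<bar> < 2 * a" using assms(3) by (simp add: abs_minus_commute)
  with assms have "T v \<le> T w \<and> (v < w \<longrightarrow> T v < T w)" "T w \<le> T v \<and> (w < v \<longrightarrow> T w < T v)"
    unfolding peaks_def by blast+
  then show False using \<open>v \<noteq> w\<close> by linarith
qed

lemma leftmost_maximum:
  fixes T :: "real \<Rightarrow> real"
  assumes "finite C" "C \<noteq> {}"
  obtains w where "w \<in> C" "\<And>v. v \<in> C \<Longrightarrow> T v \<le> T w" "\<And>v. v \<in> C \<Longrightarrow> v < w \<Longrightarrow> T v < T w"
proof -
  define m where "m = Max (T ` C)"
  define B where "B = {w \<in> C. T w = m}"
  have "m \<in> T ` C" unfolding m_def using assms by (intro Max_in) auto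
  then have B: "finite B" "B \<noteq> {}" using assms by (auto simp: B_def)
  have le: "T v \<le> m" if "v \<in> C" for v unfolding m_def using that assms by (intro Max_ge) auto
  have "Min B \<in> B" using B by (intro Min_in) auto
  then have w: "Min B \<in> C" "T (Min B) = m" by (auto simp: B_def)
  have "T v < m" if "v \<in> C" "v < Min B" for v
  proof -
    have "v \<notin> B" using that(2) B(1) by (meson Min_le linorder_not_le)
    then show ?thesis using le[OF that(1)] that(1) by (auto simp: B_def)
  qed
  then show thesis using that[of "Min B"] w le by auto
qed

text \<open>If \<open>T\<close> exceeds the threshold only within distance \<open>a\<close> of points of \<open>H\<close>, and does so near each of them,
then each point of \<open>H\<close> accounts for exactly one peak. At least one: the leftmost maximum over the points
of \<open>G\<close> within \<open>a\<close> of \<open>b\<close> is a peak, because all other points of its window lie at distance at least \<open>a\<close>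
from all of \<open>L\<close>. At most one: points within \<open>a\<close> of \<open>b\<close> are less than \<open>2a\<close> apart. As \<open>L\<close> is separated, the
correspondence preserves the order.\<close>

lemma peaks_bijection:
  fixes \<theta> :: "real \<Rightarrow> real" and L G :: "real set" and \<delta> :: real
  assumes G: "finite G" and L: "finite L" and a: "a > 0"
    and sep: "\<And>b b'. b \<in> L \<Longrightarrow> b' \<in> L \<Longrightarrow> b \<noteq> b' \<Longrightarrow> 4 * a \<le> \<bar>b - b'\<bar>"
    and near: "\<And>w b. w \<in> G \<Longrightarrow> b \<in> L \<Longrightarrow> \<bar>w - b\<bar> < a \<Longrightarrow> T w \<le> \<theta> b + e"
    and far: "\<And>w. w \<in> G \<Longrightarrow> (\<And>b. b \<in> L \<Longrightarrow> a \<le> \<bar>w - b\<bar>) \<Longrightarrow> T w \<le> e"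
    and hit: "\<And>b. b \<in> L \<Longrightarrow> \<exists>w\<in>G. \<bar>w - b\<bar> < a \<and> \<theta> b - e \<le> T w"
    and light: "e \<le> \<tau>" "\<delta> + e \<le> \<tau>"
    and heavy: "\<And>b. b \<in> L \<Longrightarrow> \<delta> < \<theta> b \<Longrightarrow> \<tau> < \<theta> b - e"
  defines "H \<equiv> {b \<in> L. \<delta> < \<theta> b}"
  shows "\<exists>g. g ` H = peaks G a \<tau> T \<and> strict_mono_on H g \<and>
    (\<forall>b\<in>H. g b \<in> G \<and> \<bar>g b - b\<bar> < a \<and> \<theta> b - e \<le> T (g b))"
proof -
  have ex: "\<exists>w\<in>peaks G a \<tau> T. \<bar>w - b\<bar> < a \<and> \<theta> b - e \<le> T w" if b: "b \<in> H" for b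
  proof -
    define C where "C = {w \<in> G. \<bar>w - b\<bar> < a}"
    have bL: "b \<in> L" using b by (simp add: H_def)
    obtain w0 where w0: "w0 \<in> C" "\<theta> b - e \<le> T w0"
      using hit[OF bL] by (auto simp: C_def)
    have "finite C" "C \<noteq> {}" using G w0 by (auto simp: C_def)
    then obtain w where w: "w \<in> C" "\<And>v. v \<in> C \<Longrightarrow> T v \<le> T w" "\<And>v. v \<in> C \<Longrightarrow> v < w \<Longrightarrow> T v < T w"
      using leftmost_maximum[of C T] by metis
    have Tw: "\<theta> b - e \<le> T w" using w(2)[OF w0(1)] w0(2) by linarith
    then have \<tau>: "\<tau> < T w" using heavy[OF bL] b by (force simp: H_def)
    have wG: "w \<in> G" "\<bar>w - b\<bar> < a" using w(1) by (auto simp: C_def)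
    have "T v \<le> T w \<and> (v < w \<longrightarrow> T v < T w)" if v: "v \<in> G" "\<bar>v - w\<bar> < 2 * a" for v
    proof (cases "v \<in> C")
      case False
      then have vb: "a \<le> \<bar>v - b\<bar>" using v(1) by (auto simp: C_def)
      have "a \<le> \<bar>v - b'\<bar>" if "b' \<in> L" for b'
        using sep[OF bL that] vb wG(2) v(2) a by (cases "b' = b") linarith+
      from far[OF v(1) this] \<tau> light show ?thesis by linarith
    qed (use w in auto)
    then have "w \<in> peaks G a \<tau> T" using wG \<tau> by (auto simp: peaks_def)
    then show ?thesis using wG Tw by blast
  qed
  then obtain g where g: "\<And>b. b \<in> H \<Longrightarrow> g b \<in> peaks G a \<tau> T" "\<And>b. b \<in> H \<Longrightarrow> \<bar>g b - b\<bar> < a"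
    "\<And>b. b \<in> H \<Longrightarrow> \<theta> b - e \<le> T (g b)" by metis
  have "w \<in> g ` H" if w: "w \<in> peaks G a \<tau> T" for w
  proof -
    have wG: "w \<in> G" "\<tau> < T w" using w by (auto simp: peaks_def)
    obtain b where b: "b \<in> L" "\<bar>w - b\<bar> < a"
      using far[OF wG(1)] wG(2) light by (meson linorder_not_le order_less_le_trans)
    have "b \<in> H" using near[OF wG(1) b] b(1) wG(2) light by (auto simp: H_def)
    moreover have "w = g b"
      using peaks_close_imp_eq[OF w g(1)[OF \<open>b \<in> H\<close>]] g(2)[OF \<open>b \<in> H\<close>] b(2) by linarith
    ultimately show ?thesis by blast
  qed
  then have "g ` H = peaks G a \<tau> T" using g(1) by blast
  moreover have "strict_mono_on H g"
  proof (rule strict_mono_onI)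
    fix b b' assume "b \<in> H" "b' \<in> H" "b < b'"
    then show "g b < g b'"
      using sep[of b b'] g(2)[of b] g(2)[of b'] a by (auto simp: H_def)
  qed
  moreover have "\<forall>b\<in>H. g b \<in> G" using g(1) by (auto simp: peaks_def)
  ultimately show ?thesis using g by blast
qed

text \<open>A function of a random subset of a finite set is measurable, whatever it does with the subset.\<close>

lemma measurable_finite_filter:
  assumes G: "finite G" and P: "\<And>w. w \<in> G \<Longrightarrow> Measurable.pred N (\<lambda>x. P x w)"
    and F: "\<And>S. S \<subseteq> G \<Longrightarrow> F S \<in> space K"
  shows "(\<lambda>x. F {w \<in> G. P x w}) \<in> measurable N K"
proof -
  have "(\<lambda>x. {w \<in> G. P x w}) \<in> measurable N (count_space (Pow G))"
  proof (subst measurable_count_space_eq_countable)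
    show "countable (Pow G)" using G by (simp add: countable_finite)
    have "(\<lambda>x. {w \<in> G. P x w}) -` {S} \<inter> space N \<in> sets N" if "S \<in> Pow G" for S
    proof -
      have "(\<lambda>x. {w \<in> G. P x w}) -` {S} \<inter> space N = {x \<in> space N. \<forall>w\<in>G. P x w \<longleftrightarrow> w \<in> S}"
        using that by auto
      also have "\<dots> \<in> sets N"
        using G P by (intro sets.sets_Collect_finite_All) (auto simp: pred_def intro!: sets.sets_Collect)
      finally show ?thesis .
    qed
    then show "(\<lambda>x. {w \<in> G. P x w}) \<in> space N \<rightarrow> Pow G \<and>
      (\<forall>S\<in>Pow G. (\<lambda>x. {w \<in> G. P x w}) -` {S} \<inter> space N \<in> sets N)" by auto
  qed
  moreover have "F \<in> measurable (count_space (Pow G)) K"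
    using F by (auto simp: measurable_count_space_eq1)
  ultimately show ?thesis by (rule measurable_compose)
qed

section \<open>Recovery of frequencies from an approximate transform\<close>

text \<open>The radius \<open>n\<^sup>-\<^sup>1\<^sup>/\<^sup>2\<close> is large compared with the width \<open>1/n\<close> of a peak, and tends to 0, so that eventually it
separates the frequencies.\<close>

definition resolution :: "nat \<Rightarrow> real" where
  "resolution n = real n powr (- 1 / 2)"

text \<open>The multiples of \<open>n\<^sup>-\<^sup>2\<close> in an interval of length \<open>2\<pi>\<close>. The transform is \<open>2\<pi>\<close>-periodic, hence each frequency
must be found once. The interval is shifted to the right of \<open>(-\<pi>, \<pi>]\<close> because the frequency \<open>\<pi>\<close> may occur:
an estimate slightly above \<open>\<pi>\<close> must not be reported as one slightly above \<open>-\<pi>\<close>. Frequencies near \<open>-\<pi>\<close> stay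
inside once \<open>n\<close> is large.\<close>

definition search_grid :: "nat \<Rightarrow> real set" where
  "search_grid n = (\<lambda>j::int. of_int j / real n ^ 2) ` {- 5 * int n ^ 2..5 * int n ^ 2}
     \<inter> {- pi + resolution n<..pi + resolution n}"

text \<open>The exponent must lie between two bounds. The random error is of order \<open>n\<^sup>-\<^sup>1\<^sup>/\<^sup>2\<close> at each point, and a
slightly larger bound holds at all grid points at once; the final accuracy is the square root of the
noise level and must be \<open>o(n\<^sup>-\<^sup>1\<^sup>/\<^sup>5)\<close>. So the exponent must lie between \<open>-1/2\<close> and \<open>-2/5\<close>.\<close>

definition noise_level :: "nat \<Rightarrow> real" where
  "noise_level n = real n powr (- 9 / 20)"

lemma finite_search_grid: "finite (search_grid n)"
  by (simp add: search_grid_def)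

lemma card_search_grid_le: "card (search_grid n) \<le> 10 * n ^ 2 + 1"
proof -
  have "card (search_grid n) \<le> card ((\<lambda>j::int. of_int j / real n ^ 2) ` {- 5 * int n ^ 2..5 * int n ^ 2})"
    unfolding search_grid_def by (intro card_mono) auto
  also have "\<dots> \<le> card {- 5 * int n ^ 2..5 * int n ^ 2}" by (rule card_image_le) simp
  also have "\<dots> = 10 * n ^ 2 + 1"
  proof -
    have "5 * int n ^ 2 + 1 - - 5 * int n ^ 2 = int (10 * n ^ 2 + 1)" by simp
    then show ?thesis by (simp only: card_atLeastAtMost_int nat_int)
  qed
  finally show ?thesis .
qed

lemma resolution_bounds:
  assumes "n \<ge> 1"
  shows "0 < resolution n" "resolution n \<le> 1" "(resolution n)\<^sup>2 = 1 / real n" "1 / real n ^ 2 \<le> resolution n"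
proof -
  have n: "real n \<ge> 1" using assms by simp
  show "0 < resolution n" using n by (simp add: resolution_def)
  have "real n powr (- 1 / 2) \<le> real n powr 0" using n by (intro powr_mono) auto
  then show "resolution n \<le> 1" using n by (simp add: resolution_def)
  have "(resolution n)\<^sup>2 = real n powr (- 1 / 2 + - 1 / 2)"
    unfolding resolution_def power2_eq_square powr_add ..
  also have "\<dots> = 1 / real n" using n by (simp add: powr_minus_divide)
  finally show "(resolution n)\<^sup>2 = 1 / real n" .
  have "real n powr (- 2) \<le> real n powr (- 1 / 2)" using n by (intro powr_mono) auto
  then show "1 / real n ^ 2 \<le> resolution n"
    using n by (simp add: resolution_def powr_minus_divide powr_numeral)
qed

lemma search_grid_hit:
  assumes n: "n \<ge> 1" and b: "- pi + resolution n < b" "b \<le> pi"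
  obtains w where "w \<in> search_grid n" "\<bar>w - b\<bar> \<le> 1 / real n ^ 2" "\<bar>w - b\<bar> < resolution n"
proof -
  define N where "N = real n ^ 2"
  have N: "N \<ge> 1" using n by (simp add: N_def)
  define j where "j = \<lceil>b * N\<rceil>"
  have j: "b * N \<le> of_int j" "of_int j < b * N + 1" unfolding j_def by linarith+
  let ?w = "of_int j / N"
  have w: "b \<le> ?w" "?w < b + 1 / N" using j N by (simp_all add: field_simps)
  have "1 / N \<le> resolution n" using resolution_bounds(4)[OF n] by (simp add: N_def)
  have "\<bar>b\<bar> * N \<le> 4 * N"
    using b resolution_bounds(1)[OF n] pi_less_4 N by (intro mult_right_mono) auto
  then have "\<bar>b * N\<bar> \<le> 4 * N" using N by (simp add: abs_mult)
  then have "\<bar>of_int j\<bar> \<le> 5 * N" using j N by linarith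
  moreover have "5 * N = of_int (5 * int n ^ 2)" by (simp add: N_def)
  ultimately have "\<bar>j\<bar> \<le> 5 * int n ^ 2" by linarith
  then have "j \<in> {- 5 * int n ^ 2..5 * int n ^ 2}" by auto
  then have "?w \<in> search_grid n"
    unfolding search_grid_def using w b \<open>1 / N \<le> resolution n\<close> by (auto simp: N_def)
  moreover have "\<bar>?w - b\<bar> \<le> 1 / N" "\<bar>?w - b\<bar> < resolution n" using w \<open>1 / N \<le> resolution n\<close> by linarith+
  ultimately show thesis using that by (simp add: N_def)
qed

lemma abs_sin_half_ge_away_from_period:
  assumes "0 < a" "a \<le> \<bar>y\<bar>" "\<bar>y\<bar> \<le> 2 * pi - a"
  shows "a / pi \<le> \<bar>sin (y / 2)\<bar>"
proof (cases "\<bar>y\<bar> \<le> pi")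
  case True
  have "a / pi \<le> \<bar>y\<bar> / pi" using assms by (intro divide_right_mono) auto
  also have "\<dots> \<le> \<bar>sin (y / 2)\<bar>" by (rule abs_sin_half_ge[OF True])
  finally show ?thesis .
next
  case False
  have "\<bar>2 * pi - \<bar>y\<bar>\<bar> \<le> pi" using False assms by linarith
  from abs_sin_half_ge[OF this] have "\<bar>2 * pi - \<bar>y\<bar>\<bar> / pi \<le> \<bar>sin (pi - \<bar>y\<bar> / 2)\<bar>"
    by (simp add: diff_divide_distrib)
  also have "\<dots> = \<bar>sin (y / 2)\<bar>" by (cases "y \<ge> 0") auto
  finally have "\<bar>2 * pi - \<bar>y\<bar>\<bar> / pi \<le> \<bar>sin (y / 2)\<bar>" .
  moreover have "a / pi \<le> \<bar>2 * pi - \<bar>y\<bar>\<bar> / pi" using assms by (intro divide_right_mono) auto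
  ultimately show ?thesis by linarith
qed

definition normalized_kernel :: "nat \<Rightarrow> real \<Rightarrow> real" where
  "normalized_kernel n x = dirichlet_kernel (n div 2) x / (real n + 1)"

lemma normalized_kernel_le_1:
  assumes "even n"
  shows "\<bar>normalized_kernel n x\<bar> \<le> 1"
  using dirichlet_kernel_abs_le[of "n div 2" x] assms
  by (auto simp: normalized_kernel_def elim!: evenE)

text \<open>For a difference \<open>y\<close> of a grid point and a frequency, distance from 0 is the same as distance from all
multiples of \<open>2\<pi>\<close>: the shifted interval keeps \<open>y\<close> away from \<open>\<plusminus>2\<pi>\<close>.\<close>

lemma normalized_kernel_far:
  assumes n: "n \<ge> 1" and y: "resolution n \<le> \<bar>y\<bar>" "\<bar>y\<bar> \<le> 2 * pi - resolution n"
  shows "\<bar>normalized_kernel n y\<bar> \<le> pi * resolution n"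
proof -
  let ?a = "resolution n" and ?D = "\<bar>dirichlet_kernel (n div 2) y\<bar>"
  note a = resolution_bounds[OF n]
  have "?D * (?a / pi) \<le> ?D * \<bar>sin (y / 2)\<bar>"
    by (intro mult_left_mono abs_sin_half_ge_away_from_period a(1) y) auto
  also have "\<dots> \<le> 1" by (rule dirichlet_kernel_decay)
  finally have "?D \<le> pi / ?a" using a(1) by (simp add: field_simps)
  then have "?D / (real n + 1) \<le> pi / ?a / (real n + 1)"
    by (intro divide_right_mono) auto
  also have "\<dots> \<le> pi / ?a / real n"
    using n a(1) by (intro divide_left_mono) auto
  also have "\<dots> = pi / ?a * ?a\<^sup>2" by (simp add: a(3))
  also have "\<dots> = pi * ?a" using a(1) by (simp add: power2_eq_square)
  finally show ?thesis by (simp add: normalized_kernel_def abs_divide)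
qed

lemma normalized_kernel_near:
  assumes n: "even n" "n \<ge> 1" and x: "\<bar>x\<bar> \<le> 1 / real n ^ 2"
  shows "1 - 1 / real n \<le> normalized_kernel n x"
proof -
  obtain h where h: "n = 2 * h" using n by (auto elim: evenE)
  have "1 - 1 / real n \<le> 1 - real h * \<bar>x\<bar>"
  proof -
    have "real h * \<bar>x\<bar> \<le> real n * (1 / real n ^ 2)"
      using x by (intro mult_mono) (auto simp: h)
    also have "\<dots> = 1 / real n" using n by (simp add: power2_eq_square)
    finally show ?thesis by simp
  qed
  also have "\<dots> = (2 * real h + 1) * (1 - real h * \<bar>x\<bar>) / (2 * real h + 1)" by simp
  also have "\<dots> \<le> dirichlet_kernel h x / (2 * real h + 1)"
    by (intro divide_right_mono dirichlet_kernel_ge) auto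
  finally show ?thesis by (simp add: normalized_kernel_def h)
qed

lemma normalized_kernel_peak:
  assumes n: "even n" and x: "\<bar>x\<bar> \<le> pi" and w: "1 - \<eta> \<le> \<bar>normalized_kernel n x\<bar>" "\<eta> < 1 / 2"
  shows "(real n * x)\<^sup>2 \<le> 6 * pi\<^sup>2 * \<eta>"
proof -
  obtain h where h: "n = 2 * h" using n by (auto elim: evenE)
  let ?D = "\<bar>dirichlet_kernel h x\<bar>" and ?N = "2 * real h + 1"
  have N: "?N > 0" by simp
  have D: "\<bar>normalized_kernel n x\<bar> = ?D / ?N" by (simp add: normalized_kernel_def h)
  have "\<not> ?D \<le> ?N / 2"
  proof
    assume "?D \<le> ?N / 2"
    then have "?D / ?N \<le> 1 / 2" unfolding pos_divide_le_eq[OF N] by simp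
    with w show False unfolding D by linarith
  qed
  with dirichlet_kernel_peak[OF x, of h] have "?D \<le> ?N * (1 - (2 * real h)\<^sup>2 * x\<^sup>2 / (6 * pi\<^sup>2))" by blast
  then have "?D / ?N \<le> ?N * (1 - (2 * real h)\<^sup>2 * x\<^sup>2 / (6 * pi\<^sup>2)) / ?N"
    by (intro divide_right_mono) auto
  with w have "(2 * real h)\<^sup>2 * x\<^sup>2 / (6 * pi\<^sup>2) \<le> \<eta>" unfolding D by simp
  then show ?thesis by (simp add: h power_mult_distrib field_simps)
qed

text \<open>A deterministic statement. The transform is a sum of kernels centred at the frequencies, with heights
\<open>\<bar>\<theta> b\<bar>\<close>; at a grid point within the resolution of \<open>b\<close> all other kernels together contribute no more than the
noise level. Hence peaks and frequencies correspond. A peak is at least as high as the value at the grid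
point next to \<open>b\<close>, thus the kernel has lost at most the fraction \<open>4 \<epsilon>/\<delta>\<close> of its height, where \<open>\<epsilon>\<close> is the
noise level; as it falls off like \<open>(n x)\<^sup>2\<close>, the error \<open>x\<close> is of order \<open>\<surd>\<epsilon>/n\<close>.\<close>

lemma frequency_recovery:
  fixes L :: "real set" and \<theta> :: "real \<Rightarrow> complex" and T :: "real \<Rightarrow> real" and \<delta> :: real
  defines "\<Theta> \<equiv> \<Sum>b\<in>L. cmod (\<theta> b)" and "H \<equiv> {b \<in> L. \<delta> < cmod (\<theta> b)}"
  assumes n: "even n" "n \<ge> 1" and L: "finite L" and \<delta>: "\<delta> > 0"
    and T: "\<And>w. w \<in> search_grid n \<Longrightarrow>
      \<bar>T w - cmod (\<Sum>b\<in>L. \<theta> b * of_real (normalized_kernel n (b - w)))\<bar> \<le> noise_level n"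
    and sep: "\<And>b b'. b \<in> L \<Longrightarrow> b' \<in> L \<Longrightarrow> b \<noteq> b' \<Longrightarrow> 4 * resolution n \<le> \<bar>b - b'\<bar>"
    and range: "\<And>b. b \<in> L \<Longrightarrow> - pi + 4 * resolution n \<le> b \<and> b \<le> pi"
    and bias: "\<Theta> * (pi * resolution n + 1 / real n) \<le> noise_level n"
    and light: "\<delta> + 2 * noise_level n \<le> \<tau>"
    and heavy: "\<And>b. b \<in> H \<Longrightarrow> \<tau> < cmod (\<theta> b) - 2 * noise_level n"
    and small: "4 * noise_level n / \<delta> < 1 / 2"
    and accurate: "24 * pi\<^sup>2 / \<delta> * noise_level n < (real n powr (- 1 / 5))\<^sup>2"
  shows "\<exists>g. g ` H = peaks (search_grid n) (resolution n) \<tau> T \<and> strict_mono_on H g \<and>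
    (\<forall>b\<in>H. real n * \<bar>g b - b\<bar> < real n powr (- 1 / 5))"
proof -
  let ?a = "resolution n" and ?\<epsilon> = "noise_level n"
  let ?S = "\<lambda>w. \<Sum>b\<in>L. \<theta> b * of_real (normalized_kernel n (b - w))"
  note a = resolution_bounds[OF n(2)]
  have \<epsilon>: "?\<epsilon> \<ge> 0" by (simp add: noise_level_def)
  have \<Theta>: "\<Theta> \<ge> 0" unfolding \<Theta>_def by (intro sum_nonneg) auto
  have bias1: "\<Theta> * (pi * ?a) \<le> ?\<epsilon>"
  proof -
    have "\<Theta> * (pi * ?a) \<le> \<Theta> * (pi * ?a + 1 / real n)" using \<Theta> by (intro mult_left_mono) auto
    with bias show ?thesis by linarith
  qed
  have \<theta>le: "cmod (\<theta> b) \<le> \<Theta>" if "b \<in> L" for b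
    unfolding \<Theta>_def using L that by (intro member_le_sum) auto
  have far_weight: "\<bar>normalized_kernel n (b - w)\<bar> \<le> pi * ?a" if "w \<in> search_grid n" "b \<in> L" "?a \<le> \<bar>w - b\<bar>" for w b
  proof (rule normalized_kernel_far[OF n(2)])
    show "?a \<le> \<bar>b - w\<bar>" using that(3) by linarith
    have "- pi + ?a < w" "w \<le> pi + ?a" using that(1) by (auto simp: search_grid_def)
    with range[OF that(2)] a(1) show "\<bar>b - w\<bar> \<le> 2 * pi - ?a" by linarith
  qed
  have rest: "cmod (\<Sum>b\<in>L'. \<theta> b * of_real (normalized_kernel n (b - w))) \<le> \<Theta> * (pi * ?a)"
    if "w \<in> search_grid n" "L' \<subseteq> L" "\<And>b. b \<in> L' \<Longrightarrow> ?a \<le> \<bar>w - b\<bar>" for w L'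
  proof -
    have "cmod (\<Sum>b\<in>L'. \<theta> b * of_real (normalized_kernel n (b - w))) \<le>
        (\<Sum>b\<in>L'. cmod (\<theta> b) * (pi * ?a))"
      using that far_weight
      by (intro sum_norm_le) (auto simp: norm_mult intro!: mult_left_mono)
    also have "\<dots> \<le> \<Theta> * (pi * ?a)"
      unfolding \<Theta>_def sum_distrib_right using L that(2) a(1) by (intro sum_mono2) auto
    finally show ?thesis .
  qed
  have split: "cmod (?S w - \<theta> b * of_real (normalized_kernel n (b - w))) \<le> \<Theta> * (pi * ?a)"
    if "w \<in> search_grid n" "b \<in> L" "\<bar>w - b\<bar> < ?a" for w b
  proof -
    have "?S w - \<theta> b * of_real (normalized_kernel n (b - w)) = (\<Sum>b\<in>L - {b}. \<theta> b * of_real (normalized_kernel n (b - w)))"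
      using L that(2) by (simp add: sum_diff1)
    also have "cmod \<dots> \<le> \<Theta> * (pi * ?a)"
    proof (rule rest[OF that(1)])
      fix b' assume "b' \<in> L - {b}"
      then show "?a \<le> \<bar>w - b'\<bar>" using sep[of b b'] that a(1) by auto
    qed auto
    finally show ?thesis .
  qed
  have near: "T w \<le> cmod (\<theta> b) * \<bar>normalized_kernel n (b - w)\<bar> + 2 * ?\<epsilon>"
    if "w \<in> search_grid n" "b \<in> L" "\<bar>w - b\<bar> < ?a" for w b
  proof -
    have "cmod (?S w) \<le> cmod (\<theta> b * of_real (normalized_kernel n (b - w))) + \<Theta> * (pi * ?a)"
      using split[OF that] norm_triangle_sub[of "?S w" "\<theta> b * of_real (normalized_kernel n (b - w))"] by linarith
    then show ?thesis using T[OF that(1)] bias1 by (simp add: norm_mult)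
  qed
  have "\<exists>g. g ` {b \<in> L. \<delta> < cmod (\<theta> b)} = peaks (search_grid n) ?a \<tau> T \<and> strict_mono_on {b \<in> L. \<delta> < cmod (\<theta> b)} g \<and>
    (\<forall>b\<in>{b \<in> L. \<delta> < cmod (\<theta> b)}. g b \<in> search_grid n \<and> \<bar>g b - b\<bar> < ?a \<and> cmod (\<theta> b) - 2 * ?\<epsilon> \<le> T (g b))"
  proof (rule peaks_bijection)
    fix w b assume wb: "w \<in> search_grid n" "b \<in> L" "\<bar>w - b\<bar> < ?a"
    have "cmod (\<theta> b) * \<bar>normalized_kernel n (b - w)\<bar> \<le> cmod (\<theta> b) * 1"
      by (intro mult_left_mono normalized_kernel_le_1 n) auto
    then show "T w \<le> cmod (\<theta> b) + 2 * ?\<epsilon>" using near[OF wb] by linarith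
  next
    fix w assume "w \<in> search_grid n" "\<And>b. b \<in> L \<Longrightarrow> ?a \<le> \<bar>w - b\<bar>"
    then show "T w \<le> 2 * ?\<epsilon>" using rest[of w L] T[of w] bias1 by force
  next
    fix b assume b: "b \<in> L"
    obtain w where w: "w \<in> search_grid n" "\<bar>w - b\<bar> \<le> 1 / real n ^ 2" "\<bar>w - b\<bar> < ?a"
      using search_grid_hit[OF n(2), of b] range[OF b] a(1) by auto
    have "cmod (\<theta> b) * (1 - 1 / real n) \<le> cmod (\<theta> b * of_real (normalized_kernel n (b - w)))"
      unfolding norm_mult norm_of_real
      using normalized_kernel_near[OF n, of "b - w"] w(2) by (intro mult_left_mono) (auto simp: abs_minus_commute)
    moreover have "cmod (\<theta> b) * (1 / real n) \<le> \<Theta> * (1 / real n)"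
      by (intro mult_right_mono \<theta>le b) auto
    moreover have "cmod (\<theta> b * of_real (normalized_kernel n (b - w))) - \<Theta> * (pi * ?a) \<le> cmod (?S w)"
      using split[OF w(1) b w(3)] norm_triangle_ineq2[of "\<theta> b * of_real (normalized_kernel n (b - w))" "?S w"]
      by (simp add: norm_minus_commute)
    ultimately have "cmod (\<theta> b) - \<Theta> * (pi * ?a + 1 / real n) \<le> cmod (?S w)"
      by (simp add: algebra_simps)
    then have "cmod (\<theta> b) - 2 * ?\<epsilon> \<le> T w" using T[OF w(1)] bias by linarith
    then show "\<exists>w\<in>search_grid n. \<bar>w - b\<bar> < ?a \<and> cmod (\<theta> b) - 2 * ?\<epsilon> \<le> T w" using w by blast
  next
    fix b assume "b \<in> L" "\<delta> < cmod (\<theta> b)"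
    then show "\<tau> < cmod (\<theta> b) - 2 * ?\<epsilon>" using heavy by (auto simp: H_def)
  qed (use L a(1) sep light \<delta> \<epsilon> finite_search_grid in auto)
  then obtain g where g: "g ` H = peaks (search_grid n) ?a \<tau> T" "strict_mono_on H g"
    "\<And>b. b \<in> H \<Longrightarrow> g b \<in> search_grid n \<and> \<bar>g b - b\<bar> < ?a \<and> cmod (\<theta> b) - 2 * ?\<epsilon> \<le> T (g b)"
    unfolding H_def by blast
  have "real n * \<bar>g b - b\<bar> < real n powr (- 1 / 5)" if b: "b \<in> H" for b
  proof -
    have bL: "b \<in> L" and \<theta>: "\<delta> < cmod (\<theta> b)" using b by (auto simp: H_def)
    have \<theta>0: "cmod (\<theta> b) > 0" using \<theta> \<delta> by linarith
    let ?\<kappa> = "\<bar>normalized_kernel n (b - g b)\<bar>"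
    have "cmod (\<theta> b) - 2 * ?\<epsilon> \<le> cmod (\<theta> b) * ?\<kappa> + 2 * ?\<epsilon>"
      using g(3)[OF b] near[of "g b" b] bL by linarith
    then have "cmod (\<theta> b) * (1 - ?\<kappa>) \<le> 4 * ?\<epsilon>" by (simp add: algebra_simps)
    then have "1 - ?\<kappa> \<le> 4 * ?\<epsilon> / cmod (\<theta> b)" using \<theta>0 by (simp add: field_simps)
    also have "\<dots> \<le> 4 * ?\<epsilon> / \<delta>" using \<theta> \<delta> \<epsilon> \<theta>0 by (intro divide_left_mono mult_pos_pos) auto
    finally have "1 - 4 * ?\<epsilon> / \<delta> \<le> ?\<kappa>" by linarith
    moreover have "\<bar>b - g b\<bar> \<le> pi" using g(3)[OF b] a(2) pi_gt3 by linarith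
    ultimately have "(real n * (b - g b))\<^sup>2 \<le> 6 * pi\<^sup>2 * (4 * ?\<epsilon> / \<delta>)"
      using small by (intro normalized_kernel_peak n)
    also have "\<dots> = 24 * pi\<^sup>2 / \<delta> * ?\<epsilon>" by simp
    finally have "\<bar>real n * (b - g b)\<bar>\<^sup>2 < (real n powr (- 1 / 5))\<^sup>2" using accurate by simp
    then have "\<bar>real n * (b - g b)\<bar> < real n powr (- 1 / 5)" by (rule power2_less_imp_less) simp
    then show ?thesis by (simp add: abs_mult abs_minus_commute)
  qed
  then show ?thesis using g(1,2) by blast
qed

section \<open>The transform of the squared observations\<close>

definition square_transform :: "nat \<Rightarrow> (int \<Rightarrow> real) \<Rightarrow> real \<Rightarrow> complex" where
  "square_transform n y w = (\<Sum>k\<in>obs_window n. of_real (y k) * cis (- (of_int k * w))) / of_real (real n + 1)"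

definition periodogram :: "nat \<Rightarrow> (int \<Rightarrow> real) \<Rightarrow> real \<Rightarrow> real" where
  "periodogram n x w = cmod (square_transform n (\<lambda>k. (x k)\<^sup>2) w)"

text \<open>The margin \<open>n\<^sup>-\<^sup>1\<^sup>/\<^sup>3\<close> above \<open>\<delta>\<close> exceeds twice the noise level, so that a line of mass exactly \<open>\<delta>\<close> is never
detected, and tends to 0, so that each line of mass above \<open>\<delta>\<close> is detected once \<open>n\<close> is large.\<close>

definition detected :: "real \<Rightarrow> nat \<Rightarrow> (int \<Rightarrow> real) \<Rightarrow> real set" where
  "detected \<delta> n x = peaks (search_grid n) (resolution n) (\<delta> + real n powr (- 1 / 3)) (periodogram n x)"

lemma finite_obs_window: "finite (obs_window n)"
  by (simp add: obs_window_def)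

lemma card_obs_window_le: "card (obs_window n) \<le> n + 1"
  by (simp add: obs_window_def)

lemma periodogram_observed: "periodogram n (observed X n \<omega>) = periodogram n (\<lambda>k. X k \<omega>)"
  unfolding periodogram_def square_transform_def observed_def
  by (intro ext arg_cong[where f=cmod] arg_cong2[where f="(/)"] sum.cong) auto

lemma periodogram_measurable: "(\<lambda>x. periodogram n x w) \<in> borel_measurable (obs_space n)"
proof -
  have x: "(\<lambda>x. x k) \<in> borel_measurable (obs_space n)" if "k \<in> obs_window n" for k
    unfolding obs_space_def using that by (rule measurable_component_singleton)
  have "(\<lambda>x. complex_of_real ((x k)\<^sup>2) * cis (- (of_int k * w))) \<in> borel_measurable (obs_space n)"
    if "k \<in> obs_window n" for k
    using measurable_compose[OF borel_measurable_power[OF x[OF that]] borel_measurable_of_real]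
    by (intro borel_measurable_times) auto
  then have "(\<lambda>x. cmod (\<Sum>k\<in>obs_window n. of_real ((x k)\<^sup>2) * cis (- (of_int k * w))) / norm (complex_of_real (real n + 1)))
      \<in> borel_measurable (obs_space n)"
    by (intro borel_measurable_divide borel_measurable_norm borel_measurable_sum) auto
  then show ?thesis
    unfolding periodogram_def square_transform_def norm_divide .
qed

lemma frequency_estimator_detected:
  "frequency_estimator (\<lambda>n x. card (detected \<delta> n x)) (\<lambda>n i x. at_position (detected \<delta> n x) i)"
proof -
  have meas: "(\<lambda>x. F (detected \<delta> n x)) \<in> measurable (obs_space n) K" if "\<And>S. F S \<in> space K" for F K n
  proof -
    have pm: "(\<lambda>x. periodogram n x w) \<in> borel_measurable (obs_space n)" for w
      by (rule periodogram_measurable)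
    have less: "Measurable.pred (obs_space n) (\<lambda>x. f x < g x)"
      and le: "Measurable.pred (obs_space n) (\<lambda>x. f x \<le> g x)"
      if "f \<in> borel_measurable (obs_space n)" "g \<in> borel_measurable (obs_space n)" for f g :: "(int \<Rightarrow> real) \<Rightarrow> real"
      unfolding pred_def using that by (auto intro: borel_measurable_less borel_measurable_le)
    have const: "Measurable.pred (obs_space n) (\<lambda>x. c)" for c by simp
    show ?thesis
      unfolding detected_def peaks_def
    proof (rule measurable_finite_filter[OF finite_search_grid _ that])
      fix w assume "w \<in> search_grid n"
      show "Measurable.pred (obs_space n) (\<lambda>x. \<delta> + real n powr (- 1 / 3) < periodogram n x w \<and>
        (\<forall>v\<in>search_grid n. \<bar>v - w\<bar> < 2 * resolution n \<longrightarrow>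
          periodogram n x v \<le> periodogram n x w \<and> (v < w \<longrightarrow> periodogram n x v < periodogram n x w)))"
        by (intro pred_intros_logic(3,4) pred_intros_finite(3) finite_search_grid less le pm borel_measurable_const const)
    qed
  qed
  show ?thesis
    unfolding frequency_estimator_def
  proof (intro allI conjI)
    fix n i
    show "(\<lambda>x. card (detected \<delta> n x)) \<in> measurable (obs_space n) (count_space UNIV)"
      by (rule meas) simp
    show "(\<lambda>x. at_position (detected \<delta> n x) i) \<in> borel_measurable (obs_space n)"
      by (rule meas[of "\<lambda>S. at_position S i"]) simp
  qed
qed

text \<open>The variances \<open>E X\<^sub>k\<^sup>2\<close> form a finite sum of exponentials in \<open>k\<close>; its transform is a sum of Dirichlet kernels.\<close>

lemma square_transform_mean:
  assumes n: "even n" and y: "\<And>k. of_real (y k) = (\<Sum>b\<in>L. cis (of_int k * b) * \<theta> b)"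
  shows "square_transform n y w = (\<Sum>b\<in>L. \<theta> b * of_real (normalized_kernel n (b - w)))"
proof -
  have "(\<Sum>k\<in>obs_window n. of_real (y k) * cis (- (of_int k * w))) =
      (\<Sum>k\<in>obs_window n. \<Sum>b\<in>L. \<theta> b * cis (of_int k * (b - w)))"
  proof -
    have "cis (of_int k * (b - w)) = cis (of_int k * b) * cis (- (of_int k * w))" for k b
      by (simp add: cis_mult right_diff_distrib)
    then show ?thesis unfolding y sum_distrib_right by (simp only: mult_ac)
  qed
  also have "\<dots> = (\<Sum>b\<in>L. \<theta> b * (\<Sum>k\<in>obs_window n. cis (of_int k * (b - w))))"
    unfolding sum_distrib_left by (rule sum.swap)
  also have "\<dots> = (\<Sum>b\<in>L. \<theta> b * of_real (dirichlet_kernel (n div 2) (b - w)))"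
    unfolding obs_window_def sum_cis_eq_dirichlet_kernel ..
  finally show ?thesis
    unfolding square_transform_def normalized_kernel_def by (simp add: sum_divide_distrib)
qed

lemma square_transform_diff:
  "square_transform n y w - square_transform n y' w = square_transform n (\<lambda>k. y k - y' k) w"
  unfolding square_transform_def
  by (simp add: diff_divide_distrib[symmetric] sum_subtractf[symmetric] left_diff_distrib)

text \<open>At each grid point the real and the imaginary part of the transform are quadratic forms with
coefficients of absolute value at most 1, to which \<open>centered_quadratic_form_tail\<close> applies. There
are at most \<open>10 n\<^sup>2 + 1\<close> grid points, and the union bound suffices.\<close>

lemma (in gaussian_space) uniform_deviation_probability:
  fixes X :: "int \<Rightarrow> 'a \<Rightarrow> real"
  assumes X: "\<And>k. X k \<in> H" and r: "\<And>k m. r k m = (LINT \<omega>|M. X k \<omega> * X m \<omega>)"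
    and row: "\<And>k I. finite I \<Longrightarrow> (\<Sum>m\<in>I. \<bar>r k m\<bar>) \<le> \<rho>" and \<rho>: "\<rho> \<ge> 0"
  defines "A \<equiv> \<lambda>n. {\<omega>\<in>space M. \<exists>w\<in>search_grid n.
      noise_level n < cmod (square_transform n (\<lambda>k. (X k \<omega>)\<^sup>2 - r k k) w)}"
  shows "A n \<in> sets M" and "\<exists>C. \<forall>n\<ge>1. prob (A n) \<le> C / real n ^ 2"
proof -
  have [measurable]: "X k \<in> borel_measurable M" for k
    using all_moments[OF X] by (rule all_moments_measurable)
  define D where "D n w = {\<omega>\<in>space M. noise_level n < cmod (square_transform n (\<lambda>k. (X k \<omega>)\<^sup>2 - r k k) w)}" for n w
  have D: "D n w \<in> sets M" for n w
  proof -
    have "(\<lambda>\<omega>. complex_of_real ((X k \<omega>)\<^sup>2 - r k k) * cis (- (of_int k * w))) \<in> borel_measurable M" for k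
      using measurable_compose[OF _ borel_measurable_of_real, of "\<lambda>\<omega>. (X k \<omega>)\<^sup>2 - r k k"]
      by (intro borel_measurable_times) auto
    then have "(\<lambda>\<omega>. cmod (\<Sum>k\<in>obs_window n. complex_of_real ((X k \<omega>)\<^sup>2 - r k k) * cis (- (of_int k * w)))
        / norm (complex_of_real (real n + 1))) \<in> borel_measurable M"
      by (intro borel_measurable_divide borel_measurable_norm borel_measurable_sum) auto
    then show ?thesis
      unfolding D_def square_transform_def norm_divide by (intro borel_measurable_less) auto
  qed
  have A: "A n = (\<Union>w\<in>search_grid n. D n w)" for n
    by (auto simp: A_def D_def)
  show "A n \<in> sets M"
    unfolding A using D finite_search_grid by (intro sets.finite_UN) auto
  \<comment> \<open>The tail bound is of order \<open>n\<^sup>p\<^sup>+\<^sup>1 (n n\<^sup>-\<^sup>9\<^sup>/\<^sup>2\<^sup>0)\<^sup>-\<^sup>2\<^sup>p = n\<^sup>1\<^sup>-\<^sup>p\<^sup>/\<^sup>1\<^sup>0\<close>; for \<open>p = 50\<close> this is \<open>n\<^sup>-\<^sup>4\<close>, which leaves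
    \<open>n\<^sup>-\<^sup>2\<close> after the union over the grid.\<close>
  define p :: nat where "p = 50"
  define K where "K = (8 * real p * \<rho>\<^sup>2) ^ p * fact (2 * p)"
  have K: "K \<ge> 0" unfolding K_def by (intro mult_nonneg_nonneg) auto
  have tail: "prob (D n w) \<le> 2 * K * 2 ^ (2 * p) / real n ^ 4" if n: "n \<ge> 1" for n w
  proof -
    let ?N = "real n + 1" and ?I = "obs_window n"
    define s where "s = ?N * noise_level n / 2"
    have s: "s > 0" using n by (simp add: s_def noise_level_def)
    let ?Q = "\<lambda>a \<omega>. \<Sum>k\<in>?I. a k * ((X k \<omega>)\<^sup>2 - r k k)"
    let ?E = "\<lambda>a. {\<omega>\<in>space M. \<bar>?Q a \<omega>\<bar> \<ge> s}"
    let ?c = "\<lambda>k. cos (of_int k * w)" and ?s = "\<lambda>k. - sin (of_int k * w)"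
    have E: "?E a \<in> sets M" for a by measurable
    have bound: "prob (?E a) \<le> K * 2 ^ (2 * p) / real n ^ 4" if a: "\<And>k. \<bar>a k\<bar> \<le> 1" for a
    proof -
      have "prob (?E a) \<le> (8 * real p * \<rho>\<^sup>2) ^ p * fact (2 * p) * real (card ?I) ^ Suc p / s ^ (2 * p)"
        by (rule centered_quadratic_form_tail[OF finite_obs_window X r row a _ \<rho> s]) (auto simp: finite_obs_window p_def)
      also have "\<dots> = K * real (card ?I) ^ Suc p / s ^ (2 * p)" unfolding K_def ..
      also have "\<dots> \<le> K * ?N ^ Suc p / s ^ (2 * p)"
        using card_obs_window_le[of n] s K by (intro divide_right_mono mult_left_mono power_mono) auto
      also have "\<dots> = K * 2 ^ (2 * p) * (?N ^ Suc p / (?N ^ (2 * p) * noise_level n ^ (2 * p)))"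
        by (simp add: s_def power_divide power_mult_distrib)
      also have "noise_level n ^ (2 * p) = 1 / real n ^ 45"
      proof -
        have "noise_level n ^ (2 * p) = real n powr (- 9 / 20 * real (2 * p))"
          using n unfolding noise_level_def powr_powr[symmetric] by (subst powr_realpow) auto
        also have "\<dots> = real n powr (- real 45)" by (simp add: p_def)
        also have "\<dots> = 1 / real n ^ 45"
          using n by (subst powr_minus_divide, subst powr_realpow) auto
        finally show ?thesis .
      qed
      also have "?N ^ Suc p / (?N ^ (2 * p) * (1 / real n ^ 45)) = real n ^ 45 / ?N ^ 49"
      proof -
        have N: "?N ^ (2 * p) = ?N ^ Suc p * ?N ^ 49" unfolding power_add[symmetric] by (simp add: p_def)
        have "x / (x * y * (1 / z)) = z / y" if "x \<noteq> 0" for x y z :: real using that by simp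
        from this[of "?N ^ Suc p" "?N ^ 49" "real n ^ 45"] show ?thesis unfolding N by simp
      qed
      also have "K * 2 ^ (2 * p) * (real n ^ 45 / ?N ^ 49) \<le> K * 2 ^ (2 * p) * (real n ^ 45 / real n ^ 49)"
        using n K by (intro mult_left_mono divide_left_mono power_mono) auto
      also have "real n ^ 45 / real n ^ 49 = 1 / real n ^ 4"
      proof -
        have n49: "real n ^ 49 = real n ^ 45 * real n ^ 4" unfolding power_add[symmetric] by simp
        have "x / (x * y) = 1 / y" if "x \<noteq> 0" for x y :: real using that by simp
        from this[of "real n ^ 45" "real n ^ 4"] show ?thesis unfolding n49 using n by simp
      qed
      finally show ?thesis by simp
    qed
    have "D n w \<subseteq> ?E ?c \<union> ?E ?s"
    proof
      fix \<omega> assume \<omega>: "\<omega> \<in> D n w"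
      define z where "z = (\<Sum>k\<in>?I. of_real ((X k \<omega>)\<^sup>2 - r k k) * cis (- (of_int k * w)))"
      have "noise_level n < cmod z / ?N"
        using \<omega> by (simp add: D_def square_transform_def z_def norm_divide del: of_real_add)
      then have "2 * s < cmod z" by (simp add: s_def field_simps)
      also have "\<dots> \<le> \<bar>Re z\<bar> + \<bar>Im z\<bar>" by (rule cmod_le)
      finally have "s \<le> \<bar>Re z\<bar> \<or> s \<le> \<bar>Im z\<bar>" by linarith
      moreover have "Re z = ?Q ?c \<omega>" "Im z = ?Q ?s \<omega>"
        by (simp_all add: z_def mult_ac)
      ultimately show "\<omega> \<in> ?E ?c \<union> ?E ?s" using \<omega> by (auto simp: D_def)
    qed
    then have "prob (D n w) \<le> prob (?E ?c \<union> ?E ?s)"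
      using E by (intro finite_measure_mono) auto
    also have "\<dots> \<le> prob (?E ?c) + prob (?E ?s)"
      using E by (intro measure_Un_le)
    also have "\<dots> \<le> K * 2 ^ (2 * p) / real n ^ 4 + K * 2 ^ (2 * p) / real n ^ 4"
      by (intro add_mono bound) auto
    finally show ?thesis by simp
  qed
  have "prob (A n) \<le> 22 * K * 2 ^ (2 * p) / real n ^ 2" if n: "n \<ge> 1" for n
  proof -
    have "prob (A n) \<le> (\<Sum>w\<in>search_grid n. prob (D n w))"
      unfolding A using D finite_search_grid by (intro finite_measure_subadditive_finite) auto
    also have "\<dots> \<le> of_nat (card (search_grid n)) * (2 * K * 2 ^ (2 * p) / real n ^ 4)"
      by (intro sum_bounded_above tail n)
    also have "\<dots> \<le> (11 * real n ^ 2) * (2 * K * 2 ^ (2 * p) / real n ^ 4)"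
    proof (intro mult_right_mono)
      have "real (card (search_grid n)) \<le> real (10 * n ^ 2 + 1)"
        using card_search_grid_le[of n] by (simp only: of_nat_le_iff)
      also have "\<dots> \<le> 11 * real n ^ 2" using n by simp
      finally show "real (card (search_grid n)) \<le> 11 * real n ^ 2" .
    qed (use K in auto)
    also have "\<dots> = 22 * K * 2 ^ (2 * p) / real n ^ 2"
    proof -
      have "real n ^ 4 = real n ^ 2 * real n ^ 2" unfolding power_add[symmetric] by simp
      then show ?thesis using n by (simp add: field_simps)
    qed
    finally show ?thesis .
  qed
  then show "\<exists>C. \<forall>n\<ge>1. prob (A n) \<le> C / real n ^ 2" by blast
qed

section \<open>Estimation of the frequencies\<close>

text \<open>The conditions under which \<open>n\<close> is large enough for \<open>frequency_recovery\<close>; they depend on the process.\<close>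

definition recoverable :: "real set \<Rightarrow> (real \<Rightarrow> complex) \<Rightarrow> real \<Rightarrow> nat \<Rightarrow> bool" where
  "recoverable L \<theta> \<delta> n \<longleftrightarrow> n \<ge> 1 \<and>
     (\<forall>b\<in>L. \<forall>b'\<in>L. b \<noteq> b' \<longrightarrow> 4 * resolution n \<le> \<bar>b - b'\<bar>) \<and>
     (\<forall>b\<in>L. - pi + 4 * resolution n \<le> b \<and> b \<le> pi) \<and>
     (\<Sum>b\<in>L. cmod (\<theta> b)) * (pi * resolution n + 1 / real n) \<le> noise_level n \<and>
     \<delta> + 2 * noise_level n \<le> \<delta> + real n powr (- 1 / 3) \<and>
     (\<forall>b\<in>{b \<in> L. \<delta> < cmod (\<theta> b)}. \<delta> + real n powr (- 1 / 3) < cmod (\<theta> b) - 2 * noise_level n) \<and>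
     4 * noise_level n / \<delta> < 1 / 2 \<and>
     24 * pi\<^sup>2 / \<delta> * noise_level n < (real n powr (- 1 / 5))\<^sup>2"

lemma eventually_recoverable:
  assumes L: "finite L" "L \<subseteq> {-pi<..pi}" and \<delta>: "\<delta> > 0"
  shows "\<forall>\<^sub>F n in sequentially. recoverable L \<theta> \<delta> n"
proof -
  have res: "(\<lambda>n. 4 * resolution n) \<longlonglongrightarrow> 0"
    unfolding resolution_def by real_asymp
  have below: "\<forall>\<^sub>F n in sequentially. g n < c" if "g \<longlonglongrightarrow> 0" "0 < c" for g :: "nat \<Rightarrow> real" and c
    using order_tendstoD(2)[OF that] .
  have sep: "\<forall>\<^sub>F n in sequentially. \<forall>b\<in>L. \<forall>b'\<in>L. b \<noteq> b' \<longrightarrow> 4 * resolution n \<le> \<bar>b - b'\<bar>"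
  proof (intro eventually_ball_finite L ballI)
    fix b b'
    show "\<forall>\<^sub>F n in sequentially. b \<noteq> b' \<longrightarrow> 4 * resolution n \<le> \<bar>b - b'\<bar>"
    proof (cases "b = b'")
      case False
      then show ?thesis using below[OF res, of "\<bar>b - b'\<bar>"] by (auto elim!: eventually_mono)
    qed simp
  qed
  have range: "\<forall>\<^sub>F n in sequentially. \<forall>b\<in>L. - pi + 4 * resolution n \<le> b \<and> b \<le> pi"
  proof (intro eventually_ball_finite L ballI)
    fix b assume "b \<in> L"
    then have b: "0 < b + pi" "b \<le> pi" using L(2) by auto
    from below[OF res b(1)] show "\<forall>\<^sub>F n in sequentially. - pi + 4 * resolution n \<le> b \<and> b \<le> pi"
      by eventually_elim (use b in auto)
  qed
  have bias: "\<forall>\<^sub>F n in sequentially. (\<Sum>b\<in>L. cmod (\<theta> b)) * (pi * resolution n + 1 / real n) \<le> noise_level n"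
  proof -
    have "(\<lambda>n. (pi * resolution n + 1 / real n) / noise_level n) \<longlonglongrightarrow> 0"
      unfolding resolution_def noise_level_def by real_asymp
    then have "(\<lambda>n. (\<Sum>b\<in>L. cmod (\<theta> b)) * ((pi * resolution n + 1 / real n) / noise_level n)) \<longlonglongrightarrow> 0"
      by (rule tendsto_mult_right_zero)
    from below[OF this zero_less_one] eventually_ge_at_top[of 1] show ?thesis
    proof eventually_elim
      case (elim n)
      have "noise_level n > 0" using elim by (simp add: noise_level_def)
      with elim show ?case by (simp add: field_simps)
    qed
  qed
  have light: "\<forall>\<^sub>F n in sequentially. \<delta> + 2 * noise_level n \<le> \<delta> + real n powr (- 1 / 3)"
    unfolding noise_level_def add_le_cancel_left by real_asymp
  have heavy: "\<forall>\<^sub>F n in sequentially. \<forall>b\<in>{b \<in> L. \<delta> < cmod (\<theta> b)}.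
      \<delta> + real n powr (- 1 / 3) < cmod (\<theta> b) - 2 * noise_level n"
  proof (intro eventually_ball_finite ballI)
    fix b assume b: "b \<in> {b \<in> L. \<delta> < cmod (\<theta> b)}"
    have "(\<lambda>n. real n powr (- 1 / 3) + 2 * noise_level n) \<longlonglongrightarrow> 0"
      unfolding noise_level_def by real_asymp
    from below[OF this, of "cmod (\<theta> b) - \<delta>"] b
    show "\<forall>\<^sub>F n in sequentially. \<delta> + real n powr (- 1 / 3) < cmod (\<theta> b) - 2 * noise_level n"
      by (auto elim!: eventually_mono)
  qed (use L in auto)
  have small: "\<forall>\<^sub>F n in sequentially. 4 * noise_level n / \<delta> < 1 / 2"
  proof -
    have "noise_level \<longlonglongrightarrow> 0" unfolding noise_level_def[abs_def] by real_asymp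
    from below[OF this, of "\<delta> / 8"] \<delta> show ?thesis
      by (auto elim!: eventually_mono simp: field_simps)
  qed
  have accurate: "\<forall>\<^sub>F n in sequentially. 24 * pi\<^sup>2 / \<delta> * noise_level n < (real n powr (- 1 / 5))\<^sup>2"
  proof -
    have "(\<lambda>n. noise_level n / (real n powr (- 1 / 5))\<^sup>2) \<longlonglongrightarrow> 0"
      unfolding noise_level_def by real_asymp
    then have "(\<lambda>n. 24 * pi\<^sup>2 / \<delta> * (noise_level n / (real n powr (- 1 / 5))\<^sup>2)) \<longlonglongrightarrow> 0"
      by (rule tendsto_mult_right_zero)
    from below[OF this zero_less_one] eventually_ge_at_top[of 1] show ?thesis
    proof eventually_elim
      case (elim n)
      have "(real n powr (- 1 / 5))\<^sup>2 > 0" using elim by simp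
      moreover have "24 * pi\<^sup>2 / \<delta> * noise_level n / (real n powr (- 1 / 5))\<^sup>2 < 1" using elim by simp
      ultimately show ?case by (simp only: divide_less_eq_1_pos)
    qed
  qed
  from eventually_ge_at_top[of 1] sep range bias light heavy small accurate
  show ?thesis by eventually_elim (simp only: recoverable_def)
qed

lemma detected_recovers:
  assumes n: "even n" and L: "finite L" and \<delta>: "\<delta> > 0" and rec: "recoverable L \<theta> \<delta> n"
    and dev: "\<And>w. w \<in> search_grid n \<Longrightarrow>
      \<bar>periodogram n x w - cmod (\<Sum>b\<in>L. \<theta> b * of_real (normalized_kernel n (b - w)))\<bar> \<le> noise_level n"
  defines "H \<equiv> {b \<in> L. \<delta> < cmod (\<theta> b)}"
  shows "card (detected \<delta> n x) = card H"
    and "b \<in> H \<Longrightarrow> real n * \<bar>at_position (detected \<delta> n x) (position H b) - b\<bar> < real n powr (- 1 / 5)"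
proof -
  have "\<exists>g. g ` H = detected \<delta> n x \<and> strict_mono_on H g \<and>
    (\<forall>b\<in>H. real n * \<bar>g b - b\<bar> < real n powr (- 1 / 5))"
    unfolding detected_def H_def
    by (rule frequency_recovery[OF n _ L \<delta> dev]) (use rec in \<open>auto simp: recoverable_def\<close>)
  then obtain g where g: "g ` H = detected \<delta> n x" "strict_mono_on H g"
    "\<And>b. b \<in> H \<Longrightarrow> real n * \<bar>g b - b\<bar> < real n powr (- 1 / 5)" by blast
  have H: "finite H" using L by (simp add: H_def)
  show "card (detected \<delta> n x) = card H"
    using g(1) strict_mono_on_imp_inj_on[OF g(2)] by (metis card_image)
  show "real n * \<bar>at_position (detected \<delta> n x) (position H b) - b\<bar> < real n powr (- 1 / 5)" if b: "b \<in> H"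
  proof -
    have "at_position (g ` H) (position (g ` H) (g b)) = g b" using H b by (intro at_position_position) auto
    then have "at_position (detected \<delta> n x) (position H b) = g b"
      using position_image[OF H g(2) b] g(1) by simp
    then show ?thesis using g(3)[OF b] by simp
  qed
qed

text \<open>Summable line coefficients make the covariance matrices uniformly bounded, although the process is not
stationary: the phases \<open>e\<^sup>i\<^sup>k\<^sup>b\<close> have absolute value 1.\<close>

lemma covariance_row_sum_bounded:
  assumes cov: "\<And>k m. of_real (r k m) = (\<Sum>b\<in>L. cis (of_int k * b) * \<gamma> b (k - m))"
    and c: "\<And>b j. b \<in> L \<Longrightarrow> cmod (\<gamma> b j) \<le> c j" "\<And>j. 0 \<le> c j" "c summable_on UNIV"
    and I: "finite (I :: int set)"
  shows "(\<Sum>m\<in>I. \<bar>r k m\<bar>) \<le> real (card L) * infsum c UNIV"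
proof -
  have "\<bar>r k m\<bar> \<le> real (card L) * c (k - m)" for m
  proof -
    have "\<bar>r k m\<bar> = cmod (of_real (r k m))" by simp
    also have "\<dots> \<le> (\<Sum>b\<in>L. c (k - m))"
      unfolding cov using c(1) by (intro sum_norm_le) (simp add: norm_mult)
    finally show ?thesis by simp
  qed
  then have "(\<Sum>m\<in>I. \<bar>r k m\<bar>) \<le> real (card L) * (\<Sum>m\<in>I. c (k - m))"
    unfolding sum_distrib_left by (intro sum_mono)
  also have "(\<Sum>m\<in>I. c (k - m)) = (\<Sum>j\<in>(\<lambda>m. k - m) ` I. c j)"
    by (subst sum.reindex) (auto simp: inj_on_def)
  also have "\<dots> \<le> infsum c UNIV"
    using c I by (intro finite_sum_le_infsum) auto
  finally show ?thesis by (simp add: mult_left_mono)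
qed

theorem theorem4:
  fixes \<delta> :: real
  assumes "\<delta> > 0"
  shows "\<exists>m w. frequency_estimator m w \<and>
    (\<forall>(M :: 'a measure) X Z f.
       regular_gaussian_ap M X Z f \<and> dominated_line_coeffs f \<and> nonzero_line_masses f \<longrightarrow>
       (\<exists>\<sigma> A.
          bij_betw \<sigma> (heavy_freqs f \<delta>) {..<card (heavy_freqs f \<delta>)} \<and>
          (\<forall>n. A n \<in> sets M) \<and>
          (\<lambda>n. measure M (A n)) \<in> O(\<lambda>n. ln (real n) / real n ^ 2) \<and>
          (\<forall>\<^sub>F n in sequentially. even n \<longrightarrow>
             (\<forall>\<omega>\<in>space M - A n.
                m n (observed X n \<omega>) = card (heavy_freqs f \<delta>) \<and>
                (\<forall>b\<in>heavy_freqs f \<delta>.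
                   real n * \<bar>w n (\<sigma> b) (observed X n \<omega>) - b\<bar> < real n powr (- 1 / 5))))))"
proof (rule exI[of _ "\<lambda>n x. card (detected \<delta> n x)"],
    rule exI[of _ "\<lambda>n i x. at_position (detected \<delta> n x) i"], intro conjI allI impI)
  show "frequency_estimator (\<lambda>n x. card (detected \<delta> n x)) (\<lambda>n i x. at_position (detected \<delta> n x) i)"
    by (rule frequency_estimator_detected)
next
  fix M :: "'a measure" and X Z f
  assume *: "regular_gaussian_ap M X Z f \<and> dominated_line_coeffs f \<and> nonzero_line_masses f"
  define L where "L = line_freqs f"
  define r where "r = covariance M X"
  have M: "prob_space M" and zero: "\<And>k. (LINT \<omega>|M. X k \<omega>) = 0" and L: "finite L"
    and G: "gaussian_family M X"
    and cov: "\<And>k m. of_real (r k m) = (\<Sum>b\<in>L. cis (of_int k * b) * line_coeff f b (k - m))"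
    using * prob_space.covariance_line_expansion[of M X Z f]
    unfolding regular_gaussian_ap_def L_def r_def by auto
  interpret gaussian_space M "linear_combinations X"
    using M G zero by (rule gaussian_space_linear_combinations)
  obtain c :: "int \<Rightarrow> real" where c: "\<And>b j. b \<in> L \<Longrightarrow> cmod (line_coeff f b j) \<le> c j" "\<And>j. 0 \<le> c j" "c summable_on UNIV"
    using * unfolding dominated_line_coeffs_def L_def by auto
  define \<rho> where "\<rho> = real (card L) * infsum c UNIV"
  have \<rho>: "\<rho> \<ge> 0" unfolding \<rho>_def using c by (intro mult_nonneg_nonneg infsum_nonneg) auto
  have row: "(\<Sum>m\<in>I. \<bar>r k m\<bar>) \<le> \<rho>" if "finite I" for k I
    unfolding \<rho>_def using covariance_row_sum_bounded[OF cov c that] .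
  have mean: "of_real (r k k) = (\<Sum>b\<in>L. cis (of_int k * b) * line_mass f b)" for k
    unfolding cov line_coeff_def line_mass_def by simp
  define A where "A n = {\<omega>\<in>space M. \<exists>w\<in>search_grid n.
      noise_level n < cmod (square_transform n (\<lambda>k. (X k \<omega>)\<^sup>2 - r k k) w)}" for n
  note dev = uniform_deviation_probability[where X=X and r=r, OF linear_combinations_self _ row \<rho>, folded A_def]
  have rX: "r k m = (LINT \<omega>|M. X k \<omega> * X m \<omega>)" for k m by (simp add: r_def covariance_def)
  have H: "heavy_freqs f \<delta> = {b \<in> L. \<delta> < cmod (line_mass f b)}"
    by (simp add: heavy_freqs_def L_def)
  show "\<exists>\<sigma> A.
          bij_betw \<sigma> (heavy_freqs f \<delta>) {..<card (heavy_freqs f \<delta>)} \<and>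
          (\<forall>n. A n \<in> sets M) \<and>
          (\<lambda>n. measure M (A n)) \<in> O(\<lambda>n. ln (real n) / real n ^ 2) \<and>
          (\<forall>\<^sub>F n in sequentially. even n \<longrightarrow>
             (\<forall>\<omega>\<in>space M - A n.
                card (detected \<delta> n (observed X n \<omega>)) = card (heavy_freqs f \<delta>) \<and>
                (\<forall>b\<in>heavy_freqs f \<delta>.
                   real n * \<bar>at_position (detected \<delta> n (observed X n \<omega>)) (\<sigma> b) - b\<bar> < real n powr (- 1 / 5))))"
  proof (intro exI conjI allI)
    show "bij_betw (position (heavy_freqs f \<delta>)) (heavy_freqs f \<delta>) {..<card (heavy_freqs f \<delta>)}"
      using L by (intro position_bij_betw) (simp add: H)
    show "A n \<in> sets M" for n by (rule dev(1)) (rule rX)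
    obtain C where C: "\<And>n. n \<ge> 1 \<Longrightarrow> prob (A n) \<le> C / real n ^ 2"
      using dev(2)[OF rX] by blast
    show "(\<lambda>n. measure M (A n)) \<in> O(\<lambda>n. ln (real n) / real n ^ 2)"
    proof -
      have "(\<lambda>n. measure M (A n)) \<in> O(\<lambda>n. 1 / real n ^ 2)"
        by (rule bigoI[of _ C]) (use C in \<open>auto intro!: eventually_mono[OF eventually_ge_at_top[of 1]]\<close>)
      also have "(\<lambda>n. 1 / real n ^ 2) \<in> O(\<lambda>n. ln (real n) / real n ^ 2)" by real_asymp
      finally show ?thesis .
    qed
    have "L \<subseteq> {-pi<..pi}" by (auto simp: L_def line_freqs_def)
    from eventually_recoverable[OF L this assms, of "line_mass f"]
    show "\<forall>\<^sub>F n in sequentially. even n \<longrightarrow>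
             (\<forall>\<omega>\<in>space M - A n.
                card (detected \<delta> n (observed X n \<omega>)) = card (heavy_freqs f \<delta>) \<and>
                (\<forall>b\<in>heavy_freqs f \<delta>.
                   real n * \<bar>at_position (detected \<delta> n (observed X n \<omega>)) (position (heavy_freqs f \<delta>) b) - b\<bar> < real n powr (- 1 / 5)))"
    proof eventually_elim
      case (elim n)
      show ?case
      proof (intro impI ballI)
        fix \<omega> assume n: "even n" and \<omega>: "\<omega> \<in> space M - A n"
        have "\<bar>periodogram n (observed X n \<omega>) w -
            cmod (\<Sum>b\<in>L. line_mass f b * of_real (normalized_kernel n (b - w)))\<bar> \<le> noise_level n"
          if w: "w \<in> search_grid n" for w
        proof -
          have "\<bar>periodogram n (observed X n \<omega>) w - cmod (square_transform n (\<lambda>k. r k k) w)\<bar> \<le>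
              cmod (square_transform n (\<lambda>k. (X k \<omega>)\<^sup>2) w - square_transform n (\<lambda>k. r k k) w)"
            unfolding periodogram_observed unfolding periodogram_def by (rule norm_triangle_ineq3)
          also have "\<dots> \<le> noise_level n"
            unfolding square_transform_diff using \<omega> w by (force simp: A_def)
          finally show ?thesis unfolding square_transform_mean[OF n mean] .
        qed
        note recovered = detected_recovers[OF n L assms elim this, folded H]
        then show "card (detected \<delta> n (observed X n \<omega>)) = card (heavy_freqs f \<delta>) \<and>
                (\<forall>b\<in>heavy_freqs f \<delta>.
                   real n * \<bar>at_position (detected \<delta> n (observed X n \<omega>)) (position (heavy_freqs f \<delta>) b) - b\<bar> < real n powr (- 1 / 5))"
          by blast
      qed
    qed
  qed
qed

end
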